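(* Let $G$ be a PTPG. If there exists a non-trivial $L$-shaped floor-plan corresponding to $G$, then: (i) $G$ contains at most five corner implying paths (CIPs); and (ii) $G$ contains at least one triplet $(a,b,c)$ of exterior vertices (so $(a,b)$ and $(b,c)$ are edges of $G$) such that $a$ is not adjacent to $c$, and $a$ and $c$ have no common neighbour other than $b$.
   Context: A PTPG (properly triangulated planar graph) is a bi-connected plane graph in which every face except the exterior face is a triangle and which has no separating triangle (a cycle of length three with at least one vertex in its interior). Exterior vertices are those on the outer face. A corner implying path (CIP) is a path of consecutive vertices $u_1,u_2,\dots,u_n$ on the outer boundary of $G$ such that $u_1$ and $u_n$ are adjacent and no other pair of non-consecutive vertices of the path is adjacent. A triplet $(a,b,c)$ denotes three vertices such that $(a,b)$ and $(b,c)$ are edges. A floor-plan is a partition of a polygon by axis-parallel segments into modules; two modules are adjacent if they share a wall segment of positive length. An $L$-shaped floor-plan is a floor-plan all of whose modules are rectangles and whose boundary is a rectilinear polygon with exactly one concave corner (a corner with interior angle $270^\circ$). It is non-trivial if it cannot be transformed into a rectangular floor-plan by stretching or shrinking its outer walls while preserving all adjacencies between modules. A floor-plan corresponds to $G$ if its modules are in bijection with the vertices of $G$ and two modules are adjacent exactly when the corresponding vertices are adjacent in $G$. *)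

theory Defs
  imports "HOL-Analysis.Analysis"
begin

text \<open>
  A plane graph is a pair of a finite set \<open>V\<close> of points of the plane and a set \<open>E\<close> of arcs,
  given as point sets. The two endpoints of an edge \<open>e\<close> are recovered as \<open>e \<inter> V\<close>; the third and
  fourth conditions exclude parallel edges and crossings.
\<close>

definition plane_graph :: "complex set \<Rightarrow> complex set set \<Rightarrow> bool" where
  "plane_graph V E \<longleftrightarrow>
     finite V \<and>
     (\<forall>e\<in>E. \<exists>g. arc g \<and> path_image g = e \<and> e \<inter> V = {pathstart g, pathfinish g}) \<and>
     (\<forall>e\<in>E. \<forall>e'\<in>E. e \<noteq> e' \<longrightarrow> e \<inter> V \<noteq> e' \<inter> V) \<and>
     (\<forall>e\<in>E. \<forall>e'\<in>E. e \<noteq> e' \<longrightarrow> e \<inter> e' \<subseteq> V)"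

definition adj :: "complex set \<Rightarrow> complex set set \<Rightarrow> complex \<Rightarrow> complex \<Rightarrow> bool" where
  "adj V E u v \<longleftrightarrow> (\<exists>e\<in>E. e \<inter> V = {u, v})"

definition connected_graph_on :: "complex set \<Rightarrow> (complex \<Rightarrow> complex \<Rightarrow> bool) \<Rightarrow> bool" where
  "connected_graph_on U A \<longleftrightarrow>
     (\<forall>u\<in>U. \<forall>v\<in>U. (u, v) \<in> {(x, y). x \<in> U \<and> y \<in> U \<and> A x y}\<^sup>*)"

definition biconnected :: "complex set \<Rightarrow> complex set set \<Rightarrow> bool" where
  "biconnected V E \<longleftrightarrow>
     V \<noteq> {} \<and> connected_graph_on V (adj V E) \<and>
     (\<forall>w\<in>V. connected_graph_on (V - {w}) (adj V E))"

text \<open>The point set of the drawing of a cycle of length three.\<close>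

definition is_triangle :: "complex set \<Rightarrow> complex set set \<Rightarrow> complex set \<Rightarrow> bool" where
  "is_triangle V E T \<longleftrightarrow>
     (\<exists>u v w. \<exists>e1\<in>E. \<exists>e2\<in>E. \<exists>e3\<in>E. distinct [u, v, w] \<and>
        e1 \<inter> V = {u, v} \<and> e2 \<inter> V = {v, w} \<and> e3 \<inter> V = {w, u} \<and> T = e1 \<union> e2 \<union> e3)"

definition faces :: "complex set \<Rightarrow> complex set set \<Rightarrow> complex set set" where
  "faces V E = components (- (V \<union> \<Union>E))"

definition exterior_face :: "complex set \<Rightarrow> complex set set \<Rightarrow> complex set" where
  "exterior_face V E = outside (V \<union> \<Union>E)"

definition PTPG :: "complex set \<Rightarrow> complex set set \<Rightarrow> bool" where
  "PTPG V E \<longleftrightarrow>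
     plane_graph V E \<and> biconnected V E \<and>
     (\<forall>f \<in> faces V E - {exterior_face V E}. is_triangle V E (frontier f)) \<and>
     \<not> (\<exists>T. is_triangle V E T \<and> V \<inter> inside T \<noteq> {})"

definition exterior_vertices :: "complex set \<Rightarrow> complex set set \<Rightarrow> complex set" where
  "exterior_vertices V E = V \<inter> frontier (exterior_face V E)"

definition boundary_adj :: "complex set \<Rightarrow> complex set set \<Rightarrow> complex \<Rightarrow> complex \<Rightarrow> bool" where
  "boundary_adj V E u v \<longleftrightarrow>
     (\<exists>e\<in>E. e \<inter> V = {u, v} \<and> e \<subseteq> frontier (exterior_face V E))"

text \<open>
  The end vertices are themselves a non-consecutive pair: the edge joining them is not an edge of
  the outer boundary. (Otherwise a chordless outer cycle minus any one of its edges would count.)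
\<close>

definition corner_implying_path :: "complex set \<Rightarrow> complex set set \<Rightarrow> complex list \<Rightarrow> bool" where
  "corner_implying_path V E us \<longleftrightarrow>
     length us \<ge> 3 \<and> distinct us \<and> set us \<subseteq> V \<and>
     (\<forall>i. i + 1 < length us \<longrightarrow> boundary_adj V E (us ! i) (us ! (i + 1))) \<and>
     adj V E (hd us) (last us) \<and> \<not> boundary_adj V E (hd us) (last us) \<and>
     (\<forall>i j. i + 1 < j \<and> j < length us \<and> (i, j) \<noteq> (0, length us - 1) \<longrightarrow>
        \<not> adj V E (us ! i) (us ! j))"

text \<open>Undirected paths: a vertex list is identified with its reversal.\<close>

definition CIPs :: "complex set \<Rightarrow> complex set set \<Rightarrow> complex list set set" where
  "CIPs V E = (\<lambda>us. {us, rev us}) ` {us. corner_implying_path V E us}"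

definition rectilinear_polygon :: "complex set \<Rightarrow> bool" where
  "rectilinear_polygon P \<longleftrightarrow>
     (\<exists>g S. simple_path g \<and> pathfinish g = pathstart g \<and>
        finite S \<and> (\<forall>s\<in>S. \<exists>p q. s = closed_segment p q \<and> (Re p = Re q \<or> Im p = Im q)) \<and>
        path_image g = \<Union>S \<and> P = path_image g \<union> inside (path_image g))"

text \<open>
  Interior angle of 270 degrees: near \<open>p\<close>, the region \<open>P\<close> is the plane minus one open quadrant
  with apex \<open>p\<close>.
\<close>

definition concave_corner :: "complex set \<Rightarrow> complex \<Rightarrow> bool" where
  "concave_corner P p \<longleftrightarrow>
     (\<exists>\<epsilon>>0. \<exists>s\<in>{-1, 1}. \<exists>t\<in>{-1, 1}. \<forall>z\<in>ball p \<epsilon>.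
        z \<in> P \<longleftrightarrow> \<not> (s * (Re z - Re p) > 0 \<and> t * (Im z - Im p) > 0))"

definition rectangle :: "complex set \<Rightarrow> bool" where
  "rectangle R \<longleftrightarrow> (\<exists>a b. Re a < Re b \<and> Im a < Im b \<and> R = cbox a b)"

text \<open>A floor-plan is given by its set of modules; the partitioned polygon is their union.\<close>

definition floor_plan :: "complex set set \<Rightarrow> bool" where
  "floor_plan F \<longleftrightarrow>
     finite F \<and> rectilinear_polygon (\<Union>F) \<and> (\<forall>M\<in>F. rectilinear_polygon M) \<and>
     pairwise (\<lambda>M N. interior M \<inter> interior N = {}) F"

definition rectangular_floor_plan :: "complex set set \<Rightarrow> bool" where
  "rectangular_floor_plan F \<longleftrightarrow>
     floor_plan F \<and> (\<forall>M\<in>F. rectangle M) \<and> rectangle (\<Union>F)"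

definition L_shaped_floor_plan :: "complex set set \<Rightarrow> bool" where
  "L_shaped_floor_plan F \<longleftrightarrow>
     floor_plan F \<and> (\<forall>M\<in>F. rectangle M) \<and> card {p. concave_corner (\<Union>F) p} = 1"

definition adjacent_modules :: "complex set \<Rightarrow> complex set \<Rightarrow> bool" where
  "adjacent_modules M N \<longleftrightarrow>
     M \<noteq> N \<and> (\<exists>p q. p \<noteq> q \<and> closed_segment p q \<subseteq> frontier M \<inter> frontier N)"

text \<open>
  \<open>\<sigma>\<close> deforms each rectangular module by displacing only sides that are outer walls, that is,
  sides lying on the boundary of the partitioned polygon; every other side stays on its line,
  although it may become longer or shorter. Lengthening an outer wall is the same as displacing
  the outer walls perpendicular to it at its end.
\<close>

definition outer_wall_deformation ::
  "complex set set \<Rightarrow> (complex set \<Rightarrow> complex set) \<Rightarrow> bool" where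
  "outer_wall_deformation F \<sigma> \<longleftrightarrow>
     (\<forall>a b. Re a < Re b \<and> Im a < Im b \<and> cbox a b \<in> F \<longrightarrow>
       (\<exists>a' b'. Re a' < Re b' \<and> Im a' < Im b' \<and> \<sigma> (cbox a b) = cbox a' b' \<and>
          (Re a' = Re a \<or> {z \<in> cbox a b. Re z = Re a} \<subseteq> frontier (\<Union>F)) \<and>
          (Re b' = Re b \<or> {z \<in> cbox a b. Re z = Re b} \<subseteq> frontier (\<Union>F)) \<and>
          (Im a' = Im a \<or> {z \<in> cbox a b. Im z = Im a} \<subseteq> frontier (\<Union>F)) \<and>
          (Im b' = Im b \<or> {z \<in> cbox a b. Im z = Im b} \<subseteq> frontier (\<Union>F))))"

text \<open>
  Adjacencies are preserved in both directions: a deformation creating new adjacencies does not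
  count.
\<close>

definition nontrivial :: "complex set set \<Rightarrow> bool" where
  "nontrivial F \<longleftrightarrow>
     \<not> (\<exists>\<sigma>. outer_wall_deformation F \<sigma> \<and> inj_on \<sigma> F \<and> rectangular_floor_plan (\<sigma> ` F) \<and>
          (\<forall>M\<in>F. \<forall>N\<in>F. adjacent_modules (\<sigma> M) (\<sigma> N) \<longleftrightarrow> adjacent_modules M N))"

definition corresponds :: "complex set set \<Rightarrow> complex set \<Rightarrow> complex set set \<Rightarrow> bool" where
  "corresponds F V E \<longleftrightarrow>
     (\<exists>\<phi>. bij_betw \<phi> V F \<and>
        (\<forall>u\<in>V. \<forall>v\<in>V. adjacent_modules (\<phi> u) (\<phi> v) \<longleftrightarrow> adj V E u v))"

end

theory Submission
  imports Defs
begin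

text \<open>
  An edge of a PTPG lies on the outer boundary iff its ends have at most one common neighbour: an
  inner edge borders two triangular faces, while for a boundary
  edge the two triangles would form a theta graph none of whose arcs lies inside the other two,
  which Janiszewski's theorem forbids. For two adjacent rectangles of the floor-plan the common
  neighbours sit at the ends of their common wall, one at each end inside the region and none at
  an end on its boundary, unless four modules meet in a point. Such a crossing would give a 4-cycle
  of boundary edges, hence the whole outer boundary, although some further wall ends on the
  boundary of the region. So boundary edges of the graph are exactly the walls that reach the
  boundary of the region.

  (i) The inner vertices of a corner implying path cannot all avoid the five convex corners: a
  module without corner touches only one side of the region (a module spanning the region would be
  a cut vertex), so the whole path would stay on one side and its chord would reach the boundary.
  Two different paths cannot share an inner vertex, since nested chords are excluded by definition
  and crossing ones by the theta argument.

  (ii) The modules at the concave corner give the triplet, except when one module covers a complete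
  wall at that corner; then the other wall can be pushed outwards until the region is a rectangle.
\<close>

section \<open>Walks and theta graphs\<close>

text \<open>A floor-plan corresponds to \<open>G\<close> only as an abstract graph: nothing ties the
  places of the modules to the drawing of \<open>G\<close> in the plane. The outer boundary of the
  drawing must therefore be recognised from adjacencies alone, which is why common neighbours are
  counted on both sides. Likewise the region of the floor-plan is only known to be a rectilinear
  polygon with one concave corner; that it is a hexagon has to be derived, and the connectedness of
  its interior is what excludes further pieces. The bound five counts the convex corners of this
  hexagon, each of which lies in one module: choosing an inner corner module for every corner
  implying path is injective. The two walls at the concave corner count as one side, because a path
  may pass from one to the other without meeting a convex corner. In (ii), pushing a wall creates no
  adjacency because the module covering the other wall reaches past the concave corner and so
  already touches the only pushed module beside it.\<close>

lemma theta_arc_inside: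
  fixes c1 c2 c3 :: "real \<Rightarrow> complex"
  assumes "arc c1" "pathstart c1 = a" "pathfinish c1 = b"
    and "arc c2" "pathstart c2 = a" "pathfinish c2 = b"
    and "arc c3" "pathstart c3 = a" "pathfinish c3 = b"
    and i12: "path_image c1 \<inter> path_image c2 = {a, b}"
    and i13: "path_image c1 \<inter> path_image c3 = {a, b}"
    and i23: "path_image c2 \<inter> path_image c3 = {a, b}"
    and n1: "path_image c1 \<inter> inside (path_image c2 \<union> path_image c3) = {}"
    and n2: "path_image c2 \<inter> inside (path_image c1 \<union> path_image c3) = {}"
  shows "path_image c3 \<inter> inside (path_image c1 \<union> path_image c2) \<noteq> {}"
proof
  assume n3: "path_image c3 \<inter> inside (path_image c1 \<union> path_image c2) = {}"
  let ?P1 = "path_image c1" let ?P2 = "path_image c2" let ?P3 = "path_image c3"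
  have sp: "simple_path (c1 +++ reversepath c2)" "simple_path (c1 +++ reversepath c3)"
    "simple_path (c2 +++ reversepath c3)"
    using assms by (auto simp: simple_path_join_loop_eq arc_simple_path simple_path_reversepath)
  have pim: "path_image (c1 +++ reversepath c2) = ?P1 \<union> ?P2"
    "path_image (c1 +++ reversepath c3) = ?P1 \<union> ?P3"
    "path_image (c2 +++ reversepath c3) = ?P2 \<union> ?P3"
    using assms by (auto simp: path_image_join)
  have J12: "inside (?P1 \<union> ?P2) \<noteq> {}" "connected (inside (?P1 \<union> ?P2))"
    "frontier (inside (?P1 \<union> ?P2)) = ?P1 \<union> ?P2"
    using Jordan_inside_outside [OF sp(1)] assms by (auto simp: pim)
  have J13: "connected (outside (?P1 \<union> ?P3))" "open (inside (?P1 \<union> ?P3))"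
    "frontier (inside (?P1 \<union> ?P3)) = ?P1 \<union> ?P3"
    using Jordan_inside_outside [OF sp(2)] assms by (auto simp: pim)
  have J23: "connected (outside (?P2 \<union> ?P3))" "open (inside (?P2 \<union> ?P3))"
    "frontier (inside (?P2 \<union> ?P3)) = ?P2 \<union> ?P3"
    using Jordan_inside_outside [OF sp(3)] assms by (auto simp: pim)
  have "a \<noteq> b" using assms(1-3) arc_distinct_ends by blast
  have ne: "?P1 - {a,b} \<noteq> {}" "?P2 - {a,b} \<noteq> {}"
    using nonempty_simple_path_endless[of c1] nonempty_simple_path_endless[of c2] assms
    by (simp_all add: arc_imp_simple_path)
  obtain x where x: "x \<in> inside (?P1 \<union> ?P2)" using J12(1) by blast
  have bdd: "bounded (?P1 \<union> ?P2 \<union> ?P3)"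
    using assms by (simp add: bounded_arc_image)
  obtain y where y: "y \<in> outside (?P1 \<union> ?P2 \<union> ?P3)"
    using outside_bounded_nonempty[OF bdd] by blast
  have y': "y \<in> outside (?P1 \<union> ?P3)" "y \<in> outside (?P2 \<union> ?P3)" "y \<in> outside (?P1 \<union> ?P2)"
    by (rule subsetD[OF outside_mono y]; blast)+
  \<comment> \<open>The open region enclosed by \<open>?P1\<close> and \<open>?P2\<close> is
    connected and misses \<open>Pi\<close> and \<open>?P3\<close>, so it lies on one side of their
    union. If that were the inner side, its closure would carry the inner points of
    \<open>Pj\<close> inside as well, against the assumption on \<open>Pj\<close>.\<close>
  have aux: "inside (?P1 \<union> ?P2) \<subseteq> outside (Pi \<union> ?P3)"
    if Pj: "Pi \<union> Pj = ?P1 \<union> ?P2" "frontier (inside (Pi \<union> ?P3)) = Pi \<union> ?P3"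
       "Pj - {a,b} \<noteq> {}" "Pj \<inter> inside (Pi \<union> ?P3) = {}" "Pi \<inter> Pj = {a,b}" "Pj \<inter> ?P3 = {a,b}"
    for Pi Pj
  proof -
    let ?I = "inside (?P1 \<union> ?P2)"
    have "?I \<inter> (Pi \<union> ?P3) = {}"
      using n3 inside_no_overlap[of "?P1 \<union> ?P2"] that(1) by blast
    then have sub: "?I \<subseteq> inside (Pi \<union> ?P3) \<union> outside (Pi \<union> ?P3)"
      unfolding inside_Un_outside by blast
    have dis: "?I \<inter> inside (Pi \<union> ?P3) = {}"
    proof (rule ccontr)
      assume ne: "?I \<inter> inside (Pi \<union> ?P3) \<noteq> {}"
      have "?I \<subseteq> inside (Pi \<union> ?P3)"
      proof (rule ccontr)
        assume "\<not> ?thesis"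
        then have "?I \<inter> frontier (inside (Pi \<union> ?P3)) \<noteq> {}"
          using connected_Int_frontier[OF J12(2) ne] by blast
        then show False
          using that(2) \<open>?I \<inter> (Pi \<union> ?P3) = {}\<close> by auto
      qed
      then have "closure ?I \<subseteq> closure (inside (Pi \<union> ?P3))" by (rule closure_mono)
      then have "Pj \<subseteq> inside (Pi \<union> ?P3) \<union> (Pi \<union> ?P3)"
        unfolding closure_Un_frontier Pj(2) J12(3) using Pj(1) by blast
      moreover from Pj(3) obtain w where w: "w \<in> Pj" "w \<notin> {a, b}" by blast
      moreover have "w \<notin> Pi" "w \<notin> ?P3" using w Pj(5,6) by blast+
      ultimately have "w \<in> Pj \<inter> inside (Pi \<union> ?P3)" by blast
      then show False using Pj(4) by blast
    qed
    show ?thesis using sub dis by blast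
  qed
  have "inside (?P1 \<union> ?P2) \<subseteq> outside (?P1 \<union> ?P3)"
    by (rule aux[of _ ?P2]) (use J13 ne n2 i12 i23 in auto)
  moreover have "inside (?P1 \<union> ?P2) \<subseteq> outside (?P2 \<union> ?P3)"
    by (rule aux[of _ ?P1]) (use J23 ne n1 i12 i13 in auto)
  ultimately have x': "x \<in> outside (?P1 \<union> ?P3)" "x \<in> outside (?P2 \<union> ?P3)" using x by auto
  \<comment> \<open>Neither closed curve through \<open>?P3\<close> separates \<open>x\<close> from
    \<open>y\<close>, and the two curves meet in the connected set \<open>?P3\<close>. By
    Janiszewski their union does not separate the points either, whereas \<open>?P1\<close> and
    \<open>?P2\<close> together do.\<close>
  have "connected_component (- ((?P1 \<union> ?P3) \<union> (?P2 \<union> ?P3))) x y"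
  proof (rule Janiszewski)
    show "compact (?P1 \<union> ?P3)" "closed (?P2 \<union> ?P3)"
      using assms by (auto simp: compact_arc_image closed_arc_image compact_Un closed_Un)
    have "(?P1 \<union> ?P3) \<inter> (?P2 \<union> ?P3) = ?P3"
      using i12 i13 by blast
    then show "connected ((?P1 \<union> ?P3) \<inter> (?P2 \<union> ?P3))"
      using assms(7) by (simp add: connected_arc_image)
    show "connected_component (- (?P1 \<union> ?P3)) x y"
      unfolding connected_component_def
      by (rule exI[of _ "outside (?P1 \<union> ?P3)"])
        (use x' y' J13(1) outside_no_overlap[of "?P1 \<union> ?P3"] in blast)
    show "connected_component (- (?P2 \<union> ?P3)) x y"
      unfolding connected_component_def
      by (rule exI[of _ "outside (?P2 \<union> ?P3)"])
        (use x' y' J23(1) outside_no_overlap[of "?P2 \<union> ?P3"] in blast)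
  qed
  then have "connected_component (- (?P1 \<union> ?P2)) x y"
    by (rule connected_component_of_subset) auto
  then have "connected_component_set (- (?P1 \<union> ?P2)) x = connected_component_set (- (?P1 \<union> ?P2)) y"
    by (simp add: connected_component_eq_eq connected_component_eq)
  then show False
    using x y'(3) by (auto simp: inside_def outside_def)
qed

section \<open>Plane drawings: edges as arcs, walks and their point sets\<close>

locale plane_graph_drawing =
  fixes V :: "complex set" and E :: "complex set set"
  assumes plane: "plane_graph V E"
begin

lemma finite_vertices: "finite V"
  using plane unfolding plane_graph_def by (rule conjunct1)

lemma edge_arc:
  assumes "e \<in> E"
  obtains g where "arc g" "path_image g = e" "e \<inter> V = {pathstart g, pathfinish g}"
proof -
  have "\<forall>e\<in>E. \<exists>g. arc g \<and> path_image g = e \<and> e \<inter> V = {pathstart g, pathfinish g}"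
    using plane unfolding plane_graph_def by (elim conjE)
  then show ?thesis using assms that by meson
qed

lemma edge_ends_inj: "\<lbrakk>e \<in> E; e' \<in> E; e \<inter> V = e' \<inter> V\<rbrakk> \<Longrightarrow> e = e'"
  using plane unfolding plane_graph_def by meson

lemma edges_meet_in_vertices: "\<lbrakk>e \<in> E; e' \<in> E; e \<noteq> e'\<rbrakk> \<Longrightarrow> e \<inter> e' \<subseteq> V"
  using plane unfolding plane_graph_def by meson

lemma finite_edges: "finite E"
proof (rule finite_imageD)
  show "finite ((\<lambda>e. e \<inter> V) ` E)"
    by (rule finite_subset[of _ "Pow V"]) (use finite_vertices in auto)
  show "inj_on (\<lambda>e. e \<inter> V) E"
    using edge_ends_inj by (auto simp: inj_on_def)
qed

lemma adj_sym: "adj V E u v \<longleftrightarrow> adj V E v u"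
  unfolding adj_def insert_commute[of u v] ..

lemma adj_vertices: "adj V E u v \<Longrightarrow> u \<in> V \<and> v \<in> V"
  unfolding adj_def by blast

lemma adj_neq: "adj V E u v \<Longrightarrow> u \<noteq> v"
proof
  assume "adj V E u v" "u = v"
  then obtain e where e: "e \<in> E" "e \<inter> V = {u}" unfolding adj_def by blast
  obtain g where g: "arc g" "path_image g = e" "e \<inter> V = {pathstart g, pathfinish g}"
    using edge_arc[OF e(1)] .
  have "{pathstart g, pathfinish g} = {u}" using g(3) e(2) by metis
  then have "pathstart g = pathfinish g" by (metis insertI1 insert_commute singletonD)
  then show False using arc_distinct_ends[OF g(1)] by simp
qed

text \<open>Meaningful for adjacent \<open>u\<close> and \<open>v\<close> only; unique there because
  parallel edges are excluded.\<close>

definition edge :: "complex \<Rightarrow> complex \<Rightarrow> complex set" where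
  "edge u v = (THE e. e \<in> E \<and> e \<inter> V = {u, v})"

lemma edge_eqI: "\<lbrakk>e \<in> E; e \<inter> V = {u, v}\<rbrakk> \<Longrightarrow> edge u v = e"
  unfolding edge_def by (rule the_equality) (simp_all add: edge_ends_inj)

lemma edge_props:
  assumes "adj V E u v"
  shows "edge u v \<in> E" "edge u v \<inter> V = {u, v}"
proof -
  obtain e where e: "e \<in> E" "e \<inter> V = {u, v}" using assms unfolding adj_def by blast
  then have "edge u v = e" by (rule edge_eqI)
  then show "edge u v \<in> E" "edge u v \<inter> V = {u, v}" using e by metis+
qed

lemma edge_commute: "edge u v = edge v u"
  unfolding edge_def insert_commute[of u v] ..

lemma edge_path:
  assumes "adj V E u v"
  obtains g where "arc g" "path_image g = edge u v" "pathstart g = u" "pathfinish g = v"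
proof -
  obtain g where g: "arc g" "path_image g = edge u v" "edge u v \<inter> V = {pathstart g, pathfinish g}"
    using edge_arc[OF edge_props(1)[OF assms]] .
  then have "{u, v} = {pathstart g, pathfinish g}" using edge_props(2)[OF assms] by metis
  then consider "pathstart g = u" "pathfinish g = v" | "pathstart g = v" "pathfinish g = u"
    unfolding doubleton_eq_iff by metis
  then show ?thesis
  proof cases
    case 1 then show ?thesis using g that by blast
  next
    case 2
    then show ?thesis
      by (intro that[of "reversepath g"]) (use g in \<open>simp_all add: arc_reversepath\<close>)
  qed
qed

lemma boundary_adj_adj: "boundary_adj V E u v \<Longrightarrow> adj V E u v"
  unfolding boundary_adj_def adj_def by metis

lemma boundary_adj_sym: "boundary_adj V E u v \<longleftrightarrow> boundary_adj V E v u"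
  unfolding boundary_adj_def insert_commute[of u v] ..

lemma boundary_adj_edge:
  "boundary_adj V E u v \<longleftrightarrow> adj V E u v \<and> edge u v \<subseteq> frontier (exterior_face V E)"
proof
  assume "boundary_adj V E u v"
  then obtain e where e: "e \<in> E" "e \<inter> V = {u, v}" "e \<subseteq> frontier (exterior_face V E)"
    unfolding boundary_adj_def by metis
  have "edge u v = e" using e(1,2) by (rule edge_eqI)
  moreover have "adj V E u v" unfolding adj_def using e(1,2) by (rule bexI[rotated])
  ultimately show "adj V E u v \<and> edge u v \<subseteq> frontier (exterior_face V E)"
    using e(3) by metis
next
  assume "adj V E u v \<and> edge u v \<subseteq> frontier (exterior_face V E)"
  then show "boundary_adj V E u v"
    unfolding boundary_adj_def
    by (intro bexI[of _ "edge u v"] conjI edge_props) simp_all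
qed

fun steps :: "complex list \<Rightarrow> complex set set" where
  "steps (u # v # us) = insert (edge u v) (steps (v # us))"
| "steps _ = {}"

definition trace :: "complex list \<Rightarrow> complex set" where
  "trace us = \<Union> (steps us)"

text \<open>Distinct vertices, so that the trace of a walk is an arc.\<close>

definition walk :: "complex list \<Rightarrow> bool" where
  "walk us \<longleftrightarrow> successively (adj V E) us \<and> distinct us"

lemma trace_Cons: "trace (u # v # us) = edge u v \<union> trace (v # us)"
  by (simp add: trace_def)

lemma steps_subset: "successively (adj V E) us \<Longrightarrow> steps us \<subseteq> E"
  by (induction us rule: steps.induct) (simp_all add: edge_props(1))

lemma steps_nth:
  assumes "successively (adj V E) us" "e \<in> steps us"
  obtains i where "Suc i < length us" "e \<inter> V = {us ! i, us ! Suc i}"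
proof -
  have "\<exists>i. Suc i < length us \<and> e = edge (us ! i) (us ! Suc i) \<and> adj V E (us ! i) (us ! Suc i)"
    using assms
  proof (induction us rule: steps.induct)
    case (1 u v us)
    show ?case
    proof (cases "e = edge u v")
      case True
      then show ?thesis using "1.prems" by (intro exI[of _ 0]) simp
    next
      case False
      then obtain i where "Suc i < length (v # us)" "e = edge ((v # us) ! i) ((v # us) ! Suc i)"
          "adj V E ((v # us) ! i) ((v # us) ! Suc i)"
        using "1.IH" "1.prems" by force
      then show ?thesis by (intro exI[of _ "Suc i"]) simp
    qed
  qed auto
  then show ?thesis using that edge_props(2) by metis
qed

lemma nth_steps:
  "Suc i < length us \<Longrightarrow> edge (us ! i) (us ! Suc i) \<in> steps us"
proof (induction us arbitrary: i rule: steps.induct)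
  case (1 u v us) then show ?case by (cases i) auto
qed auto

lemma trace_vertices:
  assumes "successively (adj V E) us" "length us \<ge> 2"
  shows "trace us \<inter> V = set us"
  using assms
proof (induction us rule: steps.induct)
  case (1 u v us)
  have "edge u v \<inter> V = {u, v}" using "1.prems" edge_props(2) by simp
  then have eq: "trace (u # v # us) \<inter> V = {u, v} \<union> trace (v # us) \<inter> V"
    by (simp add: trace_Cons Int_Un_distrib2)
  show ?case
  proof (cases us)
    case Nil then show ?thesis using eq by (simp add: trace_def)
  next
    case (Cons w ws)
    then have "trace (v # us) \<inter> V = set (v # us)" using 1 by simp
    then show ?thesis using eq by auto
  qed
qed auto

lemma walk_Cons: "walk (u # v # us) \<longleftrightarrow> adj V E u v \<and> u \<notin> set (v # us) \<and> walk (v # us)"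
  by (auto simp: walk_def)

lemma walk_path:
  assumes "walk us" "length us \<ge> 2"
  shows "\<exists>g. arc g \<and> path_image g = trace us \<and> pathstart g = hd us \<and> pathfinish g = last us"
  using assms
proof (induction us rule: steps.induct)
  case (1 u v us)
  then have uv: "adj V E u v" and w: "walk (v # us)" and u: "u \<notin> set (v # us)"
    unfolding walk_Cons by metis+
  obtain g where g: "arc g" "path_image g = edge u v" "pathstart g = u" "pathfinish g = v"
    using edge_path[OF uv] .
  show ?case
  proof (cases "us = []")
    case True
    then have "trace (u # v # us) = edge u v" by (simp add: trace_def)
    then show ?thesis using g True by (intro exI[of _ g]) simp
  next
    case False
    then have len: "length (v # us) \<ge> 2" by (cases us) auto
    then obtain h where h: "arc h" "path_image h = trace (v # us)" "pathstart h = v"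
      "pathfinish h = last (v # us)"
      using "1.IH"[OF w] by (metis list.sel(1))
    have tv: "trace (v # us) \<inter> V = set (v # us)"
      using trace_vertices w len unfolding walk_def by blast
    \<comment> \<open>The first edge meets the later ones in vertices only, hence only in
      \<open>v\<close>, since \<open>u\<close> does not recur. This is the condition for joining the
      two arcs.\<close>
    have "edge u v \<inter> e \<subseteq> V" if "e \<in> steps (v # us)" for e
    proof (rule edges_meet_in_vertices)
      show "edge u v \<in> E" using uv by (rule edge_props)
      show "e \<in> E" using steps_subset that w unfolding walk_def by blast
      have "u \<notin> e" using tv that u adj_vertices[OF uv] unfolding trace_def by blast
      then show "edge u v \<noteq> e" using edge_props(2)[OF uv] by blast
    qed
    then have "edge u v \<inter> trace (v # us) \<subseteq> V" unfolding trace_def by blast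
    then have "edge u v \<inter> trace (v # us) \<subseteq> {u, v} \<inter> set (v # us)"
      unfolding tv[symmetric] edge_props(2)[OF uv, symmetric] by blast
    then have "edge u v \<inter> trace (v # us) \<subseteq> {v}" using u by auto
    then have "arc (g +++ h)" using g h by (intro arc_join) simp_all
    then show ?thesis using g h False
      by (intro exI[of _ "g +++ h"]) (simp add: path_image_join trace_Cons)
  qed
qed auto

text \<open>Two walks with the same ends and no other common vertex could share only an edge that
  joins these ends. A walk of at least three vertices contains no such edge.\<close>

lemma step_ends_not_both:
  assumes "walk us" "length us \<ge> 3" "e \<in> steps us"
  shows "e \<inter> V \<noteq> {hd us, last us}"
proof
  assume eq: "e \<inter> V = {hd us, last us}"
  obtain i where i: "Suc i < length us" "e \<inter> V = {us ! i, us ! Suc i}"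
    using steps_nth[of us e] assms unfolding walk_def by blast
  have "hd us = us ! 0" "last us = us ! (length us - 1)"
    using assms(2) by (auto simp: hd_conv_nth last_conv_nth simp flip: length_greater_0_conv)
  then have "{us ! 0, us ! (length us - 1)} = {us ! i, us ! Suc i}" using eq i by metis
  moreover have "distinct us" using assms by (auto simp: walk_def)
  moreover have "0 < length us" "length us - 1 < length us" "i < length us" using i(1) by linarith+
  ultimately have "0 = i \<and> length us - 1 = Suc i \<or> 0 = Suc i \<and> length us - 1 = i"
    using i(1) unfolding doubleton_eq_iff by (metis nth_eq_iff_index_eq)
  then show False using assms(2) by linarith
qed

text \<open>Different edges meet only in vertices, so the traces meet only in common vertices. The
  length condition excludes that both walks are one and the same edge.\<close>

lemma traces_meet:
  assumes us: "walk us" "length us \<ge> 2" and vs: "walk vs" "length vs \<ge> 2"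
    and "hd vs = hd us" "last vs = last us" "set us \<inter> set vs = {hd us, last us}"
    and len: "length us \<ge> 3 \<or> length vs \<ge> 3"
  shows "trace us \<inter> trace vs = {hd us, last us}"
proof -
  have tv: "trace us \<inter> V = set us" "trace vs \<inter> V = set vs"
    using us vs trace_vertices by (auto simp: walk_def)
  have sub: "steps us \<subseteq> E" "steps vs \<subseteq> E" using us vs steps_subset by (auto simp: walk_def)
  have "e \<inter> f \<subseteq> V" if e: "e \<in> steps us" and f: "f \<in> steps vs" for e f
  proof (rule edges_meet_in_vertices)
    show "e \<in> E" "f \<in> E" using e f sub by auto
    show "e \<noteq> f"
    proof
      assume "e = f"
      have "e \<inter> V \<subseteq> set us \<inter> set vs"
        using tv e f \<open>e = f\<close> by (auto simp: trace_def)
      moreover obtain i where i: "Suc i < length us" "e \<inter> V = {us ! i, us ! Suc i}"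
        using steps_nth[of us e] us e unfolding walk_def by blast
      moreover have "us ! i \<noteq> us ! Suc i"
        using i(1) us(1) by (simp add: walk_def nth_eq_iff_index_eq)
      ultimately have "e \<inter> V = {hd us, last us}" using assms(7) by auto
      then show False
        using step_ends_not_both[OF us(1) _ e] step_ends_not_both[OF vs(1) _ f] len assms(5,6) \<open>e = f\<close>
        by auto
    qed
  qed
  then have "trace us \<inter> trace vs \<subseteq> V" by (auto simp: trace_def)
  then show ?thesis using tv assms(7) by auto
qed

section \<open>The exterior face and theta graphs of walks\<close>

lemma trace_subset: "successively (adj V E) us \<Longrightarrow> trace us \<subseteq> V \<union> \<Union>E"
  using steps_subset unfolding trace_def by blast

lemma exterior_face_outside: "J \<subseteq> V \<union> \<Union>E \<Longrightarrow> exterior_face V E \<subseteq> outside J"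
  unfolding exterior_face_def by (rule outside_mono)

text \<open>The exterior face lies outside \<open>J\<close>, and the inside of the closed set
  \<open>J\<close> is open, so it contains no limit point of the exterior face.\<close>

lemma frontier_exterior_not_inside:
  assumes "J \<subseteq> V \<union> \<Union>E" "closed J"
  shows "frontier (exterior_face V E) \<inter> inside J = {}"
proof -
  have "inside J \<inter> exterior_face V E = {}"
    using exterior_face_outside[OF assms(1)] inside_Int_outside[of J] by blast
  then have "inside J \<inter> closure (exterior_face V E) = {}"
    using open_Int_closure_eq_empty[OF open_inside[OF assms(2)]] by simp
  then show ?thesis by (auto simp: frontier_def)
qed

text \<open>The three length conditions together say that at most one of the walks is a single edge;
  then the traces are arcs meeting only in their ends.\<close>

lemma theta_walks:
  assumes us: "walk us" "length us \<ge> 2" and vs: "walk vs" "length vs \<ge> 2" and ws: "walk ws" "length ws \<ge> 2"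
    and ends: "hd vs = hd us" "last vs = last us" "hd ws = hd us" "last ws = last us"
    and "set us \<inter> set vs = {hd us, last us}" "set us \<inter> set ws = {hd us, last us}"
        "set vs \<inter> set ws = {hd us, last us}"
    and "length us \<ge> 3 \<or> length vs \<ge> 3" "length us \<ge> 3 \<or> length ws \<ge> 3" "length vs \<ge> 3 \<or> length ws \<ge> 3"
    and "trace us \<inter> inside (trace vs \<union> trace ws) = {}"
    and "trace vs \<inter> inside (trace us \<union> trace ws) = {}"
  shows "trace ws \<inter> inside (trace us \<union> trace vs) \<noteq> {}"
proof -
  obtain g1 g2 g3 where g: "arc g1" "path_image g1 = trace us" "pathstart g1 = hd us" "pathfinish g1 = last us"
      "arc g2" "path_image g2 = trace vs" "pathstart g2 = hd us" "pathfinish g2 = last us"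
      "arc g3" "path_image g3 = trace ws" "pathstart g3 = hd us" "pathfinish g3 = last us"
    using walk_path[OF us] walk_path[OF vs] walk_path[OF ws] ends by metis
  have "trace us \<inter> trace vs = {hd us, last us}" "trace us \<inter> trace ws = {hd us, last us}"
    using traces_meet[OF us vs] traces_meet[OF us ws] assms by auto
  moreover have "trace vs \<inter> trace ws = {hd us, last us}"
    using traces_meet[OF vs ws] assms by auto
  ultimately show ?thesis
    using theta_arc_inside[of g1 "hd us" "last us" g2 g3] g assms by auto
qed

lemma closed_trace: "walk us \<Longrightarrow> length us \<ge> 2 \<Longrightarrow> closed (trace us)"
  using walk_path closed_arc_image by metis

definition has_boundary_step :: "complex list \<Rightarrow> bool" where
  "has_boundary_step us \<longleftrightarrow> (\<exists>i. Suc i < length us \<and> boundary_adj V E (us ! i) (us ! Suc i))"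

text \<open>Points of a boundary edge are limits of the exterior face, hence not inside the curve
  formed by \<open>vs\<close> and \<open>ws\<close>. The walk without its ends is connected and
  misses that curve, so one such point keeps all of it from being inside.\<close>

lemma has_boundary_step_not_inside:
  assumes us: "walk us" "length us \<ge> 2" and vs: "walk vs" "length vs \<ge> 2" and ws: "walk ws" "length ws \<ge> 2"
    and ends: "hd vs = hd us" "last vs = last us" "hd ws = hd us" "last ws = last us"
    and s: "set us \<inter> set vs = {hd us, last us}" "set us \<inter> set ws = {hd us, last us}"
    and len: "length us \<ge> 3 \<or> length vs \<ge> 3" "length us \<ge> 3 \<or> length ws \<ge> 3"
    and b: "has_boundary_step us"
  shows "trace us \<inter> inside (trace vs \<union> trace ws) = {}"
proof -
  let ?J = "trace vs \<union> trace ws"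
  obtain g where g: "arc g" "path_image g = trace us" "pathstart g = hd us" "pathfinish g = last us"
    using walk_path[OF us] by metis
  have con: "connected (trace us - {hd us, last us})"
    using connected_simple_path_endless[of g] g by (simp add: arc_imp_simple_path)
  have m: "trace us \<inter> trace vs = {hd us, last us}" "trace us \<inter> trace ws = {hd us, last us}"
    using traces_meet[OF us vs ends(1,2) s(1) len(1)] traces_meet[OF us ws ends(3,4) s(2) len(2)] .
  have hl: "hd us \<in> ?J" "last us \<in> ?J" using m by blast+
  have cl: "closed ?J" using closed_trace[OF vs] closed_trace[OF ws] by (rule closed_Un)
  have J: "?J \<subseteq> V \<union> \<Union>E"
    using trace_subset[of vs] trace_subset[of ws] vs ws unfolding walk_def by blast
  obtain i where i: "Suc i < length us" "boundary_adj V E (us ! i) (us ! Suc i)"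
    using b unfolding has_boundary_step_def by blast
  let ?e = "edge (us ! i) (us ! Suc i)"
  have e: "?e \<subseteq> frontier (exterior_face V E)" "?e \<subseteq> trace us"
    using i nth_steps[OF i(1)] unfolding boundary_adj_edge trace_def by blast+
  obtain h where h: "arc h" "path_image h = ?e" "pathstart h = us ! i" "pathfinish h = us ! Suc i"
    using edge_path boundary_adj_adj[OF i(2)] by metis
  obtain z where z: "z \<in> ?e" "z \<noteq> us ! i" "z \<noteq> us ! Suc i"
    using nonempty_simple_path_endless[OF arc_imp_simple_path[OF h(1)]] unfolding h by blast
  then have "z \<notin> V" using edge_props(2)[OF boundary_adj_adj[OF i(2)]] by blast
  moreover have "hd us \<in> V" "last us \<in> V"
    using us trace_vertices[of us] s(1) unfolding walk_def by blast+
  ultimately have z': "z \<in> trace us - {hd us, last us}" using z e by blast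
  have nz: "z \<notin> inside ?J" using frontier_exterior_not_inside[OF J cl] e z by blast
  show ?thesis
  proof (rule ccontr)
    assume "\<not> ?thesis"
    then have *: "(trace us - {hd us, last us}) \<inter> inside ?J \<noteq> {}"
      using hl inside_no_overlap[of ?J] by blast
    have "(trace us - {hd us, last us}) \<inter> frontier (inside ?J) \<noteq> {}"
      using connected_Int_frontier[OF con *] z' nz by blast
    moreover have "frontier (inside ?J) \<subseteq> ?J" by (simp add: cl frontier_inside_subset)
    ultimately show False using m by blast
  qed
qed

text \<open>Some arc of a theta graph enters the curve formed by the other two, but a boundary edge
  on each arc forbids this. The bound on boundary neighbours and the exclusion of crossing chords
  both reduce to this configuration.\<close>

lemma no_boundary_theta:
  assumes us: "walk us" "length us \<ge> 2" and vs: "walk vs" "length vs \<ge> 2" and ws: "walk ws" "length ws \<ge> 2"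
    and ends: "hd vs = hd us" "last vs = last us" "hd ws = hd us" "last ws = last us"
    and s: "set us \<inter> set vs = {hd us, last us}" "set us \<inter> set ws = {hd us, last us}"
        "set vs \<inter> set ws = {hd us, last us}"
    and len: "length us \<ge> 3 \<or> length vs \<ge> 3" "length us \<ge> 3 \<or> length ws \<ge> 3" "length vs \<ge> 3 \<or> length ws \<ge> 3"
    and b: "has_boundary_step us" "has_boundary_step vs" "has_boundary_step ws"
  shows False
proof -
  have c: "set vs \<inter> set us = {hd us, last us}" "set ws \<inter> set us = {hd us, last us}"
    "set ws \<inter> set vs = {hd us, last us}" using s by blast+
  have l: "3 \<le> length vs \<or> 3 \<le> length us" "3 \<le> length ws \<or> 3 \<le> length us"
    "3 \<le> length ws \<or> 3 \<le> length vs" using len by blast+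
  have 1: "trace us \<inter> inside (trace vs \<union> trace ws) = {}"
    by (rule has_boundary_step_not_inside[OF us vs ws ends s(1,2) len(1,2) b(1)])
  have 2: "trace vs \<inter> inside (trace us \<union> trace ws) = {}"
    by (rule has_boundary_step_not_inside[OF vs us ws]) (use ends s b c l len in simp_all)
  have 3: "trace ws \<inter> inside (trace us \<union> trace vs) = {}"
    by (rule has_boundary_step_not_inside[OF ws us vs]) (use ends s b c l len in simp_all)
  show False using theta_walks[OF us vs ws ends s len 1 2] 3 by blast
qed

end

section \<open>Properly triangulated plane graphs\<close>

text \<open>The inverse of the arc would embed a disc into the real line. The consequence needed is
  that there are points beside an edge, arbitrarily close to it.\<close>

lemma ball_not_subset_arc:
  fixes g :: "real \<Rightarrow> complex"
  assumes "arc g" "\<epsilon> > 0"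
  shows "\<not> ball z \<epsilon> \<subseteq> path_image g"
proof
  assume sub: "ball z \<epsilon> \<subseteq> path_image g"
  obtain h where h: "homeomorphism {0..1} (path_image g) g h"
    using homeomorphism_arc[OF assms(1)] .
  have "DIM(complex) \<le> DIM(real)"
  proof (rule invariance_of_dimension)
    show "continuous_on (ball z \<epsilon>) h"
      using h sub unfolding homeomorphism_def by (meson continuous_on_subset)
    show "inj_on h (ball z \<epsilon>)"
      using h sub unfolding homeomorphism_def by (metis inj_onI subsetD)
  qed (use assms in auto)
  then show False by simp
qed

lemma reach_list:
  assumes "(x, y) \<in> {(x, y). x \<in> U \<and> y \<in> U \<and> A x y}\<^sup>*" "x \<in> U"
  shows "\<exists>ws. ws \<noteq> [] \<and> hd ws = x \<and> last ws = y \<and> distinct ws \<and> successively A ws \<and> set ws \<subseteq> U"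
  using assms(1)
proof (induction rule: rtrancl_induct)
  case base
  show ?case by (rule exI[of _ "[x]"]) (simp add: assms)
next
  case (step y z)
  then obtain ws where ws: "ws \<noteq> []" "hd ws = x" "last ws = y" "distinct ws" "successively A ws" "set ws \<subseteq> U"
    by blast
  show ?case
  proof (cases "z \<in> set ws")
    case True
    \<comment> \<open>A vertex that was visited before: cutting the list back to it keeps the list
      distinct.\<close>
    then obtain as bs where "ws = as @ z # bs" by (meson split_list)
    then show ?thesis using ws
      by (intro exI[of _ "as @ [z]"]) (auto simp: hd_append successively_append_iff successively_Cons)
  next
    case False
    then show ?thesis using ws step.hyps
      by (intro exI[of _ "ws @ [z]"]) (auto simp: successively_append_iff)
  qed
qed

text \<open>Stopping at the first vertex in \<open>C\<close> keeps the rest of the path outside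
  \<open>C\<close>. This is how a new path is attached to vertices already in use.\<close>

lemma reach_first_hit:
  assumes "(x, m) \<in> {(x, y). x \<in> U \<and> y \<in> U \<and> A x y}\<^sup>*" "x \<in> U - C" "m \<in> C"
  shows "\<exists>y c. (x, y) \<in> {(x, y). x \<in> U - C \<and> y \<in> U - C \<and> A x y}\<^sup>* \<and> y \<in> U - C \<and> c \<in> U \<inter> C \<and> A y c"
proof -
  define R where "R = {(x, y). x \<in> U - C \<and> y \<in> U - C \<and> A x y}"
  have "((x, m) \<in> R\<^sup>* \<and> m \<in> U - C) \<or>
    (\<exists>y c. (x, y) \<in> R\<^sup>* \<and> y \<in> U - C \<and> c \<in> U \<inter> C \<and> A y c)"
    using assms(1)
  proof (induction rule: rtrancl_induct)
    case base then show ?case using assms by simp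
  next
    case (step y z)
    have yz: "y \<in> U" "z \<in> U" "A y z" using step.hyps(2) by auto
    show ?case
    proof (cases "\<exists>y c. (x, y) \<in> R\<^sup>* \<and> y \<in> U - C \<and> c \<in> U \<inter> C \<and> A y c")
      case False
      with step.IH have "(x, y) \<in> R\<^sup>* \<and> y \<in> U - C" by argo
      then have y: "(x, y) \<in> R\<^sup>*" "y \<in> U - C" by (rule conjunct1, rule conjunct2)
      show ?thesis
      proof (cases "z \<in> C")
        case True
        then have "(x, y) \<in> R\<^sup>* \<and> y \<in> U - C \<and> z \<in> U \<inter> C \<and> A y z"
          by (intro conjI y yz IntI)
        then show ?thesis by (intro disjI2 exI)
      next
        case False
        then have "(y, z) \<in> R" using y yz by (simp add: R_def)
        with y(1) have "(x, z) \<in> R\<^sup>*" by (rule rtrancl_into_rtrancl)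
        moreover have "z \<in> U - C" using yz False by simp
        ultimately show ?thesis by (intro disjI1 conjI)
      qed
    qed (rule disjI2)
  qed
  then show ?thesis unfolding R_def by (elim disjE) (simp_all add: assms(3))
qed

locale ptpg =
  fixes V :: "complex set" and E :: "complex set set"
  assumes PTPG: "PTPG V E"
begin

sublocale plane_graph_drawing V E
  by unfold_locales (use PTPG in \<open>simp add: PTPG_def\<close>)

lemma connected_minus_vertex:
  assumes "w \<in> V" "x \<in> V - {w}" "y \<in> V - {w}"
  shows "(x, y) \<in> {(x, y). x \<in> V - {w} \<and> y \<in> V - {w} \<and> adj V E x y}\<^sup>*"
  using PTPG assms unfolding PTPG_def biconnected_def connected_graph_on_def by meson

lemma connected_all:
  assumes "x \<in> V" "y \<in> V"
  shows "(x, y) \<in> {(x, y). x \<in> V \<and> y \<in> V \<and> adj V E x y}\<^sup>*"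
  using PTPG assms unfolding PTPG_def biconnected_def connected_graph_on_def by meson

section \<open>Triangles, faces and the edges on them\<close>

definition tri :: "complex \<Rightarrow> complex \<Rightarrow> complex \<Rightarrow> complex set" where
  "tri u v w = edge u v \<union> edge v w \<union> edge w u"

lemma tri_rotate: "tri v w u = tri u v w"
  unfolding tri_def by blast

lemma tri_swap: "tri v u w = tri u v w"
  unfolding tri_def edge_commute[of v u] edge_commute[of u w] edge_commute[of w v] by blast

lemma closed_curve_of_walks:
  assumes us: "walk us" "length us \<ge> 2" and vs: "walk vs" "length vs \<ge> 2"
    and "hd vs = hd us" "last vs = last us" "set us \<inter> set vs = {hd us, last us}"
    and len: "length us \<ge> 3 \<or> length vs \<ge> 3"
  obtains c where "simple_path c" "pathfinish c = pathstart c" "path_image c = trace us \<union> trace vs"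
proof -
  obtain g h where g: "arc g" "path_image g = trace us" "pathstart g = hd us" "pathfinish g = last us"
    and h: "arc h" "path_image h = trace vs" "pathstart h = hd us" "pathfinish h = last us"
    using walk_path[OF us] walk_path[OF vs] assms(5,6) by metis
  have "trace us \<inter> trace vs = {hd us, last us}" by (rule traces_meet[OF assms])
  then have "simple_path (g +++ reversepath h)"
    using g h by (intro simple_path_join_loop) (auto simp: arc_reversepath)
  then show ?thesis
    by (rule that) (use g h in \<open>simp_all add: path_image_join\<close>)
qed

text \<open>Reads a triangle as two arcs with ends \<open>u\<close> and \<open>v\<close>, the form
  that the theta argument needs.\<close>

lemma tri_traces: "trace [u, v] \<union> trace [u, w, v] = tri u v w"
  unfolding trace_def tri_def steps.simps edge_commute[of w v] edge_commute[of u w] by blast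

lemma tri_closed_curve:
  assumes "adj V E u v" "adj V E v w" "adj V E w u"
  obtains c where "simple_path c" "pathfinish c = pathstart c" "path_image c = tri u v w"
proof -
  have d: "u \<noteq> v" "v \<noteq> w" "w \<noteq> u" using assms adj_neq by blast+
  have w: "walk [u, v]" "walk [u, w, v]"
    using assms adj_sym d by (auto simp: walk_def)
  obtain c where "simple_path c" "pathfinish c = pathstart c"
      "path_image c = trace [u, v] \<union> trace [u, w, v]"
    by (rule closed_curve_of_walks[OF w(1) _ w(2)]) auto
  then show ?thesis using that unfolding tri_traces by blast
qed

lemma is_triangle_tri:
  assumes "adj V E u v" "adj V E v w" "adj V E w u"
  shows "is_triangle V E (tri u v w)"
  unfolding is_triangle_def
proof (intro exI bexI conjI)
  show "distinct [u, v, w]" using assms adj_neq by auto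
  show "edge u v \<inter> V = {u, v}" "edge v w \<inter> V = {v, w}" "edge w u \<inter> V = {w, u}"
    using assms by (simp_all add: edge_props(2))
  show "tri u v w = edge u v \<union> edge v w \<union> edge w u" by (rule tri_def)
  show "edge u v \<in> E" "edge v w \<in> E" "edge w u \<in> E"
    using assms by (simp_all add: edge_props(1))
qed

lemma triangle_inside_empty:
  assumes "adj V E u v" "adj V E v w" "adj V E w u"
  shows "V \<inter> inside (tri u v w) = {}"
  using is_triangle_tri[OF assms] PTPG unfolding PTPG_def by metis

lemma is_triangle_obtain:
  assumes "is_triangle V E T"
  obtains u v w where "adj V E u v" "adj V E v w" "adj V E w u" "T = tri u v w"
proof -
  obtain u v w e1 e2 e3 where e: "e1 \<in> E" "e2 \<in> E" "e3 \<in> E" "e1 \<inter> V = {u, v}" "e2 \<inter> V = {v, w}"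
      "e3 \<inter> V = {w, u}" "T = e1 \<union> e2 \<union> e3"
    using assms unfolding is_triangle_def by metis
  show ?thesis
  proof (rule that)
    show "adj V E u v" "adj V E v w" "adj V E w u" using e unfolding adj_def by metis+
    show "T = tri u v w"
      unfolding tri_def edge_eqI[OF e(1,4)] edge_eqI[OF e(2,5)] edge_eqI[OF e(3,6)] by (rule e(7))
  qed
qed

text \<open>The vertices and the other edges, being finitely many closed sets, form a closed set,
  and an inner point of the edge avoids it.\<close>

lemma ball_near_edge:
  assumes "adj V E u v" "z \<in> edge u v" "z \<notin> V"
  obtains \<epsilon> where "\<epsilon> > 0" "ball z \<epsilon> \<inter> (V \<union> \<Union>E) \<subseteq> edge u v - V"
proof -
  let ?K = "V \<union> \<Union> (E - {edge u v})"
  have "closed e" if e: "e \<in> E" for e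
  proof -
    obtain g where "arc g" "path_image g = e" using edge_arc[OF e] by metis
    then show ?thesis using closed_arc_image by metis
  qed
  then have "closed ?K"
    using finite_edges finite_vertices by (intro closed_Un closed_Union) (auto simp: finite_imp_closed)
  moreover have "z \<notin> ?K"
    using assms edges_meet_in_vertices[OF edge_props(1)[OF assms(1)]] by blast
  ultimately obtain \<epsilon> where "\<epsilon> > 0" "ball z \<epsilon> \<subseteq> - ?K"
    by (meson Compl_iff open_Compl open_contains_ball)
  then show ?thesis by (intro that[of \<epsilon>]) blast+
qed

lemma edge_inner_point:
  assumes "adj V E u v"
  obtains z where "z \<in> edge u v" "z \<notin> V"
proof -
  obtain h where h: "arc h" "path_image h = edge u v" "pathstart h = u" "pathfinish h = v"
    using edge_path[OF assms] .
  have "edge u v - {u, v} \<noteq> {}"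
    using nonempty_simple_path_endless[OF arc_imp_simple_path[OF h(1)]] unfolding h .
  then show ?thesis using that edge_props(2)[OF assms] by blast
qed

text \<open>Different edges meet only in vertices, so the side of the triangle that passes through
  \<open>z\<close> must be the given edge.\<close>

lemma tri_third_vertex:
  assumes "adj V E u v" "adj V E a b" "adj V E b c" "adj V E c a" "z \<in> edge u v" "z \<notin> V" "z \<in> tri a b c"
  obtains w where "adj V E u w" "adj V E v w" "tri a b c = tri u v w"
proof -
  have main: thesis if "adj V E a b" "adj V E b c" "adj V E c a" "z \<in> edge a b"
    and th: "\<And>w. adj V E u w \<Longrightarrow> adj V E v w \<Longrightarrow> tri a b c = tri u v w \<Longrightarrow> thesis" for a b c thesis
  proof -
    have "edge a b = edge u v"
      using edges_meet_in_vertices[OF edge_props(1)[OF that(1)] edge_props(1)[OF assms(1)]] that(4) assms(5,6)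
      by blast
    then have "{a, b} = {u, v}" using edge_props(2)[OF that(1)] edge_props(2)[OF assms(1)] by metis
    then consider "a = u" "b = v" | "a = v" "b = u" unfolding doubleton_eq_iff by metis
    then show thesis
    proof cases
      case 1 then show ?thesis using th[of c] that adj_sym by metis
    next
      case 2 then show ?thesis using th[of c] that adj_sym tri_swap by metis
    qed
  qed
  have "z \<in> edge a b \<or> z \<in> edge b c \<or> z \<in> edge c a" using assms(7) unfolding tri_def by blast
  then consider "z \<in> edge a b" | "z \<in> edge b c" | "z \<in> edge c a" by metis
  then show ?thesis
  proof cases
    case 1 show ?thesis by (rule main[OF assms(2-4) 1 that])
  next
    case 2 show ?thesis by (rule main[OF assms(3,4,2) 2 that[unfolded tri_rotate[of b c a, symmetric]]])
  next
    case 3 show ?thesis by (rule main[OF assms(4,2,3) 3 that[unfolded tri_rotate[of a b c]]])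
  qed
qed

text \<open>The face of \<open>y\<close> is bounded by a triangle. The ball joins \<open>y\<close>
  to \<open>z\<close>, which lies in no face, so the triangle meets the ball and therefore has the
  edge as a side. Were \<open>y\<close> outside the triangle, its face would contain the whole
  unbounded outside and so be the exterior face.\<close>

lemma triangle_at_edge:
  assumes uv: "adj V E u v" and z: "z \<in> edge u v" "z \<notin> V"
    and \<epsilon>: "\<epsilon> > 0" "ball z \<epsilon> \<inter> (V \<union> \<Union>E) \<subseteq> edge u v - V"
    and y: "y \<in> ball z \<epsilon>" "y \<notin> V \<union> \<Union>E" "y \<notin> exterior_face V E"
  obtains w where "adj V E u w" "adj V E v w" "y \<in> inside (tri u v w)"
proof -
  let ?X = "V \<union> \<Union>E"
  define f where "f = connected_component_set (- ?X) y"
  have fy: "y \<in> f" unfolding f_def using y(2) by (simp add: connected_component_refl)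
  have "f \<in> components (- ?X)" unfolding f_def components_def using y(2) by blast
  then have "f \<in> faces V E - {exterior_face V E}" unfolding faces_def using fy y(3) by blast
  then have "is_triangle V E (frontier f)" using PTPG unfolding PTPG_def by metis
  then obtain a b c where abc: "adj V E a b" "adj V E b c" "adj V E c a" "frontier f = tri a b c"
    by (rule is_triangle_obtain)
  have sub: "tri a b c \<subseteq> ?X"
    unfolding tri_def using edge_props(1)[OF abc(1)] edge_props(1)[OF abc(2)] edge_props(1)[OF abc(3)] by blast
  have "z \<notin> f" unfolding f_def using z(1) edge_props(1)[OF uv] connected_component_subset by blast
  then have "ball z \<epsilon> \<inter> frontier f \<noteq> {}"
    using y(1) fy centre_in_ball[of z \<epsilon>] \<epsilon>(1) connected_Int_frontier[OF connected_ball, of z \<epsilon> f]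
    by blast
  then obtain z' where z': "z' \<in> ball z \<epsilon>" "z' \<in> tri a b c" using abc(4) by blast
  then have "z' \<in> edge u v" "z' \<notin> V" using \<epsilon>(2) sub by blast+
  then obtain w where w: "adj V E u w" "adj V E v w" "tri a b c = tri u v w"
    using tri_third_vertex[OF uv abc(1-3)] z'(2) by metis
  obtain cc where cc: "simple_path cc" "pathfinish cc = pathstart cc" "path_image cc = tri u v w"
    using tri_closed_curve[OF uv w(2)] w(1) adj_sym by metis
  have "y \<notin> tri u v w" using y(2) sub w(3) by blast
  moreover have "y \<notin> outside (tri u v w)"
  proof
    assume yo: "y \<in> outside (tri u v w)"
    have "connected (outside (tri u v w))" "\<not> bounded (outside (tri u v w))"
      using Jordan_inside_outside[OF cc(1,2)] unfolding cc(3) by blast+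
    moreover have "outside (tri u v w) \<inter> frontier f = {}"
      using abc(4) w(3) outside_no_overlap by metis
    ultimately have "outside (tri u v w) \<subseteq> f"
      using connected_Int_frontier[of "outside (tri u v w)" f] yo fy by blast
    then have "\<not> bounded f" using \<open>\<not> bounded (outside (tri u v w))\<close> bounded_subset by blast
    then have "y \<in> outside ?X" using y(2) unfolding f_def outside_def by blast
    then show False using y(3) unfolding exterior_face_def by blast
  qed
  ultimately have "y \<in> inside (tri u v w)" using inside_Un_outside[of "tri u v w"] by blast
  then show ?thesis using that w by blast
qed

lemma inner_edge_two_common:
  assumes uv: "adj V E u v" and nb: "\<not> boundary_adj V E u v"
  obtains w1 w2 where "w1 \<noteq> w2" "adj V E u w1" "adj V E v w1" "adj V E u w2" "adj V E v w2"
proof -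
  let ?X = "V \<union> \<Union>E" and ?ext = "exterior_face V E"
  obtain z0 where z0: "z0 \<in> edge u v" "z0 \<notin> frontier ?ext"
    using nb uv boundary_adj_edge[of u v] by (meson subsetI)
  have "open (- frontier ?ext)" by (rule open_Compl) simp
  moreover have "z0 \<in> - frontier ?ext" using z0(2) by blast
  ultimately obtain \<delta> where \<delta>0: "\<delta> > 0" "ball z0 \<delta> \<subseteq> - frontier ?ext"
    by (rule openE)
  then have \<delta>: "\<delta> > 0" "ball z0 \<delta> \<inter> frontier ?ext = {}" by blast+
  obtain g where g: "arc g" "path_image g = edge u v" "pathstart g = u" "pathfinish g = v"
    using edge_path[OF uv] .
  \<comment> \<open>The point \<open>z0\<close> may be a vertex. An edge has no isolated points and
    \<open>V\<close> is finite, so \<open>z0\<close> can be replaced by a nearby point of the edge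
    that is no vertex.\<close>
  have "z0 islimpt edge u v"
  proof (rule connected_imp_perfect)
    show "connected (edge u v)" using g connected_arc_image by metis
    show "z0 \<in> edge u v" by (rule z0(1))
    have "u \<in> edge u v" "v \<in> edge u v" using edge_props(2)[OF uv] by blast+
    then show "\<And>a. edge u v \<noteq> {a}" using adj_neq[OF uv] by (metis singletonD)
  qed
  then have "infinite (edge u v \<inter> ball z0 \<delta>)" using \<delta>(1) unfolding islimpt_eq_infinite_ball by blast
  then have "\<not> edge u v \<inter> ball z0 \<delta> \<subseteq> V" using finite_subset[OF _ finite_vertices] by blast
  then obtain z where z: "z \<in> edge u v" "z \<notin> V" "z \<in> ball z0 \<delta>" by blast
  obtain \<epsilon>0 where \<epsilon>0: "\<epsilon>0 > 0" "ball z \<epsilon>0 \<inter> ?X \<subseteq> edge u v - V"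
    using ball_near_edge[OF uv z(1,2)] .
  have "z \<in> ?X" using z(1) edge_props(1)[OF uv] by blast
  then have "z \<notin> ?ext" unfolding exterior_face_def using outside_no_overlap[of ?X] by blast
  then have "z \<notin> closure ?ext" unfolding closure_Un_frontier using z(3) \<delta>(2) by blast
  then have "z \<in> - closure ?ext" by blast
  moreover have "open (- closure ?ext)" by (simp add: open_Compl)
  ultimately obtain \<epsilon>1 where \<epsilon>1: "\<epsilon>1 > 0" "ball z \<epsilon>1 \<subseteq> - closure ?ext"
    using openE by blast
  define \<epsilon> where "\<epsilon> = min \<epsilon>0 \<epsilon>1"
  have \<epsilon>: "\<epsilon> > 0" "ball z \<epsilon> \<inter> ?X \<subseteq> edge u v - V"
  proof -
    have "ball z \<epsilon> \<subseteq> ball z \<epsilon>0" unfolding \<epsilon>_def by (simp add: subset_ball)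
    then show "ball z \<epsilon> \<inter> ?X \<subseteq> edge u v - V" using \<epsilon>0(2) by blast
  qed (simp add: \<epsilon>_def \<epsilon>0 \<epsilon>1)
  have "ball z \<epsilon> \<subseteq> - closure ?ext"
    using \<epsilon>1(2) subset_ball[of \<epsilon> \<epsilon>1 z] unfolding \<epsilon>_def by simp
  then have \<epsilon>e: "y \<notin> ?ext" if "y \<in> ball z \<epsilon>" for y
    using that closure_subset[of ?ext] by blast
  obtain y1 where y1: "y1 \<in> ball z \<epsilon>" "y1 \<notin> edge u v"
    using ball_not_subset_arc[OF g(1) \<epsilon>(1)] unfolding g(2) by blast
  then have "y1 \<notin> ?X" using \<epsilon>(2) by blast
  then obtain w1 where w1: "adj V E u w1" "adj V E v w1" "y1 \<in> inside (tri u v w1)"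
    using triangle_at_edge[OF uv z(1,2) \<epsilon> y1(1) _ \<epsilon>e[OF y1(1)]] by blast
  obtain cc where cc: "simple_path cc" "pathfinish cc = pathstart cc" "path_image cc = tri u v w1"
    using tri_closed_curve[OF uv w1(2)] w1(1) adj_sym by metis
  have "frontier (outside (tri u v w1)) = tri u v w1"
    using Jordan_inside_outside[OF cc(1,2)] unfolding cc(3) by blast
  then have "z \<in> closure (outside (tri u v w1))"
    using z(1) closure_Un_frontier unfolding tri_def by blast
  \<comment> \<open>Points outside the first triangle accumulate at \<open>z\<close>. The triangle
    found from such a point has it inside and is therefore a different one.\<close>
  then obtain y2 where y2: "y2 \<in> outside (tri u v w1)" "y2 \<in> ball z \<epsilon>"
    using \<epsilon>(1) by (metis closure_approachable dist_commute mem_ball)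
  have "y2 \<notin> tri u v w1" using y2(1) outside_no_overlap by blast
  then have "y2 \<notin> ?X" using y2(2) \<epsilon>(2) unfolding tri_def by blast
  then obtain w2 where w2: "adj V E u w2" "adj V E v w2" "y2 \<in> inside (tri u v w2)"
    using triangle_at_edge[OF uv z(1,2) \<epsilon> y2(2) _ \<epsilon>e[OF y2(2)]] by blast
  have "w1 \<noteq> w2" using w2(3) y2(1) inside_Int_outside by blast
  then show ?thesis using that w1 w2 by blast
qed

text \<open>One side of the edge lies inside the cycle and so outside the exterior face. This yields
  a triangle even for an edge of the outer boundary.\<close>

lemma edge_on_cycle_common:
  assumes uv: "adj V E u v" and c: "simple_path c" "pathfinish c = pathstart c"
    and "edge u v \<subseteq> path_image c" "path_image c \<subseteq> V \<union> \<Union>E"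
  obtains w where "adj V E u w" "adj V E v w"
proof -
  let ?X = "V \<union> \<Union>E" and ?ext = "exterior_face V E"
  obtain z where z: "z \<in> edge u v" "z \<notin> V" using edge_inner_point[OF uv] .
  obtain \<epsilon> where \<epsilon>: "\<epsilon> > 0" "ball z \<epsilon> \<inter> ?X \<subseteq> edge u v - V"
    using ball_near_edge[OF uv z] .
  have "frontier (inside (path_image c)) = path_image c"
    using Jordan_inside_outside[OF c] by blast
  then have "z \<in> closure (inside (path_image c))"
    using z(1) assms(4) closure_Un_frontier by blast
  then obtain y where y: "y \<in> inside (path_image c)" "y \<in> ball z \<epsilon>"
    using \<epsilon>(1) by (metis closure_approachable dist_commute mem_ball)
  have "y \<notin> path_image c" using y(1) inside_no_overlap by blast
  then have 1: "y \<notin> ?X" using y(2) \<epsilon>(2) assms(4) by blast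
  have "y \<notin> ?ext" using y(1) exterior_face_outside[OF assms(5)] inside_Int_outside by blast
  then show ?thesis using triangle_at_edge[OF uv z \<epsilon> y(2) 1] that by metis
qed

lemma trace_inside:
  assumes "walk us" "length us \<ge> 2" "closed J" "trace us \<inter> J = {hd us, last us}"
    and "trace us \<inter> inside J \<noteq> {}"
  shows "trace us - {hd us, last us} \<subseteq> inside J"
proof (rule ccontr)
  assume n: "\<not> ?thesis"
  obtain g where g: "arc g" "path_image g = trace us" "pathstart g = hd us" "pathfinish g = last us"
    using walk_path[OF assms(1,2)] by metis
  have con: "connected (trace us - {hd us, last us})"
    using connected_simple_path_endless[OF arc_imp_simple_path[OF g(1)]] unfolding g .
  have "(trace us - {hd us, last us}) \<inter> inside J \<noteq> {}"
    using assms(4,5) inside_no_overlap[of J] by blast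
  then have "(trace us - {hd us, last us}) \<inter> frontier (inside J) \<noteq> {}"
    using connected_Int_frontier[OF con] n by blast
  moreover have "frontier (inside J) \<subseteq> J" by (simp add: assms(3) frontier_inside_subset)
  ultimately show False using assms(4) by blast
qed

lemma boundary_edge_common_unique:
  assumes b: "boundary_adj V E u v"
    and w1: "adj V E u w1" "adj V E v w1" and w2: "adj V E u w2" "adj V E v w2"
  shows "w1 = w2"
proof (rule ccontr)
  assume ne: "w1 \<noteq> w2"
  have uv: "adj V E u v" by (rule boundary_adj_adj[OF b])
  have d: "u \<noteq> v" "w1 \<noteq> u" "w1 \<noteq> v" "w2 \<noteq> u" "w2 \<noteq> v" using uv w1 w2 adj_neq by blast+
  have s: "adj V E w1 v" "adj V E w2 v" "adj V E w1 u" "adj V E w2 u" using w1 w2 adj_sym by blast+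
  have w: "walk [u, v]" "walk [u, w1, v]" "walk [u, w2, v]"
    using uv w1 w2 s d by (simp_all add: walk_def)
  \<comment> \<open>A walk through \<open>w\<close> that entered the triangle with apex
    \<open>w'\<close> would bring the vertex \<open>w\<close> inside it, making that triangle
    separating.\<close>
  have not_in: "trace [u, w, v] \<inter> inside (trace [u, v] \<union> trace [u, w', v]) = {}"
    if "walk [u, w, v]" "walk [u, w', v]" "w \<noteq> w'" "adj V E w' u" "adj V E v w'" for w w'
  proof (rule ccontr)
    assume i: "\<not> ?thesis"
    let ?J = "trace [u, v] \<union> trace [u, w', v]"
    have d': "w \<noteq> u" "w \<noteq> v" using that(1) by (auto simp: walk_def)
    have "closed ?J" using closed_trace[OF w(1)] closed_trace[OF that(2)] by (intro closed_Un) simp_all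
    have "trace [u, w, v] \<inter> trace [u, v] = {u, v}" "trace [u, w, v] \<inter> trace [u, w', v] = {u, v}"
      using traces_meet[OF that(1) _ w(1)] traces_meet[OF that(1) _ that(2)] that(3) d' by auto
    then have "trace [u, w, v] \<inter> ?J = {hd [u, w, v], last [u, w, v]}" by auto
    then have "trace [u, w, v] - {u, v} \<subseteq> inside ?J"
      using trace_inside[OF that(1) _ \<open>closed ?J\<close> _ i] by simp
    moreover have "w \<in> trace [u, w, v] \<inter> V"
      using trace_vertices[of "[u, w, v]"] that(1) by (simp add: walk_def)
    ultimately have "w \<in> V \<inter> inside (tri u v w')" using d' unfolding tri_traces by blast
    then show False using triangle_inside_empty[OF uv] that by blast
  qed
  have b': "has_boundary_step [u, v]"
    unfolding has_boundary_step_def using b by (intro exI[of _ 0]) simp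
  have 1: "trace [u, v] \<inter> inside (trace [u, w1, v] \<union> trace [u, w2, v]) = {}"
    by (rule has_boundary_step_not_inside[OF w(1) _ w(2) _ w(3)]) (use b' d in auto)
  have 2: "trace [u, w1, v] \<inter> inside (trace [u, v] \<union> trace [u, w2, v]) = {}"
    by (rule not_in[OF w(2,3) ne s(4) w2(2)])
  have 3: "trace [u, w2, v] \<inter> inside (trace [u, v] \<union> trace [u, w1, v]) = {}"
    by (rule not_in[OF w(3,2) ne[symmetric] s(3) w1(2)])
  have "trace [u, w2, v] \<inter> inside (trace [u, v] \<union> trace [u, w1, v]) \<noteq> {}"
    by (rule theta_walks[OF w(1) _ w(2) _ w(3)]) (use 1 2 d ne in auto)
  then show False using 3 by blast
qed

text \<open>Without \<open>v\<close> the graph is still connected, so \<open>a\<close>,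
  \<open>b\<close> and \<open>c\<close> are joined by a tripod with centre \<open>m\<close> that
  avoids \<open>v\<close>. Its three legs, prolonged to \<open>v\<close>, are walks from
  \<open>v\<close> to \<open>m\<close> that begin with boundary edges.\<close>

lemma boundary_degree:
  assumes a: "boundary_adj V E v a" and b: "boundary_adj V E v b" and c: "boundary_adj V E v c"
    and ne: "a \<noteq> b" "a \<noteq> c" "b \<noteq> c"
  shows False
proof -
  let ?U = "V - {v}"
  have adj: "adj V E v a" "adj V E v b" "adj V E v c" using a b c boundary_adj_adj by blast+
  have v: "v \<in> V" and U: "a \<in> ?U" "b \<in> ?U" "c \<in> ?U"
    using adj adj_vertices adj_neq by blast+
  obtain p where p: "p \<noteq> []" "hd p = a" "last p = b" "distinct p" "successively (adj V E) p" "set p \<subseteq> ?U"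
    using reach_list[OF connected_minus_vertex[OF v U(1,2)] U(1)] by blast
  have "\<exists>q m. q \<noteq> [] \<and> hd q = c \<and> last q = m \<and> m \<in> set p \<and> distinct q \<and> successively (adj V E) q \<and>
      set q \<subseteq> ?U \<and> set q \<inter> set p = {m}"
  proof (cases "c \<in> set p")
    case True
    then show ?thesis using U by (intro exI[of _ "[c]"] exI[of _ c]) auto
  next
    case False
    have "b \<in> set p" using p last_in_set by blast
    then obtain y m where ym: "(c, y) \<in> {(x, y). x \<in> ?U - set p \<and> y \<in> ?U - set p \<and> adj V E x y}\<^sup>*"
        "y \<in> ?U - set p" "m \<in> ?U \<inter> set p" "adj V E y m"
      using reach_first_hit[OF connected_minus_vertex[OF v U(3,2)], of "set p"] U(3) False by blast
    obtain q where q: "q \<noteq> []" "hd q = c" "last q = y" "distinct q" "successively (adj V E) q" "set q \<subseteq> ?U - set p"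
      using reach_list[OF ym(1)] U(3) False by blast
    have "m \<notin> set q" using q(6) ym(3) by blast
    then show ?thesis using q ym
      by (intro exI[of _ "q @ [m]"] exI[of _ m]) (auto simp: successively_append_iff)
  qed
  then obtain q m where q: "q \<noteq> []" "hd q = c" "last q = m" "m \<in> set p" "distinct q" "successively (adj V E) q"
      "set q \<subseteq> ?U" "set q \<inter> set p = {m}" by blast
  obtain p1 p2 where ps: "p = p1 @ m # p2" using q(4) by (meson split_list)
  let ?us = "v # p1 @ [m]" and ?vs = "v # rev p2 @ [m]" and ?ws = "v # q"
  have a1: "hd (p1 @ [m]) = a" using p(2) ps by (cases p1) auto
  have b1: "hd (rev p2 @ [m]) = b" using p(3) ps by (cases p2 rule: rev_cases) auto
  have sp: "successively (adj V E) (p1 @ [m])" "successively (adj V E) (rev p2 @ [m])"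
  proof -
    show "successively (adj V E) (p1 @ [m])"
      using p(5) ps by (auto simp: successively_append_iff)
    have "successively (adj V E) (m # p2)"
      using p(5) ps by (simp add: successively_append_iff)
    then have "successively (adj V E) (rev (m # p2))"
      unfolding successively_rev using adj_sym by (metis (no_types, lifting) successively_mono)
    then show "successively (adj V E) (rev p2 @ [m])" by simp
  qed
  have mq: "m \<in> set q" using q by auto
  have w: "walk ?us" "walk ?vs" "walk ?ws"
    using sp p(4,6) q(1,2,5,6,7) ps a1 b1 adj unfolding walk_def
    by (auto simp: successively_Cons)
  have bs: "has_boundary_step ?us" "has_boundary_step ?vs" "has_boundary_step ?ws"
    unfolding has_boundary_step_def using a b c a1 b1 q(1,2)
    by (auto intro!: exI[of _ 0] simp: hd_conv_nth)
  have nv: "v \<notin> set p" "v \<notin> set q" using p(6) q(7) by blast+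
  \<comment> \<open>The centre \<open>m\<close> may coincide with one of the three neighbours, and
    then that walk is a single edge. As the neighbours are distinct, this happens for one walk at
    most.\<close>
  have l: "m = a" if "p1 = []" using that a1 by simp
  have l': "m = b" if "p2 = []" using that b1 by simp
  have l'': "m = c" if "length q = 1" using that q(2,3) by (cases q) auto
  have lq: "length q = 1 \<or> length q \<ge> 2" using q(1) by (cases q; cases "tl q") auto
  show False
  proof (rule no_boundary_theta[OF w(1) _ w(2) _ w(3)])
    show "set ?us \<inter> set ?vs = {hd ?us, last ?us}"
      using p(4) ps nv by auto
    show "set ?us \<inter> set ?ws = {hd ?us, last ?us}" "set ?vs \<inter> set ?ws = {hd ?us, last ?us}"
      using q(8) ps nv mq by auto
    show "3 \<le> length ?us \<or> 3 \<le> length ?vs"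
      using l l' ne by (cases p1; cases p2) auto
    show "3 \<le> length ?us \<or> 3 \<le> length ?ws"
      using l l'' lq ne by (cases p1) auto
    show "3 \<le> length ?vs \<or> 3 \<le> length ?ws"
      using l' l'' lq ne by (cases p2) auto
  qed (use bs q in \<open>auto simp: Suc_le_eq\<close>)
qed

text \<open>The two arcs between \<open>c\<close> and \<open>c'\<close> of a cycle with vertices
  \<open>C\<close> and point set \<open>J\<close>. Only \<open>B\<close> must have an inner vertex,
  so that \<open>c\<close> and \<open>c'\<close> may be neighbours on the cycle.\<close>

definition cycle_arcs :: "complex set \<Rightarrow> complex set \<Rightarrow> complex \<Rightarrow> complex \<Rightarrow> bool" where
  "cycle_arcs C J c c' \<longleftrightarrow> (\<exists>A B. walk A \<and> walk B \<and> length A \<ge> 2 \<and> length B \<ge> 3 \<and>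
     hd A = c \<and> hd B = c \<and> last A = c' \<and> last B = c' \<and> set A \<union> set B = C \<and> set A \<inter> set B = {c, c'} \<and>
     has_boundary_step A \<and> has_boundary_step B \<and> trace A \<union> trace B = J)"

lemma four_cycle_arcs:
  assumes b: "boundary_adj V E m1 m2" "boundary_adj V E m2 m3" "boundary_adj V E m3 m4" "boundary_adj V E m4 m1"
    and d: "distinct [m1, m2, m3, m4]" and c: "c \<in> {m2, m3, m4}"
  shows "cycle_arcs {m1, m2, m3, m4} (edge m1 m2 \<union> edge m2 m3 \<union> edge m3 m4 \<union> edge m4 m1) m1 c"
proof -
  have b': "boundary_adj V E m2 m1" "boundary_adj V E m3 m2" "boundary_adj V E m4 m3" "boundary_adj V E m1 m4"
    using b boundary_adj_sym by blast+
  note adj = b[THEN boundary_adj_adj] b'[THEN boundary_adj_adj]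
  have bs: "has_boundary_step (x # y # zs)" if "boundary_adj V E x y" for x y zs
    unfolding has_boundary_step_def using that by (intro exI[of _ 0]) simp
  have ec: "edge m2 m1 = edge m1 m2" "edge m3 m2 = edge m2 m3" "edge m4 m3 = edge m3 m4" "edge m1 m4 = edge m4 m1"
    by (rule edge_commute)+
  consider "c = m2" | "c = m3" | "c = m4" using c by blast
  then show ?thesis
  proof cases
    case 1
    show ?thesis
    proof (unfold cycle_arcs_def, rule exI[of _ "[m1, m2]"], rule exI[of _ "[m1, m4, m3, m2]"], intro conjI)
      show "trace [m1, m2] \<union> trace [m1, m4, m3, m2] = edge m1 m2 \<union> edge m2 m3 \<union> edge m3 m4 \<union> edge m4 m1"
        unfolding trace_def steps.simps ec by blast
    qed (use 1 adj b b' bs d in \<open>auto simp: walk_def\<close>)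
  next
    case 2
    show ?thesis
    proof (unfold cycle_arcs_def, rule exI[of _ "[m1, m2, m3]"], rule exI[of _ "[m1, m4, m3]"], intro conjI)
      show "trace [m1, m2, m3] \<union> trace [m1, m4, m3] = edge m1 m2 \<union> edge m2 m3 \<union> edge m3 m4 \<union> edge m4 m1"
        unfolding trace_def steps.simps ec by blast
    qed (use 2 adj b b' bs d in \<open>auto simp: walk_def\<close>)
  next
    case 3
    show ?thesis
    proof (unfold cycle_arcs_def, rule exI[of _ "[m1, m4]"], rule exI[of _ "[m1, m2, m3, m4]"], intro conjI)
      show "trace [m1, m4] \<union> trace [m1, m2, m3, m4] = edge m1 m2 \<union> edge m2 m3 \<union> edge m3 m4 \<union> edge m4 m1"
        unfolding trace_def steps.simps ec by blast
    qed (use 3 adj b b' bs d in \<open>auto simp: walk_def\<close>)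
  qed
qed

lemma four_cycle_arcs_any:
  assumes b: "boundary_adj V E m1 m2" "boundary_adj V E m2 m3" "boundary_adj V E m3 m4" "boundary_adj V E m4 m1"
    and d: "distinct [m1, m2, m3, m4]" and c: "c \<in> {m1, m2, m3, m4}" "c' \<in> {m1, m2, m3, m4}" "c \<noteq> c'"
  shows "cycle_arcs {m1, m2, m3, m4} (edge m1 m2 \<union> edge m2 m3 \<union> edge m3 m4 \<union> edge m4 m1) c c'"
proof -
  have perm: "{m2, m3, m4, m1} = {m1, m2, m3, m4}" "{m3, m4, m1, m2} = {m1, m2, m3, m4}" "{m4, m1, m2, m3} = {m1, m2, m3, m4}"
    by blast+
  have U: "edge m2 m3 \<union> edge m3 m4 \<union> edge m4 m1 \<union> edge m1 m2 = edge m1 m2 \<union> edge m2 m3 \<union> edge m3 m4 \<union> edge m4 m1"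
    "edge m3 m4 \<union> edge m4 m1 \<union> edge m1 m2 \<union> edge m2 m3 = edge m1 m2 \<union> edge m2 m3 \<union> edge m3 m4 \<union> edge m4 m1"
    "edge m4 m1 \<union> edge m1 m2 \<union> edge m2 m3 \<union> edge m3 m4 = edge m1 m2 \<union> edge m2 m3 \<union> edge m3 m4 \<union> edge m4 m1"
    by blast+
  have d': "distinct [m2, m3, m4, m1]" "distinct [m3, m4, m1, m2]" "distinct [m4, m1, m2, m3]"
    using d by auto
  consider "c = m1" | "c = m2" | "c = m3" | "c = m4" using c(1) by blast
  then show ?thesis
  proof cases
    case 1
    then have "c' \<in> {m2, m3, m4}" using c by blast
    then show ?thesis using four_cycle_arcs[OF b d] 1 by metis
  next
    case 2
    then have "c' \<in> {m3, m4, m1}" using c by blast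
    then have "cycle_arcs {m2, m3, m4, m1} (edge m2 m3 \<union> edge m3 m4 \<union> edge m4 m1 \<union> edge m1 m2) m2 c'"
      by (rule four_cycle_arcs[OF b(2,3,4,1) d'(1)])
    then show ?thesis unfolding perm(1) U(1) 2 .
  next
    case 3
    then have "c' \<in> {m4, m1, m2}" using c by blast
    then have "cycle_arcs {m3, m4, m1, m2} (edge m3 m4 \<union> edge m4 m1 \<union> edge m1 m2 \<union> edge m2 m3) m3 c'"
      by (rule four_cycle_arcs[OF b(3,4,1,2) d'(2)])
    then show ?thesis unfolding perm(2) U(2) 3 .
  next
    case 4
    then have "c' \<in> {m1, m2, m3}" using c by blast
    then have "cycle_arcs {m4, m1, m2, m3} (edge m4 m1 \<union> edge m1 m2 \<union> edge m2 m3 \<union> edge m3 m4) m4 c'"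
      by (rule four_cycle_arcs[OF b(4,1,2,3) d'(3)])
    then show ?thesis unfolding perm(3) U(3) 4 .
  qed
qed

text \<open>If \<open>x\<close> is off the cycle, then biconnectedness gives a walk \<open>Q\<close>
  through the component of \<open>x\<close> off the cycle that joins two cycle vertices. Both arcs
  of the cycle contain boundary edges, so of the three arcs it is \<open>Q\<close> that lies inside.
  The component cannot cross \<open>J\<close>, so \<open>x\<close> is inside too, although it lies
  on the outer boundary.\<close>

lemma boundary_four_cycle:
  assumes b: "boundary_adj V E m1 m2" "boundary_adj V E m2 m3" "boundary_adj V E m3 m4" "boundary_adj V E m4 m1"
    and d: "distinct [m1, m2, m3, m4]" and xy: "boundary_adj V E x x'"
  shows "x \<in> {m1, m2, m3, m4}"
proof (rule ccontr)
  assume nx: "x \<notin> {m1, m2, m3, m4}"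
  define C where "C = {m1, m2, m3, m4}"
  define J where "J = edge m1 m2 \<union> edge m2 m3 \<union> edge m3 m4 \<union> edge m4 m1"
  define R where "R = {(x, y). x \<in> V - C \<and> y \<in> V - C \<and> adj V E x y}"
  have C: "C \<subseteq> V" unfolding C_def using b[THEN boundary_adj_adj] adj_vertices by blast
  have x: "x \<in> V" "x \<in> V - C" using nx adj_vertices[OF boundary_adj_adj[OF xy]] unfolding C_def by blast+
  have m1: "m1 \<in> V" "m1 \<in> C" using C unfolding C_def by blast+
  obtain y c where yc: "(x, y) \<in> R\<^sup>*" "y \<in> V - C" "c \<in> V \<inter> C" "adj V E y c"
    using reach_first_hit[OF connected_all[OF x(1) m1(1)] x(2) m1(2)] unfolding R_def by blast
  \<comment> \<open>Some cycle vertex other than \<open>c\<close>: walking to it in the graph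
    without \<open>c\<close> forces a second point of attachment.\<close>
  define m where "m = (if c = m1 then m2 else m1)"
  have m: "m \<in> C" "m \<noteq> c" unfolding m_def C_def using d by auto
  have x': "x \<in> (V - {c}) - C" "x \<in> V - {c}" "m \<in> V - {c}" using x(2) yc(3) m C by blast+
  have VC: "V - {c} - C = V - C" using yc(3) by blast
  obtain y' c' where yc': "(x, y') \<in> R\<^sup>*" "y' \<in> V - C" "c' \<in> (V - {c}) \<inter> C" "adj V E y' c'"
    using reach_first_hit[OF connected_minus_vertex[OF _ x'(2,3)] x'(1) m(1)] yc(3) unfolding VC R_def by blast
  have "sym R" unfolding R_def sym_def using adj_sym by blast
  then have "(y, x) \<in> R\<^sup>*" using yc(1) by (metis sym_rtrancl symD)
  then have "(y, y') \<in> R\<^sup>*" using yc'(1) by (rule rtrancl_trans)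
  then obtain p where p: "p \<noteq> []" "hd p = y" "last p = y'" "distinct p" "successively (adj V E) p" "set p \<subseteq> V - C"
    using reach_list[of y y' "V - C" "adj V E"] yc(2) unfolding R_def by blast
  define Q where "Q = c # p @ [c']"
  have cc: "c \<in> C" "c' \<in> C" "c \<noteq> c'" using yc yc' by blast+
  have Q: "walk Q" "length Q \<ge> 3" "hd Q = c" "last Q = c'" "set Q = {c, c'} \<union> set p"
    using p yc(4) yc'(4) cc adj_sym unfolding walk_def Q_def
    by (auto simp: successively_Cons successively_append_iff Suc_le_eq)
  obtain A B where AB: "walk A" "walk B" "length A \<ge> 2" "length B \<ge> 3" "hd A = c" "hd B = c" "last A = c'" "last B = c'"
    "set A \<union> set B = C" "set A \<inter> set B = {c, c'}" "has_boundary_step A" "has_boundary_step B"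
    "trace A \<union> trace B = J"
    using four_cycle_arcs_any[OF b d, of c c'] cc unfolding C_def[symmetric] J_def[symmetric] cycle_arcs_def
    by metis
  have AQ: "set A \<inter> set Q = {c, c'}" "set B \<inter> set Q = {c, c'}"
    using AB(9,10) Q(5) p(6) by blast+
  then have QA: "set Q \<inter> set A = {c, c'}" "set Q \<inter> set B = {c, c'}" "set B \<inter> set A = {c, c'}"
    using AB(10) by blast+
  have 1: "trace A \<inter> inside (trace B \<union> trace Q) = {}"
    by (rule has_boundary_step_not_inside[OF AB(1) _ AB(2) _ Q(1)]) (use AB Q AQ in simp_all)
  have 2: "trace B \<inter> inside (trace A \<union> trace Q) = {}"
    by (rule has_boundary_step_not_inside[OF AB(2) _ AB(1) _ Q(1)]) (use AB Q AQ QA in simp_all)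
  have "trace Q \<inter> inside (trace A \<union> trace B) \<noteq> {}"
    by (rule theta_walks[OF AB(1) _ AB(2) _ Q(1)]) (use AB Q AQ 1 2 in simp_all)
  then have 3: "trace Q \<inter> inside J \<noteq> {}" unfolding AB(13) .
  have l2: "length A \<ge> 2" "length B \<ge> 2" "length Q \<ge> 2" using AB Q by linarith+
  have cl: "closed J"
    unfolding AB(13)[symmetric] using closed_trace AB l2 by (intro closed_Un)
  have "trace Q \<inter> trace A = {hd Q, last Q}"
    by (rule traces_meet[OF Q(1) l2(3) AB(1) l2(1)]) (use AB Q QA in simp_all)
  moreover have "trace Q \<inter> trace B = {hd Q, last Q}"
    by (rule traces_meet[OF Q(1) l2(3) AB(2) l2(2)]) (use AB Q QA in simp_all)
  ultimately have "trace Q \<inter> J = {hd Q, last Q}" unfolding AB(13)[symmetric] by blast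
  then have "trace Q - {hd Q, last Q} \<subseteq> inside J"
    by (rule trace_inside[OF Q(1) l2(3) cl _ 3])
  moreover have "y \<in> set Q" using p(1,2) hd_in_set Q(5) by blast
  moreover have "set Q = trace Q \<inter> V"
    using trace_vertices l2(3) Q(1) unfolding walk_def by blast
  moreover have "y \<notin> {hd Q, last Q}" using yc(2) cc Q by blast
  ultimately have yin: "y \<in> inside J" by blast
  have JX: "J \<subseteq> V \<union> \<Union>E"
    unfolding J_def using b[THEN boundary_adj_adj, THEN edge_props(1)] by blast
  have JV: "J \<inter> V = C"
    unfolding J_def C_def using b[THEN boundary_adj_adj, THEN edge_props(2)] by blast
  have step: "s \<in> inside J" if "(r, s) \<in> R" "r \<in> inside J" for r s
  proof (rule ccontr)
    assume "s \<notin> inside J"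
    have rs: "adj V E r s" "r \<notin> C" "s \<notin> C" using that(1) unfolding R_def by blast+
    have V: "edge r s \<inter> V = {r, s}" by (rule edge_props(2)[OF rs(1)])
    have "edge r s \<inter> e \<subseteq> V" if "e \<in> {edge m1 m2, edge m2 m3, edge m3 m4, edge m4 m1}" for e
    proof (rule edges_meet_in_vertices)
      show "edge r s \<in> E" by (rule edge_props(1)[OF rs(1)])
      show "e \<in> E" using that b[THEN boundary_adj_adj, THEN edge_props(1)] by blast
      have "e \<subseteq> J" using that unfolding J_def by blast
      then have "r \<notin> e" using JV rs(2) V by blast
      then show "edge r s \<noteq> e" using V by blast
    qed
    then have "edge r s \<inter> J \<subseteq> V" unfolding J_def by blast
    then have "edge r s \<inter> J \<subseteq> (edge r s \<inter> V) \<inter> (J \<inter> V)" by blast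
    then have dis: "edge r s \<inter> J = {}" unfolding V JV using rs(2,3) by blast
    obtain g where "arc g" "path_image g = edge r s" using edge_path[OF rs(1)] by metis
    then have "connected (edge r s)" using connected_arc_image by metis
    moreover have "r \<in> edge r s" "s \<in> edge r s" using V by blast+
    ultimately have "edge r s \<inter> frontier (inside J) \<noteq> {}"
      using connected_Int_frontier[of "edge r s" "inside J"] that(2) \<open>s \<notin> inside J\<close> by blast
    moreover have "frontier (inside J) \<subseteq> J" by (simp add: cl frontier_inside_subset)
    ultimately show False using dis by blast
  qed
  have "x \<in> inside J"
    using \<open>(y, x) \<in> R\<^sup>*\<close> by (induction rule: rtrancl_induct) (use yin step in blast)+
  moreover have "x \<in> frontier (exterior_face V E)"
    using xy edge_props(2)[OF boundary_adj_adj[OF xy]] unfolding boundary_adj_edge by blast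
  ultimately show False using frontier_exterior_not_inside[OF JX cl] by blast
qed

lemma four_cycle_common:
  assumes b: "boundary_adj V E m1 m2" "boundary_adj V E m2 m3" "boundary_adj V E m3 m4" "boundary_adj V E m4 m1"
    and d: "distinct [m1, m2, m3, m4]"
  obtains w where "adj V E m1 w" "adj V E m2 w"
proof -
  obtain A B where AB: "walk A" "walk B" "length A \<ge> 2" "length B \<ge> 3" "hd A = m1" "hd B = m1" "last A = m3" "last B = m3"
    "set A \<inter> set B = {m1, m3}"
    "trace A \<union> trace B = edge m1 m2 \<union> edge m2 m3 \<union> edge m3 m4 \<union> edge m4 m1"
    using four_cycle_arcs[OF b d, of m3] unfolding cycle_arcs_def by auto
  obtain c where c: "simple_path c" "pathfinish c = pathstart c" "path_image c = trace A \<union> trace B"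
    by (rule closed_curve_of_walks[OF AB(1) _ AB(2)]) (use AB in auto)
  show ?thesis
  proof (rule edge_on_cycle_common[OF boundary_adj_adj[OF b(1)] c(1,2) _ _ that])
    show "edge m1 m2 \<subseteq> path_image c" unfolding c(3) AB(10) by blast
    show "path_image c \<subseteq> V \<union> \<Union>E"
      unfolding c(3) AB(10) using b[THEN boundary_adj_adj, THEN edge_props(1)] by blast
  qed
qed

section \<open>Corner implying paths and their chords\<close>

lemma successively_nth:
  "(\<And>i. i + 1 < length us \<Longrightarrow> P (us ! i) (us ! (i + 1))) \<Longrightarrow> successively P us"
proof (induction us)
  case (Cons u us)
  show ?case
  proof (cases us)
    case (Cons v vs)
    have "successively P us" by (rule Cons.IH) (use Cons.prems[of "Suc _"] in simp)
    then show ?thesis using Cons Cons.prems[of 0] by simp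
  qed simp
qed simp

text \<open>What uniqueness needs of a corner implying path, freed from positions in the list. In
  this form it is visibly invariant under reversal, so that either direction of a path may be
  taken.\<close>

definition chordal :: "complex list \<Rightarrow> bool" where
  "chordal us \<longleftrightarrow> distinct us \<and> successively (boundary_adj V E) us \<and>
     adj V E (hd us) (last us) \<and> \<not> boundary_adj V E (hd us) (last us) \<and>
     (\<forall>x\<in>set us. \<forall>y\<in>set us. adj V E x y \<longrightarrow> boundary_adj V E x y \<or> {x, y} = {hd us, last us})"

lemma corner_implying_path_chordal:
  assumes "corner_implying_path V E us"
  shows "chordal us"
  unfolding chordal_def
proof (intro conjI ballI impI)
  note cip = assms[unfolded corner_implying_path_def]
  show "distinct us" "adj V E (hd us) (last us)" "\<not> boundary_adj V E (hd us) (last us)"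
    using cip by blast+
  show suc: "successively (boundary_adj V E) us" using cip by (intro successively_nth) blast
  fix x y assume "x \<in> set us" "y \<in> set us" and xy: "adj V E x y"
  then obtain i j where ij: "i < length us" "j < length us" "x = us ! i" "y = us ! j"
    by (metis in_set_conv_nth)
  have ends: "hd us = us ! 0" "last us = us ! (length us - 1)"
    using ij(1) hd_conv_nth[of us] last_conv_nth[of us] by fastforce+
  have main: "boundary_adj V E (us ! i) (us ! j) \<or> {us ! i, us ! j} = {hd us, last us}"
    if "i < j" "j < length us" "adj V E (us ! i) (us ! j)" for i j
  proof (cases "j = i + 1")
    case True then show ?thesis using cip that(2) by blast
  next
    case False
    then have "i + 1 < j" using that(1) by linarith
    then have "(i, j) = (0, length us - 1)" using cip that(2,3) by blast
    then show ?thesis using ends by simp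
  qed
  have "i \<noteq> j" using ij adj_neq[OF xy] by blast
  then consider "i < j" | "j < i" by linarith
  then show "boundary_adj V E x y \<or> {x, y} = {hd us, last us}"
  proof cases
    case 1 then show ?thesis using main ij xy by blast
  next
    case 2
    then have "boundary_adj V E y x \<or> {y, x} = {hd us, last us}"
      using main ij xy adj_sym by blast
    then show ?thesis using boundary_adj_sym insert_commute by metis
  qed
qed

lemma chordal_rev: "chordal us \<Longrightarrow> chordal (rev us)"
proof -
  assume c: "chordal us"
  have "successively (\<lambda>x y. boundary_adj V E y x) us"
    using c boundary_adj_sym unfolding chordal_def by (metis (no_types, lifting) successively_mono)
  then show ?thesis
    using c adj_sym boundary_adj_sym insert_commute unfolding chordal_def hd_rev last_rev set_rev
      successively_rev distinct_rev by metis
qed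

text \<open>A vertex has at most two boundary neighbours, so after a common first edge every further
  vertex is forced until one walk ends.\<close>

lemma boundary_walk_prefix:
  assumes "successively (boundary_adj V E) (v # w # us)" "distinct (v # w # us)"
    and "successively (boundary_adj V E) (v # w # vs)" "distinct (v # w # vs)"
  shows "\<exists>ms. vs = us @ ms \<or> us = vs @ ms"
  using assms
proof (induction us arbitrary: v w vs)
  case (Cons a us)
  show ?case
  proof (cases vs)
    case (Cons b bs)
    have ba: "boundary_adj V E w a" "boundary_adj V E w b" "boundary_adj V E w v"
      using Cons.prems Cons boundary_adj_sym by auto
    have "a = b"
      using boundary_degree[OF ba(3,1,2)] Cons.prems Cons by auto
    then obtain ms where "bs = us @ ms \<or> us = bs @ ms"
      using Cons.IH[of w a bs] Cons.prems Cons by auto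
    then show ?thesis using Cons \<open>a = b\<close> by auto
  qed auto
qed auto

text \<open>The lists \<open>L\<close> and \<open>R\<close> are read outwards from the inner vertex
  \<open>v\<close>. The chord of the shorter path joins two vertices of the longer one and is no
  boundary edge, so it is the chord of the longer path as well.\<close>

lemma chordal_nested:
  assumes us: "chordal (rev (L @ M) @ v # R @ N)" and vs: "chordal (rev L @ v # R)"
    and ne: "L \<noteq> []" "R \<noteq> []"
  shows "M = [] \<and> N = []"
proof -
  let ?us = "rev (L @ M) @ v # R @ N"
  have hv: "hd (rev L @ v # R) = last L" "last (rev L @ v # R) = last R"
    using ne by (auto simp: hd_append hd_rev)
  have hu: "hd ?us = last (L @ M)" "last ?us = last (R @ N)"
    using ne by (auto simp: hd_append hd_rev)
  have "adj V E (last L) (last R)" "\<not> boundary_adj V E (last L) (last R)"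
    using vs unfolding chordal_def hv by blast+
  moreover have in_us: "last L \<in> set ?us" "last R \<in> set ?us" using ne by auto
  ultimately have eq: "{last L, last R} = {last (L @ M), last (R @ N)}"
    using us unfolding chordal_def hu by metis
  have d: "distinct ?us" using us unfolding chordal_def by (rule conjunct1)
  have m: "last L \<in> set L" "last R \<in> set R" "last (L @ M) \<in> set (L @ M)" "last (R @ N) \<in> set (R @ N)"
    using ne by (simp_all del: last_append set_append)
  have dis: "set (L @ M) \<inter> set (R @ N) = {}" using d by auto
  then have e: "last L = last (L @ M)" "last R = last (R @ N)"
    using eq m unfolding doubleton_eq_iff by auto
  have "M = []"
  proof (rule ccontr)
    assume "M \<noteq> []"
    then have "last L \<in> set M" using e(1) by simp
    then show False using m(1) d by auto
  qed
  moreover have "N = []"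
  proof (rule ccontr)
    assume "N \<noteq> []"
    then have "last R \<in> set N" using e(2) by simp
    then show False using m(2) d by auto
  qed
  ultimately show ?thesis by simp
qed

text \<open>The paths overlap in \<open>rev L @ v # R\<close>; \<open>us\<close> goes on beyond it
  to the left and \<open>vs\<close> to the right. Three walks lead from \<open>c\<close> to
  \<open>b\<close>: the overlap itself, the one along \<open>M\<close> that returns by the chord
  from \<open>a\<close>, and the one by the chord to \<open>d\<close> that returns along
  \<open>N\<close>. Each has a boundary edge.\<close>

lemma chordal_crossing:
  assumes us: "chordal (rev (L @ M) @ v # R)" and vs: "chordal (rev L @ v # R @ N)"
    and ne: "L \<noteq> []" "R \<noteq> []" "M \<noteq> []" "N \<noteq> []"
  shows False
proof -
  let ?us = "rev (L @ M) @ v # R" and ?vs = "rev L @ v # R @ N"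
  define a b c d where "a = last M" and "b = last R" and "c = last L" and "d = last N"
  have hu: "hd ?us = a" "last ?us = b" and hv: "hd ?vs = c" "last ?vs = d"
    using ne unfolding a_def b_def c_def d_def by (auto simp: hd_append hd_rev)
  have du: "distinct ?us" using us unfolding chordal_def by (rule conjunct1)
  have dv: "distinct ?vs" using vs unfolding chordal_def by (rule conjunct1)
  have mem: "a \<in> set M" "b \<in> set R" "c \<in> set L" "d \<in> set N"
    using ne unfolding a_def b_def c_def d_def by auto
  have ab: "adj V E a b" "\<not> boundary_adj V E a b" using us hu unfolding chordal_def by metis+
  have cd: "adj V E c d" "\<not> boundary_adj V E c d" using vs hv unfolding chordal_def by metis+
  have chu: "boundary_adj V E x y \<or> {x, y} = {a, b}" if "x \<in> set ?us" "y \<in> set ?us" "adj V E x y" for x y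
    using us that hu unfolding chordal_def by metis
  have chv: "boundary_adj V E x y \<or> {x, y} = {c, d}" if "x \<in> set ?vs" "y \<in> set ?vs" "adj V E x y" for x y
    using vs that hv unfolding chordal_def by metis
  have nab: "c \<noteq> a" "c \<noteq> b" "b \<noteq> d" using mem du dv by auto
  have dM: "d \<notin> set M"
  proof
    assume "d \<in> set M"
    then have "{c, d} = {a, b}" using chu[of c d] mem(3) cd by auto
    then show False using nab unfolding doubleton_eq_iff by blast
  qed
  have aN: "a \<notin> set N"
  proof
    assume "a \<in> set N"
    then have "{a, b} = {c, d}" using chv[of a b] mem(2) ab by auto
    then show False using nab unfolding doubleton_eq_iff by blast
  qed
  have suc_u: "successively (boundary_adj V E) (c # M)"
  proof -
    have "successively (boundary_adj V E) ((rev M @ rev L) @ v # R)"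
      using us unfolding chordal_def by simp
    then have "successively (boundary_adj V E) (rev M @ rev L)"
      unfolding successively_append_iff[of _ "rev M @ rev L"] by (rule conjunct1)
    then have "successively (boundary_adj V E) (rev M @ [c])"
      using ne by (auto simp: successively_append_iff c_def hd_rev)
    then have "successively (boundary_adj V E) (rev (c # M))" by simp
    then show ?thesis
      unfolding successively_rev using boundary_adj_sym by (metis (no_types, lifting) successively_mono)
  qed
  have suc_v: "successively (boundary_adj V E) (b # N)"
    using vs ne unfolding chordal_def
    by (auto simp: successively_append_iff successively_Cons b_def split: if_splits)
  \<comment> \<open>Where \<open>N\<close> first ran into \<open>M\<close>, the meeting vertex would
    have three boundary neighbours: its two along \<open>c # M\<close> and its predecessor on
    \<open>b # N\<close>. It has two along \<open>c # M\<close> because it is not the last vertex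
    \<open>a\<close>.\<close>
  have MN: "set M \<inter> set N = {}"
  proof (rule ccontr)
    assume "\<not> ?thesis"
    then have "\<exists>z\<in>set N. z \<in> set M" by blast
    then obtain N1 z N2 where N: "N = N1 @ z # N2" "z \<in> set M" "\<forall>y\<in>set N1. y \<notin> set M"
      by (elim split_list_first_propE) blast
    obtain M1 M2 where M: "M = M1 @ z # M2" using N(2) by (meson split_list)
    have "z \<noteq> a" using aN N(1) by auto
    then have "M2 \<noteq> []" using M a_def by auto
    then obtain s M3 where M2: "M2 = s # M3" by (cases M2) auto
    define p where "p = last (c # M1)"
    define w where "w = last (b # N1)"
    have zp: "boundary_adj V E z p"
      using suc_u boundary_adj_sym unfolding M p_def
      by (cases M1 rule: rev_cases) (auto simp: successively_append_iff successively_Cons split: if_splits)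
    have zs: "boundary_adj V E z s"
      using suc_u unfolding M M2 by (cases M1) (auto simp: successively_append_iff successively_Cons)
    have zw: "boundary_adj V E z w"
      using suc_v boundary_adj_sym unfolding N(1) w_def
      by (cases N1 rule: rev_cases) (auto simp: successively_append_iff successively_Cons split: if_splits)
    have pin: "p \<in> set (c # M1)" unfolding p_def by (rule last_in_set) simp
    have win: "w \<in> set (b # N1)" unfolding w_def by (rule last_in_set) simp
    have dcM: "distinct (c # M)" using du mem(3) by auto
    have "p \<noteq> s" using pin dcM unfolding M M2 by auto
    moreover have "w \<notin> set (c # M)"
    proof -
      have "b \<notin> set (c # M)" using mem(2,3) du by auto
      moreover have "c \<notin> set N1" using mem(3) dv N(1) by auto
      ultimately show ?thesis using win N(3) by auto
    qed
    then have "w \<noteq> p" "w \<noteq> s" using pin unfolding M M2 by auto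
    ultimately show False using boundary_degree[OF zp zs zw] by blast
  qed
  have adjs: "successively (adj V E) xs" if "successively (boundary_adj V E) xs" for xs
    using that boundary_adj_adj by (rule successively_mono)
  have su: "successively (adj V E) (c # M)" and sv: "successively (adj V E) (b # N)"
    using suc_u suc_v adjs by blast+
  define mid where "mid = rev L @ v # R"
  have smid: "successively (boundary_adj V E) mid"
  proof -
    have "successively (boundary_adj V E) (rev M @ mid)"
      using us unfolding chordal_def mid_def by simp
    then show ?thesis unfolding successively_append_iff[of _ "rev M"] by blast
  qed
  have w1: "walk mid" using adjs[OF smid] du unfolding walk_def mid_def by auto
  have h1: "hd mid = c" "last mid = b"
    using ne unfolding mid_def b_def c_def by (auto simp: hd_append hd_rev)
  have h3: "length mid \<ge> 3" using ne(1,2) unfolding mid_def by (cases L; cases R) auto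
  have w2: "walk (c # M @ [b])"
    using su ab(1) du mem ne unfolding walk_def a_def
    by (auto simp: successively_append_iff successively_Cons)
  have srev: "successively (adj V E) (rev N @ [b])"
  proof -
    have "successively (\<lambda>x y. adj V E y x) (b # N)"
      using sv adj_sym by (metis (no_types, lifting) successively_mono)
    then have "successively (adj V E) (rev (b # N))" unfolding successively_rev .
    then show ?thesis by simp
  qed
  have w3: "walk (c # rev N @ [b])"
    using srev cd(1) dv mem ne unfolding walk_def d_def
    by (auto simp: successively_Cons hd_append hd_rev)
  have "boundary_adj V E (mid ! 0) (mid ! Suc 0)"
    using smid h3 by (cases mid; cases "tl mid") auto
  then have b1: "has_boundary_step mid"
    unfolding has_boundary_step_def using h3 by (intro exI[of _ 0]) simp
  have b2: "has_boundary_step (c # M @ [b])"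
    unfolding has_boundary_step_def using suc_u ne by (intro exI[of _ 0]) (cases M; simp)
  have "boundary_adj V E (hd N) b" using suc_v ne boundary_adj_sym by (cases N) auto
  then have b3: "has_boundary_step (c # rev N @ [b])"
    unfolding has_boundary_step_def using ne
    by (intro exI[of _ "length N"]) (simp add: nth_append nth_Cons' rev_nth hd_conv_nth)
  have smid': "set mid = insert v (set L \<union> set R)" unfolding mid_def by auto
  show False
  proof (rule no_boundary_theta[OF w1 _ w2 _ w3])
    show "set mid \<inter> set (c # M @ [b]) = {hd mid, last mid}"
      using du mem unfolding h1 smid' by auto
    show "set mid \<inter> set (c # rev N @ [b]) = {hd mid, last mid}"
      using dv mem unfolding h1 smid' by auto
    show "set (c # M @ [b]) \<inter> set (c # rev N @ [b]) = {hd mid, last mid}"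
      using MN unfolding h1 by auto
  qed (use h1 h3 ne b1 b2 b3 in \<open>auto simp: Suc_le_eq\<close>)
qed

text \<open>Both paths leave \<open>v\<close> by the same two boundary edges, so on either side of
  \<open>v\<close> one half continues the other. The four combinations are two nestings and two
  crossings.\<close>

lemma chordal_aligned:
  assumes us: "chordal (rev L1 @ v # R1)" and vs: "chordal (rev L2 @ v # R2)"
    and ne: "L1 \<noteq> []" "R1 \<noteq> []" "L2 \<noteq> []" "R2 \<noteq> []"
    and hd: "hd L1 = hd L2" "hd R1 = hd R2"
  shows "L1 = L2 \<and> R1 = R2"
proof -
  have suc: "successively (boundary_adj V E) (v # R)" "successively (boundary_adj V E) (v # L)"
    "distinct (v # R)" "distinct (v # L)"
    if "chordal (rev L @ v # R)" "L \<noteq> []" for L R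
  proof -
    show "successively (boundary_adj V E) (v # R)" "distinct (v # R)" "distinct (v # L)"
      using that unfolding chordal_def by (auto simp: successively_append_iff)
    have "successively (boundary_adj V E) (rev L @ [v])"
      using that unfolding chordal_def by (auto simp: successively_append_iff)
    then have "successively (boundary_adj V E) (rev (v # L))" by simp
    then show "successively (boundary_adj V E) (v # L)"
      unfolding successively_rev using boundary_adj_sym by (metis (no_types, lifting) successively_mono)
  qed
  have pre: "\<exists>ms. ys = xs @ ms \<or> xs = ys @ ms"
    if h: "successively (boundary_adj V E) (v # xs)" "distinct (v # xs)"
      "successively (boundary_adj V E) (v # ys)" "distinct (v # ys)" "xs \<noteq> []" "ys \<noteq> []" "hd xs = hd ys" for xs ys
  proof -
    obtain w xs' ys' where *: "xs = w # xs'" "ys = w # ys'"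
      using h(5-7) by (cases xs; cases ys) auto
    show ?thesis using boundary_walk_prefix[of v w xs' ys'] h(1-4) unfolding * by auto
  qed
  obtain M where M: "L2 = L1 @ M \<or> L1 = L2 @ M"
    using pre[of L1 L2] suc[OF us ne(1)] suc[OF vs ne(3)] ne hd by blast
  obtain N where N: "R2 = R1 @ N \<or> R1 = R2 @ N"
    using pre[of R1 R2] suc[OF us ne(1)] suc[OF vs ne(3)] ne hd by blast
  consider "L2 = L1 @ M" "R2 = R1 @ N" | "L1 = L2 @ M" "R1 = R2 @ N"
    | "L2 = L1 @ M" "R1 = R2 @ N" | "L1 = L2 @ M" "R2 = R1 @ N" using M N by blast
  then show ?thesis
  proof cases
    case 1 then show ?thesis using chordal_nested[of L1 M v R1 N] us vs ne by simp
  next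
    case 2 then show ?thesis using chordal_nested[of L2 M v R2 N] us vs ne by simp
  next
    case 3
    show ?thesis
    proof (cases "M = [] \<or> N = []")
      case True
      then show ?thesis
        using 3 chordal_nested[of L2 "[]" v R2 N] chordal_nested[of L1 M v R1 "[]"] us vs ne by auto
    next
      case False
      then show ?thesis using chordal_crossing[of L1 M v R2 N] us vs ne 3 by auto
    qed
  next
    case 4
    show ?thesis
    proof (cases "M = [] \<or> N = []")
      case True
      then show ?thesis
        using 4 chordal_nested[of L1 "[]" v R1 N] chordal_nested[of L2 M v R2 "[]"] us vs ne by auto
    next
      case False
      then show ?thesis using chordal_crossing[of L2 M v R1 N] us vs ne 4 by auto
    qed
  qed
qed

text \<open>Both paths use the only two boundary edges at \<open>v\<close>; if they use them in
  opposite order, one path is reversed.\<close>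

lemma chordal_interior_unique:
  assumes us: "chordal us" and vs: "chordal vs"
    and v: "v \<in> set us" "v \<noteq> hd us" "v \<noteq> last us" "v \<in> set vs" "v \<noteq> hd vs" "v \<noteq> last vs"
  shows "vs = us \<or> vs = rev us"
proof -
  have split: "\<exists>L R. xs = rev L @ v # R \<and> L \<noteq> [] \<and> R \<noteq> []"
    if h: "v \<in> set xs" "v \<noteq> hd xs" "v \<noteq> last xs" for xs
  proof -
    obtain A R where "xs = A @ v # R" using h(1) by (meson split_list)
    then show ?thesis using h by (intro exI[of _ "rev A"] exI[of _ R]) auto
  qed
  obtain L1 R1 where 1: "us = rev L1 @ v # R1" "L1 \<noteq> []" "R1 \<noteq> []" using split v by metis
  obtain L2 R2 where 2: "vs = rev L2 @ v # R2" "L2 \<noteq> []" "R2 \<noteq> []" using split v by metis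
  have nb: "boundary_adj V E v (hd L)" "boundary_adj V E v (hd R)" "hd L \<noteq> hd R"
    if "chordal (rev L @ v # R)" "L \<noteq> []" "R \<noteq> []" for L R
  proof -
    show "boundary_adj V E v (hd L)" "boundary_adj V E v (hd R)"
      using that boundary_adj_sym unfolding chordal_def
      by (auto simp: successively_append_iff successively_Cons last_rev)
    have "set L \<inter> set R = {}" using that unfolding chordal_def by auto
    then show "hd L \<noteq> hd R" using that(2,3) hd_in_set by (metis disjoint_iff)
  qed
  note n1 = nb[OF us[unfolded 1(1)] 1(2,3)] and n2 = nb[OF vs[unfolded 2(1)] 2(2,3)]
  have "(hd L1 = hd L2 \<and> hd R1 = hd R2) \<or> (hd L1 = hd R2 \<and> hd R1 = hd L2)"
    using boundary_degree[OF n1(1,2) n2(1)] boundary_degree[OF n1(1,2) n2(2)] n1(3) n2(3) by metis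
  then show ?thesis
  proof
    assume "hd L1 = hd L2 \<and> hd R1 = hd R2"
    then show ?thesis using chordal_aligned[of L1 v R1 L2 R2] us vs 1 2 by simp
  next
    assume *: "hd L1 = hd R2 \<and> hd R1 = hd L2"
    have "chordal (rev R2 @ v # L2)" using chordal_rev[OF vs] 2 by simp
    then have "L1 = R2 \<and> R1 = L2" using chordal_aligned[of L1 v R1 R2 L2] us 1 2 * by simp
    then show ?thesis using 1 2 by simp
  qed
qed

end

section \<open>Systems of boxes\<close>

type_synonym 'v coord = "'v \<Rightarrow> real"

text \<open>
  A module \<open>v\<close> is the box \<open>[l v, r v] \<times> [d v, u v]\<close>. Keeping the four coordinate functions as
  explicit arguments turns reflections and the transposition of the plane into substitutions.
\<close>

definition boxes :: "'v set \<Rightarrow> 'v coord \<Rightarrow> 'v coord \<Rightarrow> 'v coord \<Rightarrow> 'v coord \<Rightarrow> bool" where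
  "boxes V l r d u \<longleftrightarrow> finite V \<and> (\<forall>v\<in>V. l v < r v \<and> d v < u v) \<and>
     (\<forall>v\<in>V. \<forall>w\<in>V. v \<noteq> w \<longrightarrow> r v \<le> l w \<or> r w \<le> l v \<or> u v \<le> d w \<or> u w \<le> d v)"

definition meets :: "'v coord \<Rightarrow> 'v coord \<Rightarrow> 'v coord \<Rightarrow> 'v coord \<Rightarrow> 'v \<Rightarrow> 'v \<Rightarrow> bool" where
  "meets l r d u v w \<longleftrightarrow> v \<noteq> w \<and>
     ((r v = l w \<or> r w = l v) \<and> max (d v) (d w) < min (u v) (u w) \<or>
      (u v = d w \<or> u w = d v) \<and> max (l v) (l w) < min (r v) (r w))"

definition in_box :: "'v coord \<Rightarrow> 'v coord \<Rightarrow> 'v coord \<Rightarrow> 'v coord \<Rightarrow> 'v \<Rightarrow> real \<Rightarrow> real \<Rightarrow> bool" where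
  "in_box l r d u v x y \<longleftrightarrow> l v \<le> x \<and> x \<le> r v \<and> d v \<le> y \<and> y \<le> u v"

text \<open>Some box contains a small open quadrant with apex \<open>(x, y)\<close> in the given direction.\<close>

definition north_east :: "'v set \<Rightarrow> 'v coord \<Rightarrow> 'v coord \<Rightarrow> 'v coord \<Rightarrow> 'v coord \<Rightarrow> real \<Rightarrow> real \<Rightarrow> bool" where
  "north_east V l r d u x y \<longleftrightarrow> (\<exists>v\<in>V. l v \<le> x \<and> x < r v \<and> d v \<le> y \<and> y < u v)"

definition north_west :: "'v set \<Rightarrow> 'v coord \<Rightarrow> 'v coord \<Rightarrow> 'v coord \<Rightarrow> 'v coord \<Rightarrow> real \<Rightarrow> real \<Rightarrow> bool" where
  "north_west V l r d u x y \<longleftrightarrow> (\<exists>v\<in>V. l v < x \<and> x \<le> r v \<and> d v \<le> y \<and> y < u v)"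

definition south_west :: "'v set \<Rightarrow> 'v coord \<Rightarrow> 'v coord \<Rightarrow> 'v coord \<Rightarrow> 'v coord \<Rightarrow> real \<Rightarrow> real \<Rightarrow> bool" where
  "south_west V l r d u x y \<longleftrightarrow> (\<exists>v\<in>V. l v < x \<and> x \<le> r v \<and> d v < y \<and> y \<le> u v)"

definition south_east :: "'v set \<Rightarrow> 'v coord \<Rightarrow> 'v coord \<Rightarrow> 'v coord \<Rightarrow> 'v coord \<Rightarrow> real \<Rightarrow> real \<Rightarrow> bool" where
  "south_east V l r d u x y \<longleftrightarrow> (\<exists>v\<in>V. l v \<le> x \<and> x < r v \<and> d v < y \<and> y \<le> u v)"

text \<open>The interior points of the region, expressed by boxes around the point; see
  \<open>mem_interior_Union_rect\<close>.\<close>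

definition full :: "'v set \<Rightarrow> 'v coord \<Rightarrow> 'v coord \<Rightarrow> 'v coord \<Rightarrow> 'v coord \<Rightarrow> real \<Rightarrow> real \<Rightarrow> bool" where
  "full V l r d u x y \<longleftrightarrow> north_east V l r d u x y \<and> north_west V l r d u x y \<and>
     south_west V l r d u x y \<and> south_east V l r d u x y"

text \<open>Four modules meeting in \<open>(x, y)\<close>, listed clockwise from the north-west.
  Rotating the plane shifts the four arguments cyclically, so it is enough to study the wall between
  the first two.\<close>

definition cross :: "'v set \<Rightarrow> 'v coord \<Rightarrow> 'v coord \<Rightarrow> 'v coord \<Rightarrow> 'v coord \<Rightarrow> real \<Rightarrow> real \<Rightarrow> 'v \<Rightarrow> 'v \<Rightarrow> 'v \<Rightarrow> 'v \<Rightarrow> bool" where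
  "cross V l r d u x y m1 m2 m3 m4 \<longleftrightarrow> m1 \<in> V \<and> m2 \<in> V \<and> m3 \<in> V \<and> m4 \<in> V \<and>
     r m1 = x \<and> d m1 = y \<and> l m2 = x \<and> d m2 = y \<and> l m3 = x \<and> u m3 = y \<and> r m4 = x \<and> u m4 = y"

definition common :: "'v set \<Rightarrow> 'v coord \<Rightarrow> 'v coord \<Rightarrow> 'v coord \<Rightarrow> 'v coord \<Rightarrow> 'v \<Rightarrow> 'v \<Rightarrow> 'v \<Rightarrow> bool" where
  "common V l r d u v w k \<longleftrightarrow> k \<in> V \<and> meets l r d u v k \<and> meets l r d u w k"

text \<open>For modules that meet, such a point can only be an end of their common wall. Speaking of
  points avoids distinguishing horizontal from vertical walls.\<close>

definition open_wall :: "'v set \<Rightarrow> 'v coord \<Rightarrow> 'v coord \<Rightarrow> 'v coord \<Rightarrow> 'v coord \<Rightarrow> 'v \<Rightarrow> 'v \<Rightarrow> bool" where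
  "open_wall V l r d u v w \<longleftrightarrow>
     (\<exists>x y. in_box l r d u v x y \<and> in_box l r d u w x y \<and> \<not> full V l r d u x y)"

section \<open>Transposition and reflection of systems of boxes\<close>

lemma boxes_transpose: "boxes V l r d u \<longleftrightarrow> boxes V d u l r"
  unfolding boxes_def by blast

lemma boxes_flip: "boxes V l r d u \<longleftrightarrow> boxes V l r (\<lambda>v. - u v) (\<lambda>v. - d v)"
  unfolding boxes_def by auto

lemma meets_transpose: "meets l r d u v w \<longleftrightarrow> meets d u l r v w"
  unfolding meets_def by blast

lemma meets_flip: "meets l r d u v w \<longleftrightarrow> meets l r (\<lambda>v. - u v) (\<lambda>v. - d v) v w"
  unfolding meets_def minus_max_eq_min[symmetric] minus_min_eq_max[symmetric] neg_less_iff_less neg_equal_iff_equal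
  by metis

lemma meets_sym: "meets l r d u v w \<longleftrightarrow> meets l r d u w v"
  unfolding meets_def max.commute[of _ "_ w"] min.commute[of _ "_ w"] by metis

lemma common_transpose: "common V l r d u v w k \<longleftrightarrow> common V d u l r v w k"
  unfolding common_def using meets_transpose by metis

lemma common_flip: "common V l r d u v w k \<longleftrightarrow> common V l r (\<lambda>v. - u v) (\<lambda>v. - d v) v w k"
  unfolding common_def using meets_flip by metis

lemma common_sym: "common V l r d u v w k \<longleftrightarrow> common V l r d u w v k"
  unfolding common_def by blast

lemma full_transpose: "full V l r d u x y \<longleftrightarrow> full V d u l r y x"
  unfolding full_def north_east_def north_west_def south_east_def south_west_def by blast

lemma full_flip: "full V l r d u x y \<longleftrightarrow> full V l r (\<lambda>v. - u v) (\<lambda>v. - d v) x (- y)"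
  unfolding full_def north_east_def north_west_def south_east_def south_west_def by auto

lemma open_wall_transpose: "open_wall V l r d u v w \<longleftrightarrow> open_wall V d u l r v w"
proof -
  have "open_wall V d u l r v w" if "open_wall V l r d u v w" for l r d u :: "'a \<Rightarrow> real"
    using that full_transpose[of V l r d u] unfolding open_wall_def in_box_def by blast
  then show ?thesis by blast
qed

lemma open_wall_flip: "open_wall V l r d u v w \<longleftrightarrow> open_wall V l r (\<lambda>v. - u v) (\<lambda>v. - d v) v w"
proof
  assume "open_wall V l r d u v w"
  then obtain x y where "in_box l r d u v x y" "in_box l r d u w x y" "\<not> full V l r d u x y"
    unfolding open_wall_def by blast
  then show "open_wall V l r (\<lambda>v. - u v) (\<lambda>v. - d v) v w"
    unfolding open_wall_def using full_flip[of V l r d u x y]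
    by (intro exI[of _ x] exI[of _ "- y"]) (auto simp: in_box_def)
next
  assume "open_wall V l r (\<lambda>v. - u v) (\<lambda>v. - d v) v w"
  then obtain x y where "in_box l r (\<lambda>v. - u v) (\<lambda>v. - d v) v x y" "in_box l r (\<lambda>v. - u v) (\<lambda>v. - d v) w x y"
    "\<not> full V l r (\<lambda>v. - u v) (\<lambda>v. - d v) x y"
    unfolding open_wall_def by blast
  then show "open_wall V l r d u v w"
    unfolding open_wall_def using full_flip[of V l r d u x "- y"]
    by (intro exI[of _ x] exI[of _ "- y"]) (auto simp: in_box_def)
qed

lemma open_wall_sym: "open_wall V l r d u v w \<longleftrightarrow> open_wall V l r d u w v"
  unfolding open_wall_def by blast

section \<open>Common neighbours of two modules that share a wall\<close>

lemma boxes_disjoint: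
  "\<lbrakk>boxes V l r d u; v \<in> V; w \<in> V; v \<noteq> w\<rbrakk> \<Longrightarrow> r v \<le> l w \<or> r w \<le> l v \<or> u v \<le> d w \<or> u w \<le> d v"
  unfolding boxes_def by blast

lemma boxes_proper: "\<lbrakk>boxes V l r d u; v \<in> V\<rbrakk> \<Longrightarrow> l v < r v \<and> d v < u v"
  unfolding boxes_def by blast

text \<open>Between its ends the wall is enclosed by \<open>v\<close> and \<open>w\<close>, so a
  third module can touch both of them only at one of the two ends.\<close>

lemma vertical_wall_common:
  assumes B: "boxes V l r d u" and V: "v \<in> V" "w \<in> V" and vw: "r v = l w" "max (d v) (d w) < min (u v) (u w)"
    and k: "common V l r d u v w k"
  shows "l k \<le> r v \<and> r v \<le> r k \<and> (d k = min (u v) (u w) \<or> u k = max (d v) (d w))"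
proof -
  have kV: "k \<in> V" and m: "meets l r d u v k" "meets l r d u w k" using k unfolding common_def by auto
  have ne: "v \<noteq> k" "w \<noteq> k" using m unfolding meets_def by auto
  note p = boxes_proper[OF B V(1)] boxes_proper[OF B V(2)] boxes_proper[OF B kV]
  note q = boxes_disjoint[OF B V(1) kV ne(1)] boxes_disjoint[OF B V(2) kV ne(2)]
  show ?thesis using p q m vw unfolding meets_def by (smt (verit))
qed

lemma vertical_wall_top_unique:
  assumes B: "boxes V l r d u" and V: "v \<in> V" "w \<in> V" and vw: "r v = l w" "max (d v) (d w) < min (u v) (u w)"
    and k: "common V l r d u v w k" "d k = min (u v) (u w)" and k': "common V l r d u v w k'" "d k' = min (u v) (u w)"
  shows "k = k'"
proof (rule ccontr)
  assume ne: "k \<noteq> k'"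
  have kV: "k \<in> V" "k' \<in> V" and m: "meets l r d u v k" "meets l r d u w k" "meets l r d u v k'" "meets l r d u w k'"
    using k k' unfolding common_def by auto
  note p = boxes_proper[OF B V(1)] boxes_proper[OF B V(2)] boxes_proper[OF B kV(1)] boxes_proper[OF B kV(2)]
  note q = boxes_disjoint[OF B kV ne] vertical_wall_common[OF B V vw k(1)] vertical_wall_common[OF B V vw k'(1)]
  show False using p q m vw k(2) k'(2) unfolding meets_def by (smt (verit))
qed

lemma vertical_wall_top_full:
  assumes B: "boxes V l r d u" and V: "v \<in> V" "w \<in> V" and vw: "r v = l w" "max (d v) (d w) < min (u v) (u w)"
    and k: "common V l r d u v w k" "d k = min (u v) (u w)"
  shows "full V l r d u (r v) (min (u v) (u w))"
proof -
  have kV: "k \<in> V" and m: "meets l r d u v k" "meets l r d u w k" using k unfolding common_def by auto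
  note p = boxes_proper[OF B V(1)] boxes_proper[OF B V(2)] boxes_proper[OF B kV]
  note q = vertical_wall_common[OF B V vw k(1)]
  have "south_west V l r d u (r v) (min (u v) (u w))"
    unfolding south_west_def by (rule bexI[OF _ V(1)]) (use p vw in auto)
  moreover have "south_east V l r d u (r v) (min (u v) (u w))"
    unfolding south_east_def by (rule bexI[OF _ V(2)]) (use p vw in auto)
  moreover have "north_west V l r d u (r v) (min (u v) (u w))"
  proof (cases "l k < r v")
    case True
    then show ?thesis unfolding north_west_def by (intro bexI[OF _ kV]) (use p q k(2) in auto)
  next
    case False
    \<comment> \<open>Here \<open>k\<close> touches the end of the wall from the right only, so it
      can meet \<open>v\<close> only because \<open>v\<close> is taller than the wall.\<close>
    then have "u v > min (u v) (u w)" using p q m(1) k(2) vw unfolding meets_def by (smt (verit))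
    then show ?thesis unfolding north_west_def by (intro bexI[OF _ V(1)]) (use p vw in auto)
  qed
  moreover have "north_east V l r d u (r v) (min (u v) (u w))"
  proof (cases "r v < r k")
    case True
    then show ?thesis unfolding north_east_def by (intro bexI[OF _ kV]) (use p q k(2) in auto)
  next
    case False
    then have "u w > min (u v) (u w)" using p q m(2) k(2) vw unfolding meets_def by (smt (verit))
    then show ?thesis unfolding north_east_def by (intro bexI[OF _ V(2)]) (use p vw in auto)
  qed
  ultimately show ?thesis unfolding full_def by blast
qed

text \<open>Consider the modules in the two quadrants above the end of the wall. If one of
  \<open>v\<close> and \<open>w\<close> is taller, the module above the other one is a common
  neighbour. If both stop there, either one module covers both quadrants or four modules
  meet.\<close>

lemma vertical_wall_top_exists:
  assumes B: "boxes V l r d u" and V: "v \<in> V" "w \<in> V" and vw: "r v = l w" "max (d v) (d w) < min (u v) (u w)"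
    and f: "full V l r d u (r v) (min (u v) (u w))"
  shows "(\<exists>k. common V l r d u v w k \<and> d k = min (u v) (u w)) \<or>
    (\<exists>k1 k2. cross V l r d u (r v) (min (u v) (u w)) k1 k2 w v)"
proof -
  let ?y = "min (u v) (u w)"
  obtain k1 where k1: "k1 \<in> V" "l k1 < r v" "r v \<le> r k1" "d k1 \<le> ?y" "?y < u k1"
    using f unfolding full_def north_west_def by blast
  obtain k2 where k2: "k2 \<in> V" "l k2 \<le> r v" "r v < r k2" "d k2 \<le> ?y" "?y < u k2"
    using f unfolding full_def north_east_def by blast
  note p = boxes_proper[OF B V(1)] boxes_proper[OF B V(2)] boxes_proper[OF B k1(1)] boxes_proper[OF B k2(1)]
  consider "u v > ?y" | "u w > ?y" "u v = ?y" | "u v = ?y" "u w = ?y" by linarith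
  then show ?thesis
  proof cases
    case 1
    then have ne: "k2 \<noteq> w" "k2 \<noteq> v" using k2 p vw by auto
    note q = boxes_disjoint[OF B k2(1) V(1) ne(2)] boxes_disjoint[OF B k2(1) V(2) ne(1)]
    have "d k2 = ?y" "l k2 = r v" using q 1 k2 p vw by linarith+
    then have "common V l r d u v w k2"
      unfolding common_def meets_def using 1 k2 p vw ne by (auto simp: max_def min_def split: if_splits)
    then show ?thesis using \<open>d k2 = ?y\<close> by blast
  next
    case 2
    then have ne: "k1 \<noteq> w" "k1 \<noteq> v" using k1 p vw by auto
    note q = boxes_disjoint[OF B k1(1) V(1) ne(2)] boxes_disjoint[OF B k1(1) V(2) ne(1)]
    have "d k1 = ?y" "r k1 = r v" using q 2 k1 p vw by linarith+
    then have "common V l r d u v w k1"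
      unfolding common_def meets_def using 2 k1 p vw ne by (auto simp: max_def min_def split: if_splits)
    then show ?thesis using \<open>d k1 = ?y\<close> by blast
  next
    case 3
    then have ne: "k1 \<noteq> w" "k1 \<noteq> v" "k2 \<noteq> w" "k2 \<noteq> v" using k1 k2 p vw by auto
    note q = boxes_disjoint[OF B k1(1) V(1) ne(2)] boxes_disjoint[OF B k2(1) V(2) ne(3)]
    have dk: "d k1 = ?y" "d k2 = ?y" using q 3 k1 k2 p vw by linarith+
    show ?thesis
    proof (cases "k1 = k2")
      case True
      then have "common V l r d u v w k1"
        unfolding common_def meets_def using 3 k1 k2 p vw ne dk by (auto simp: max_def min_def split: if_splits)
      then show ?thesis using dk by blast
    next
      case False
      have "r k1 = r v" "l k2 = r v" using boxes_disjoint[OF B k1(1) k2(1) False] k1 k2 p dk by linarith+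
      then have "cross V l r d u (r v) ?y k1 k2 w v"
        unfolding cross_def using V k1 k2 dk 3 vw by auto
      then show ?thesis by blast
    qed
  qed
qed

text \<open>Points between the ends of the wall are interior to the region, so
  \<open>open_wall\<close> is witnessed by an end. A common neighbour at that end would make it
  interior, and the other end admits only one.\<close>

lemma vertical_wall_open_common_unique:
  assumes B: "boxes V l r d u" and V: "v \<in> V" "w \<in> V" and vw: "r v = l w" "max (d v) (d w) < min (u v) (u w)"
    and o: "open_wall V l r d u v w"
    and k: "common V l r d u v w k" "common V l r d u v w k'"
  shows "k = k'"
proof -
  let ?d = "\<lambda>v. - u v" and ?u = "\<lambda>v. - d v"
  have B': "boxes V l r ?d ?u" using B boxes_flip by blast
  have vw': "max (?d v) (?d w) < min (?u v) (?u w)" 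
    using vw(2) unfolding minus_min_eq_max[symmetric] minus_max_eq_min[symmetric] by simp
  have mm: "min (?u v) (?u w) = - max (d v) (d w)" by (rule minus_max_eq_min[symmetric])
  note p = boxes_proper[OF B V(1)] boxes_proper[OF B V(2)]
  obtain x y where xy: "in_box l r d u v x y" "in_box l r d u w x y" "\<not> full V l r d u x y"
    using o unfolding open_wall_def by blast
  have x: "x = r v" "max (d v) (d w) \<le> y" "y \<le> min (u v) (u w)" using xy vw unfolding in_box_def by auto
  have "y = max (d v) (d w) \<or> y = min (u v) (u w)"
  proof (rule ccontr)
    assume "\<not> ?thesis"
    then have y: "max (d v) (d w) < y" "y < min (u v) (u w)" using x by auto
    have "north_east V l r d u x y" "south_east V l r d u x y"
      unfolding north_east_def south_east_def by (rule bexI[OF _ V(2)], use y x p vw in auto)+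
    moreover have "north_west V l r d u x y" "south_west V l r d u x y"
      unfolding north_west_def south_west_def by (rule bexI[OF _ V(1)], use y x p vw in auto)+
    ultimately show False using xy(3) unfolding full_def by blast
  qed
  then consider "\<not> full V l r d u (r v) (min (u v) (u w))" | "\<not> full V l r d u (r v) (max (d v) (d w))"
    using xy(3) x(1) by blast
  then show ?thesis
  proof cases
    case 1
    then have "d k \<noteq> min (u v) (u w)" "d k' \<noteq> min (u v) (u w)"
      using vertical_wall_top_full[OF B V vw] k by blast+
    then have "u k = max (d v) (d w)" "u k' = max (d v) (d w)"
      using vertical_wall_common[OF B V vw] k by blast+
    then show ?thesis
      using vertical_wall_top_unique[OF B' V vw(1) vw', of k k'] k common_flip mm by metis
  next
    case 2
    then have "\<not> full V l r ?d ?u (r v) (min (?u v) (?u w))"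
      using full_flip[of V l r d u "r v"] mm by simp
    then have "?d k \<noteq> min (?u v) (?u w)" "?d k' \<noteq> min (?u v) (?u w)"
      using vertical_wall_top_full[OF B' V vw(1) vw'] k common_flip by metis+
    then have "d k = min (u v) (u w)" "d k' = min (u v) (u w)"
      using vertical_wall_common[OF B V vw] k mm by (metis neg_equal_iff_equal)+
    then show ?thesis using vertical_wall_top_unique[OF B V vw] k by blast
  qed
qed

lemma open_wall_common_unique:
  assumes B: "boxes V l r d u" and V: "v \<in> V" "w \<in> V" and m: "meets l r d u v w"
    and o: "open_wall V l r d u v w"
    and k: "common V l r d u v w k" "common V l r d u v w k'"
  shows "k = k'"
proof -
  note B' = boxes_transpose[THEN iffD1, OF B]
  consider "r v = l w" "max (d v) (d w) < min (u v) (u w)" | "r w = l v" "max (d w) (d v) < min (u w) (u v)"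
    | "u v = d w" "max (l v) (l w) < min (r v) (r w)" | "u w = d v" "max (l w) (l v) < min (r w) (r v)"
    using m unfolding meets_def max.commute[of "_ w"] min.commute[of "_ w"] by metis
  then show ?thesis
  proof cases
    case 1 show ?thesis by (rule vertical_wall_open_common_unique[OF B V 1 o k])
  next
    case 2
    show ?thesis
      by (rule vertical_wall_open_common_unique[OF B V(2,1) 2 open_wall_sym[THEN iffD1, OF o]
            common_sym[THEN iffD1, OF k(1)] common_sym[THEN iffD1, OF k(2)]])
  next
    case 3
    show ?thesis
      by (rule vertical_wall_open_common_unique[OF B' V 3 open_wall_transpose[THEN iffD1, OF o]
            common_transpose[THEN iffD1, OF k(1)] common_transpose[THEN iffD1, OF k(2)]])
  next
    case 4
    show ?thesis
      by (rule vertical_wall_open_common_unique[OF B' V(2,1) 4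
            open_wall_transpose[THEN iffD1, OF open_wall_sym[THEN iffD1, OF o]]
            common_transpose[THEN iffD1, OF common_sym[THEN iffD1, OF k(1)]]
            common_transpose[THEN iffD1, OF common_sym[THEN iffD1, OF k(2)]]])
  qed
qed

section \<open>Points where four modules meet\<close>

lemma cross_rotate:
  "cross V l r d u x y m1 m2 m3 m4 \<longleftrightarrow> cross V (\<lambda>v. - u v) (\<lambda>v. - d v) l r (- y) x m2 m3 m4 m1"
  unfolding cross_def by auto

lemma cross_flip:
  "cross V l r d u x y m1 m2 m3 m4 \<longleftrightarrow> cross V l r (\<lambda>v. - u v) (\<lambda>v. - d v) x (- y) m4 m3 m2 m1"
  unfolding cross_def by auto

lemma cross_transpose:
  "cross V l r d u x y m1 m2 m3 m4 \<longleftrightarrow> cross V d u l r y x m3 m2 m1 m4"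
  unfolding cross_def by auto

text \<open>Both ends of the wall are interior to the region, so each carries a common neighbour
  unless four modules meet there. The lower end is the upper one of the reflected boxes.\<close>

lemma vertical_wall_closed:
  assumes B: "boxes V l r d u" and V: "v \<in> V" "w \<in> V" and vw: "r v = l w" "max (d v) (d w) < min (u v) (u w)"
    and o: "\<not> open_wall V l r d u v w"
  shows "(\<exists>k k'. k \<noteq> k' \<and> common V l r d u v w k \<and> common V l r d u v w k') \<or>
    (\<exists>x y m1 m2 m3 m4. cross V l r d u x y m1 m2 m3 m4)"
proof (rule disjCI)
  assume nc: "\<nexists>x y m1 m2 m3 m4. cross V l r d u x y m1 m2 m3 m4"
  let ?d = "\<lambda>v. - u v" and ?u = "\<lambda>v. - d v"
  have B': "boxes V l r ?d ?u" using B boxes_flip by blast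
  have vw': "max (?d v) (?d w) < min (?u v) (?u w)" 
    using vw(2) unfolding minus_min_eq_max[symmetric] minus_max_eq_min[symmetric] by simp
  have mm: "min (?u v) (?u w) = - max (d v) (d w)" by (rule minus_max_eq_min[symmetric])
  note p = boxes_proper[OF B V(1)] boxes_proper[OF B V(2)]
  have f: "full V l r d u (r v) (min (u v) (u w))" "full V l r d u (r v) (max (d v) (d w))"
    using o vw p unfolding open_wall_def in_box_def by auto
  have f': "full V l r ?d ?u (r v) (min (?u v) (?u w))"
    using f(2) full_flip[of V l r d u "r v"] mm by simp
  obtain k where k: "common V l r d u v w k" "d k = min (u v) (u w)"
    using vertical_wall_top_exists[OF B V vw f(1)] nc by blast
  have "\<not> cross V l r ?d ?u x y k1 k2 w v" for x y k1 k2
    using nc cross_flip[of V l r d u x "- y"] by auto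
  then obtain k' where k': "common V l r ?d ?u v w k'" "?d k' = min (?u v) (?u w)"
    using vertical_wall_top_exists[OF B' V vw(1) vw' f'] by blast
  have "k' \<in> V" using k' unfolding common_def by blast
  then have "k \<noteq> k'" using k(2) k'(2) mm vw(2) boxes_proper[OF B, of k'] by auto
  moreover have "common V l r d u v w k'" by (rule common_flip[THEN iffD2, OF k'(1)])
  ultimately show "\<exists>k k'. k \<noteq> k' \<and> common V l r d u v w k \<and> common V l r d u v w k'"
    using k(1) by blast
qed

lemma closed_wall:
  assumes B: "boxes V l r d u" and V: "v \<in> V" "w \<in> V" and m: "meets l r d u v w"
    and o: "\<not> open_wall V l r d u v w" and nc: "\<nexists>x y m1 m2 m3 m4. cross V l r d u x y m1 m2 m3 m4"
  obtains k k' where "k \<noteq> k'" "common V l r d u v w k" "common V l r d u v w k'"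
proof -
  have nc': "\<nexists>x y m1 m2 m3 m4. cross V d u l r x y m1 m2 m3 m4"
    using nc cross_transpose[of V d u l r] by blast
  have o': "\<not> open_wall V l r d u w v" "\<not> open_wall V d u l r v w" "\<not> open_wall V d u l r w v"
    using o open_wall_sym[of V l r d u] open_wall_sym[of V d u l r] open_wall_transpose[of V l r d u] by blast+
  note B' = boxes_transpose[THEN iffD1, OF B]
  consider "r v = l w" "max (d v) (d w) < min (u v) (u w)" | "r w = l v" "max (d w) (d v) < min (u w) (u v)"
    | "u v = d w" "max (l v) (l w) < min (r v) (r w)" | "u w = d v" "max (l w) (l v) < min (r w) (r v)"
    using m unfolding meets_def max.commute[of "_ w"] min.commute[of "_ w"] by metis
  then have "\<exists>k k'. k \<noteq> k' \<and> common V l r d u v w k \<and> common V l r d u v w k'"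
  proof cases
    case 1 then show ?thesis using vertical_wall_closed[OF B V 1 o] nc by blast
  next
    case 2 then show ?thesis
      using vertical_wall_closed[OF B V(2,1) 2 o'(1)] nc common_sym[of V l r d u v w] by blast
  next
    case 3 then show ?thesis
      using vertical_wall_closed[OF B' V 3 o'(2)] nc' common_transpose[of V l r d u v w] by blast
  next
    case 4
    then show ?thesis
      using vertical_wall_closed[OF B' V(2,1) 4 o'(3)] nc' common_transpose[of V l r d u v w]
        common_sym[of V d u l r v w] by blast
  qed
  then show ?thesis using that by blast
qed

text \<open>At the crossing the wall between \<open>m1\<close> and \<open>m2\<close> has no common
  neighbour, since \<open>m3\<close> and \<open>m4\<close> occupy both quadrants below. All common
  neighbours thus sit at the other end. If there is one, that end is interior too, and with it every
  point of the wall.\<close>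

lemma cross_wall:
  assumes B: "boxes V l r d u" and c: "cross V l r d u x y m1 m2 m3 m4"
  shows "meets l r d u m1 m2" "\<not> meets l r d u m1 m3" "m1 \<noteq> m2" "m1 \<noteq> m3"
    and "\<lbrakk>common V l r d u m1 m2 k; common V l r d u m1 m2 k'\<rbrakk> \<Longrightarrow> k = k'"
    and "\<lbrakk>common V l r d u m1 m2 k; open_wall V l r d u m1 m2\<rbrakk> \<Longrightarrow> False"
proof -
  have V: "m1 \<in> V" "m2 \<in> V" "m3 \<in> V" "m4 \<in> V"
    and e: "r m1 = x" "d m1 = y" "l m2 = x" "d m2 = y" "l m3 = x" "u m3 = y" "r m4 = x" "u m4 = y"
    using c unfolding cross_def by auto
  note p = boxes_proper[OF B V(1)] boxes_proper[OF B V(2)] boxes_proper[OF B V(3)] boxes_proper[OF B V(4)]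
  show ne: "m1 \<noteq> m2" "m1 \<noteq> m3" using p e by auto
  show m12: "meets l r d u m1 m2" unfolding meets_def using p e ne by auto
  show "\<not> meets l r d u m1 m3" unfolding meets_def using p e by auto
  have vw: "r m1 = l m2" "max (d m1) (d m2) < min (u m1) (u m2)" using p e by auto
  have top: "d k = min (u m1) (u m2)" if k: "common V l r d u m1 m2 k" for k
  proof (rule ccontr)
    assume "d k \<noteq> min (u m1) (u m2)"
    then have uk: "u k = y" "l k \<le> x" "x \<le> r k"
      using vertical_wall_common[OF B V(1,2) vw k] e by auto
    have kV: "k \<in> V" and m: "meets l r d u m1 k" "meets l r d u m2 k" using k unfolding common_def by auto
    note pk = boxes_proper[OF B kV]
    have "l k < x" using m(1) p pk e uk unfolding meets_def by (smt (verit))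
    moreover have "x < r k" using m(2) p pk e uk unfolding meets_def by (smt (verit))
    ultimately have k34: "\<not> (r k \<le> l m3 \<or> r m3 \<le> l k \<or> u k \<le> d m3 \<or> u m3 \<le> d k)"
      "\<not> (r k \<le> l m4 \<or> r m4 \<le> l k \<or> u k \<le> d m4 \<or> u m4 \<le> d k)"
      using p pk e uk by linarith+
    have "k = m3" "k = m4"
      using boxes_disjoint[OF B kV V(3)] boxes_disjoint[OF B kV V(4)] k34 by metis+
    then show False using p e by simp
  qed
  show "k = k'" if "common V l r d u m1 m2 k" "common V l r d u m1 m2 k'" for k k'
    using vertical_wall_top_unique[OF B V(1,2) vw that(1) top[OF that(1)] that(2) top[OF that(2)]] .
  show False if k: "common V l r d u m1 m2 k" and o: "open_wall V l r d u m1 m2" for k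
  proof -
    have ft: "full V l r d u x (min (u m1) (u m2))"
      using vertical_wall_top_full[OF B V(1,2) vw k top[OF k]] e by simp
    have "north_east V l r d u x y" unfolding north_east_def by (rule bexI[OF _ V(2)]) (use p e in simp)
    moreover have "north_west V l r d u x y" unfolding north_west_def by (rule bexI[OF _ V(1)]) (use p e in simp)
    moreover have "south_west V l r d u x y" unfolding south_west_def by (rule bexI[OF _ V(4)]) (use p e in simp)
    moreover have "south_east V l r d u x y" unfolding south_east_def by (rule bexI[OF _ V(3)]) (use p e in simp)
    ultimately have fb: "full V l r d u x y" unfolding full_def by blast
    obtain x' y' where xy: "in_box l r d u m1 x' y'" "in_box l r d u m2 x' y'" "\<not> full V l r d u x' y'"
      using o unfolding open_wall_def by blast
    have x': "x' = x" "y \<le> y'" "y' \<le> min (u m1) (u m2)" using xy e unfolding in_box_def by auto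
    then have y': "y < y'" "y' < min (u m1) (u m2)" using ft fb xy(3) by (metis order_le_less)+
    have y'': "y' < u m1" "y' < u m2" using y' by simp_all
    have "north_east V l r d u x' y'" unfolding north_east_def by (rule bexI[OF _ V(2)]) (use y' y'' x' p e in simp)
    moreover have "north_west V l r d u x' y'" unfolding north_west_def by (rule bexI[OF _ V(1)]) (use y' y'' x' p e in simp)
    moreover have "south_west V l r d u x' y'" unfolding south_west_def by (rule bexI[OF _ V(1)]) (use y' y'' x' p e in simp)
    moreover have "south_east V l r d u x' y'" unfolding south_east_def by (rule bexI[OF _ V(2)]) (use y' y'' x' p e in simp)
    ultimately show False using xy(3) unfolding full_def by blast
  qed
qed

lemma boxes_rotate: "boxes V l r d u \<longleftrightarrow> boxes V (\<lambda>v. - u v) (\<lambda>v. - d v) l r"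
  using boxes_flip boxes_transpose by metis

lemma meets_rotate: "meets l r d u v w \<longleftrightarrow> meets (\<lambda>v. - u v) (\<lambda>v. - d v) l r v w"
  using meets_flip meets_transpose by metis

lemma common_rotate: "common V l r d u v w k \<longleftrightarrow> common V (\<lambda>v. - u v) (\<lambda>v. - d v) l r v w k"
  using common_flip common_transpose by metis

lemma open_wall_rotate: "open_wall V l r d u v w \<longleftrightarrow> open_wall V (\<lambda>v. - u v) (\<lambda>v. - d v) l r v w"
  using open_wall_flip open_wall_transpose by metis

section \<open>L-shaped regions\<close>

lemma not_north_east_gap:
  assumes "finite V" "\<not> north_east V l r d u x y"
  obtains \<epsilon> where "\<epsilon> > 0"
    "\<And>a b. 0 < a \<Longrightarrow> a < \<epsilon> \<Longrightarrow> 0 < b \<Longrightarrow> b < \<epsilon> \<Longrightarrow> \<not> (\<exists>v\<in>V. in_box l r d u v (x + a) (y + b))"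
proof -
  have "\<exists>\<epsilon>>0. \<forall>a b. 0 < a \<and> a < \<epsilon> \<and> 0 < b \<and> b < \<epsilon> \<longrightarrow> \<not> (\<exists>v\<in>V. in_box l r d u v (x + a) (y + b))"
    using assms
  proof (induction V rule: finite_induct)
    case empty then show ?case by (intro exI[of _ 1]) auto
  next
    case (insert w V)
    then obtain \<epsilon> where \<epsilon>: "\<epsilon> > 0" "\<forall>a b. 0 < a \<and> a < \<epsilon> \<and> 0 < b \<and> b < \<epsilon> \<longrightarrow> \<not> (\<exists>v\<in>V. in_box l r d u v (x + a) (y + b))"
      unfolding north_east_def by auto
    have n: "\<not> (l w \<le> x \<and> x < r w \<and> d w \<le> y \<and> y < u w)" using insert.prems unfolding north_east_def by blast
    \<comment> \<open>A box misses the quadrant because it begins too far east or north, or because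
      it ends at or before the apex. In the last case every positive distance will do, for instance
      1.\<close>
    define \<delta> where "\<delta> = (if x < l w then l w - x else if y < d w then d w - y else 1)"
    have "\<delta> > 0" unfolding \<delta>_def by auto
    moreover have "\<not> in_box l r d u w (x + a) (y + b)" if "0 < a" "a < \<delta>" "0 < b" "b < \<delta>" for a b
      using n that unfolding \<delta>_def in_box_def by (auto split: if_splits)
    ultimately show ?case using \<epsilon> by (intro exI[of _ "min \<epsilon> \<delta>"]) auto
  qed
  then show ?thesis using that by metis
qed

lemma north_west_flip:
  "north_west V l r d u x y \<longleftrightarrow> north_east V (\<lambda>v. - r v) (\<lambda>v. - l v) d u (- x) y"
  unfolding north_west_def north_east_def by auto

lemma south_west_flip:
  "south_west V l r d u x y \<longleftrightarrow> north_east V (\<lambda>v. - r v) (\<lambda>v. - l v) (\<lambda>v. - u v) (\<lambda>v. - d v) (- x) (- y)"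
  unfolding south_west_def north_east_def by auto

lemma south_east_flip:
  "south_east V l r d u x y \<longleftrightarrow> north_east V l r (\<lambda>v. - u v) (\<lambda>v. - d v) x (- y)"
  unfolding south_east_def north_east_def by auto

lemma not_north_west_gap:
  assumes "finite V" "\<not> north_west V l r d u x y"
  obtains \<epsilon> where "\<epsilon> > 0"
    "\<And>a b. 0 < a \<Longrightarrow> a < \<epsilon> \<Longrightarrow> 0 < b \<Longrightarrow> b < \<epsilon> \<Longrightarrow> \<not> (\<exists>v\<in>V. in_box l r d u v (x - a) (y + b))"
proof -
  have "in_box (\<lambda>v. - r v) (\<lambda>v. - l v) d u v (- x + a) (y + b) = in_box l r d u v (x - a) (y + b)" for v a b
    unfolding in_box_def by auto
  then show ?thesis
    using not_north_east_gap[OF assms(1) assms(2)[unfolded north_west_flip], of thesis] that by simp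
qed

lemma not_south_west_gap:
  assumes "finite V" "\<not> south_west V l r d u x y"
  obtains \<epsilon> where "\<epsilon> > 0"
    "\<And>a b. 0 < a \<Longrightarrow> a < \<epsilon> \<Longrightarrow> 0 < b \<Longrightarrow> b < \<epsilon> \<Longrightarrow> \<not> (\<exists>v\<in>V. in_box l r d u v (x - a) (y - b))"
proof -
  have "in_box (\<lambda>v. - r v) (\<lambda>v. - l v) (\<lambda>v. - u v) (\<lambda>v. - d v) v (- x + a) (- y + b) =
      in_box l r d u v (x - a) (y - b)" for v a b
    unfolding in_box_def by auto
  then show ?thesis
    using not_north_east_gap[OF assms(1) assms(2)[unfolded south_west_flip], of thesis] that by simp
qed

lemma not_south_east_gap:
  assumes "finite V" "\<not> south_east V l r d u x y"
  obtains \<epsilon> where "\<epsilon> > 0"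
    "\<And>a b. 0 < a \<Longrightarrow> a < \<epsilon> \<Longrightarrow> 0 < b \<Longrightarrow> b < \<epsilon> \<Longrightarrow> \<not> (\<exists>v\<in>V. in_box l r d u v (x + a) (y - b))"
proof -
  have "in_box l r (\<lambda>v. - u v) (\<lambda>v. - d v) v (x + a) (- y + b) = in_box l r d u v (x + a) (y - b)" for v a b
    unfolding in_box_def by auto
  then show ?thesis
    using not_north_east_gap[OF assms(1) assms(2)[unfolded south_east_flip], of thesis] that by simp
qed

text \<open>The region is normalised so that the north-east quadrant at the concave corner \<open>(px, py)\<close> is missing.\<close>

locale L_plan =
  fixes V :: "'v set" and l r d u :: "'v \<Rightarrow> real" and X0 px X1 Y0 py Y1 :: real
  assumes boxes: "boxes V l r d u"
    and order: "X0 < px" "px < X1" "Y0 < py" "py < Y1"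
    and cover: "\<And>x y. (\<exists>v\<in>V. in_box l r d u v x y) \<longleftrightarrow>
      X0 \<le> x \<and> x \<le> X1 \<and> Y0 \<le> y \<and> y \<le> Y1 \<and> (x \<le> px \<or> y \<le> py)"
begin

lemma L_plan_transpose: "L_plan V d u l r Y0 py Y1 X0 px X1"
proof
  show "boxes V d u l r" using boxes boxes_transpose by blast
  show "(\<exists>v\<in>V. in_box d u l r v x y) \<longleftrightarrow> Y0 \<le> x \<and> x \<le> Y1 \<and> X0 \<le> y \<and> y \<le> X1 \<and> (x \<le> py \<or> y \<le> px)" for x y
    using cover[of y x] unfolding in_box_def by blast
qed (use order in auto)

lemma proper: "v \<in> V \<Longrightarrow> l v < r v \<and> d v < u v"
  using boxes_proper[OF boxes] by blast

lemma disjoint: "\<lbrakk>v \<in> V; w \<in> V; v \<noteq> w\<rbrakk> \<Longrightarrow> r v \<le> l w \<or> r w \<le> l v \<or> u v \<le> d w \<or> u w \<le> d v"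
  using boxes_disjoint[OF boxes] by blast

lemma fin: "finite V"
  using boxes unfolding boxes_def by blast

lemma bounds:
  assumes "v \<in> V"
  shows "X0 \<le> l v" "r v \<le> X1" "Y0 \<le> d v" "u v \<le> Y1" "r v \<le> px \<or> u v \<le> py"
proof -
  have "\<exists>w\<in>V. in_box l r d u w (l v) (d v)" "\<exists>w\<in>V. in_box l r d u w (r v) (u v)"
    by (rule bexI[OF _ assms], use proper[OF assms] in \<open>auto simp: in_box_def\<close>)+
  then show "X0 \<le> l v" "r v \<le> X1" "Y0 \<le> d v" "u v \<le> Y1" "r v \<le> px \<or> u v \<le> py"
    unfolding cover by auto
qed

lemma north_east_iff:
  "north_east V l r d u x y \<longleftrightarrow> X0 \<le> x \<and> x < X1 \<and> Y0 \<le> y \<and> y < Y1 \<and> (x < px \<or> y < py)"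
proof
  assume "north_east V l r d u x y"
  then obtain v where v: "v \<in> V" "l v \<le> x" "x < r v" "d v \<le> y" "y < u v" unfolding north_east_def by blast
  then show "X0 \<le> x \<and> x < X1 \<and> Y0 \<le> y \<and> y < Y1 \<and> (x < px \<or> y < py)" using bounds[OF v(1)] by auto
next
  assume c: "X0 \<le> x \<and> x < X1 \<and> Y0 \<le> y \<and> y < Y1 \<and> (x < px \<or> y < py)"
  show "north_east V l r d u x y"
  proof (rule ccontr)
    assume "\<not> ?thesis"
    then obtain \<epsilon> where \<epsilon>: "\<epsilon> > 0" and gap: "\<And>a b. 0 < a \<Longrightarrow> a < \<epsilon> \<Longrightarrow> 0 < b \<Longrightarrow> b < \<epsilon> \<Longrightarrow> \<not> (\<exists>v\<in>V. in_box l r d u v (x + a) (y + b))"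
      by (rule not_north_east_gap[OF fin]) (rule that)
    \<comment> \<open>Small enough for the gap, for the outer bounds of the region, and for not
      passing the coordinates of the concave corner.\<close>
    define a where "a = min (\<epsilon> / 2) (min (X1 - x) (if x < px then px - x else 1))"
    define b where "b = min (\<epsilon> / 2) (min (Y1 - y) (if y < py then py - y else 1))"
    have "0 < a" "a < \<epsilon>" "0 < b" "b < \<epsilon>" using \<epsilon> c unfolding a_def b_def by auto
    then have "\<not> (\<exists>v\<in>V. in_box l r d u v (x + a) (y + b))" by (rule gap)
    moreover have "a \<le> X1 - x" "b \<le> Y1 - y" "x < px \<longrightarrow> a \<le> px - x" "y < py \<longrightarrow> b \<le> py - y"
      unfolding a_def b_def by auto
    ultimately show False unfolding cover using c \<open>0 < a\<close> \<open>0 < b\<close> by auto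
  qed
qed

lemma north_west_iff:
  "north_west V l r d u x y \<longleftrightarrow> X0 < x \<and> x \<le> X1 \<and> Y0 \<le> y \<and> y < Y1 \<and> (x \<le> px \<or> y < py)"
proof
  assume "north_west V l r d u x y"
  then obtain v where v: "v \<in> V" "l v < x" "x \<le> r v" "d v \<le> y" "y < u v" unfolding north_west_def by blast
  then show "X0 < x \<and> x \<le> X1 \<and> Y0 \<le> y \<and> y < Y1 \<and> (x \<le> px \<or> y < py)" using bounds[OF v(1)] by auto
next
  assume c: "X0 < x \<and> x \<le> X1 \<and> Y0 \<le> y \<and> y < Y1 \<and> (x \<le> px \<or> y < py)"
  show "north_west V l r d u x y"
  proof (rule ccontr)
    assume "\<not> ?thesis"
    then obtain \<epsilon> where \<epsilon>: "\<epsilon> > 0" and gap: "\<And>a b. 0 < a \<Longrightarrow> a < \<epsilon> \<Longrightarrow> 0 < b \<Longrightarrow> b < \<epsilon> \<Longrightarrow> \<not> (\<exists>v\<in>V. in_box l r d u v (x - a) (y + b))"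
      by (rule not_north_west_gap[OF fin]) (rule that)
    define a where "a = min (\<epsilon> / 2) (x - X0)"
    define b where "b = min (\<epsilon> / 2) (min (Y1 - y) (if y < py then py - y else 1))"
    have "0 < a" "a < \<epsilon>" "0 < b" "b < \<epsilon>" using \<epsilon> c unfolding a_def b_def by auto
    then have "\<not> (\<exists>v\<in>V. in_box l r d u v (x - a) (y + b))" by (rule gap)
    moreover have "a \<le> x - X0" "b \<le> Y1 - y" "y < py \<longrightarrow> b \<le> py - y"
      unfolding a_def b_def by auto
    ultimately show False unfolding cover using c \<open>0 < a\<close> \<open>0 < b\<close> by auto
  qed
qed

lemma south_west_iff:
  "south_west V l r d u x y \<longleftrightarrow> X0 < x \<and> x \<le> X1 \<and> Y0 < y \<and> y \<le> Y1 \<and> (x \<le> px \<or> y \<le> py)"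
proof
  assume "south_west V l r d u x y"
  then obtain v where v: "v \<in> V" "l v < x" "x \<le> r v" "d v < y" "y \<le> u v" unfolding south_west_def by blast
  then show "X0 < x \<and> x \<le> X1 \<and> Y0 < y \<and> y \<le> Y1 \<and> (x \<le> px \<or> y \<le> py)" using bounds[OF v(1)] by auto
next
  assume c: "X0 < x \<and> x \<le> X1 \<and> Y0 < y \<and> y \<le> Y1 \<and> (x \<le> px \<or> y \<le> py)"
  show "south_west V l r d u x y"
  proof (rule ccontr)
    assume "\<not> ?thesis"
    then obtain \<epsilon> where \<epsilon>: "\<epsilon> > 0" and gap: "\<And>a b. 0 < a \<Longrightarrow> a < \<epsilon> \<Longrightarrow> 0 < b \<Longrightarrow> b < \<epsilon> \<Longrightarrow> \<not> (\<exists>v\<in>V. in_box l r d u v (x - a) (y - b))"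
      by (rule not_south_west_gap[OF fin]) (rule that)
    define a where "a = min (\<epsilon> / 2) (x - X0)"
    define b where "b = min (\<epsilon> / 2) (y - Y0)"
    have "0 < a" "a < \<epsilon>" "0 < b" "b < \<epsilon>" using \<epsilon> c unfolding a_def b_def by auto
    then have "\<not> (\<exists>v\<in>V. in_box l r d u v (x - a) (y - b))" by (rule gap)
    moreover have "a \<le> x - X0" "b \<le> y - Y0" unfolding a_def b_def by auto
    ultimately show False unfolding cover using c \<open>0 < a\<close> \<open>0 < b\<close> by auto
  qed
qed

lemma south_east_iff:
  "south_east V l r d u x y \<longleftrightarrow> X0 \<le> x \<and> x < X1 \<and> Y0 < y \<and> y \<le> Y1 \<and> (x < px \<or> y \<le> py)"
proof -
  have "south_east V l r d u x y \<longleftrightarrow> north_west V d u l r y x"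
    unfolding south_east_def north_west_def by blast
  then show ?thesis using L_plan.north_west_iff[OF L_plan_transpose, of y x] by auto
qed

lemma full_iff:
  "full V l r d u x y \<longleftrightarrow> X0 < x \<and> x < X1 \<and> Y0 < y \<and> y < Y1 \<and> (x < px \<or> y < py)"
  unfolding full_def north_east_iff north_west_iff south_west_iff south_east_iff by auto

section \<open>Corners and sides of the L-shaped region\<close>

definition corner :: "'v \<Rightarrow> bool" where
  "corner v \<longleftrightarrow> (l v = X0 \<or> r v = X1) \<and> d v = Y0 \<or> l v = X0 \<and> u v = Y1 \<or>
     r v = X1 \<and> u v = py \<or> u v = Y1 \<and> r v = px"

text \<open>Two different modules at the same convex corner would overlap, so each of the five
  corners contributes at most one.\<close>

lemma card_corners: "finite {v \<in> V. corner v} \<and> card {v \<in> V. corner v} \<le> 5"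
proof -
  let ?C1 = "{v \<in> V. l v = X0 \<and> d v = Y0}" let ?C2 = "{v \<in> V. r v = X1 \<and> d v = Y0}"
  let ?C3 = "{v \<in> V. l v = X0 \<and> u v = Y1}" let ?C4 = "{v \<in> V. r v = X1 \<and> u v = py}"
  let ?C5 = "{v \<in> V. u v = Y1 \<and> r v = px}"
  have eq: "{v \<in> V. corner v} = ?C1 \<union> ?C2 \<union> ?C3 \<union> ?C4 \<union> ?C5" unfolding corner_def by blast
  have one: "card {v \<in> V. P v} \<le> 1" if "\<And>v w. v \<in> V \<Longrightarrow> w \<in> V \<Longrightarrow> P v \<Longrightarrow> P w \<Longrightarrow> v = w" for P
    using that card_le_Suc0_iff_eq[of "{v \<in> V. P v}"] fin by simp
  have c: "card ?C1 \<le> 1" "card ?C2 \<le> 1" "card ?C3 \<le> 1" "card ?C4 \<le> 1" "card ?C5 \<le> 1"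
    by (rule one, use disjoint proper in fastforce)+
  have "card {v \<in> V. corner v} \<le> card ?C1 + card ?C2 + card ?C3 + card ?C4 + card ?C5"
    unfolding eq by (meson add_mono_thms_linordered_semiring(3) card_Un_le le_trans)
  then show ?thesis using c fin by simp
qed

text \<open>Such a \<open>K\<close> would be a cut vertex: every other module lies entirely above or
  entirely below it, and adjacency does not lead from one part to the other. Both parts are
  inhabited, because \<open>K\<close> touches the left side and, having no convex corner, stays away
  from top and bottom.\<close>

lemma no_horizontal_span:
  assumes K: "K \<in> V" "l K = X0" "r K \<ge> px" "r K = X1 \<or> u K \<ge> py" "\<not> corner K"
    and con: "\<And>x y. x \<in> V - {K} \<Longrightarrow> y \<in> V - {K} \<Longrightarrow>
      (x, y) \<in> {(x, y). x \<in> V - {K} \<and> y \<in> V - {K} \<and> meets l r d u x y}\<^sup>*"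
  shows False
proof -
  have dK: "Y0 < d K" "u K < Y1" using bounds[OF K(1)] K unfolding corner_def by auto
  \<comment> \<open>Above \<open>K\<close> the region is not wider than \<open>K\<close>: either
    \<open>K\<close> reaches the right side, or it reaches the height of the concave corner, above
    which the region ends at \<open>px\<close>.\<close>
  have rK: "x \<le> r K" if "v \<in> V" "u v > u K" "x \<le> r v" for v x
    using bounds[OF that(1)] that K by auto
  have side: "u K \<le> d v \<or> u v \<le> u K" if v: "v \<in> V" "v \<noteq> K" for v
    using disjoint[OF v(1) K(1) v(2)] rK[OF v(1), of "r v"] proper[OF v(1)] proper[OF K(1)] bounds[OF v(1)] K(2)
    by linarith
  obtain a where a: "a \<in> V" "l a < px" "px \<le> r a" "d a < Y1" "Y1 \<le> u a"
    using south_west_iff[of px Y1] order unfolding south_west_def by auto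
  obtain b where b: "b \<in> V" "l b < px" "px \<le> r b" "d b \<le> Y0" "Y0 < u b"
    using north_west_iff[of px Y0] order unfolding north_west_def by auto
  have aK: "a \<noteq> K" "u K < u a" using a dK by auto
  have bK: "b \<noteq> K" using b dK by auto
  have ub: "u b \<le> u K"
    using side[OF b(1) bK] b(4) dK proper[OF K(1)] by linarith
  have inv: "u K < u v" if "(a, v) \<in> {(x, y). x \<in> V - {K} \<and> y \<in> V - {K} \<and> meets l r d u x y}\<^sup>*" for v
    using that
  proof (induction rule: rtrancl_induct)
    case base then show ?case using aK by simp
  next
    case (step v w)
    then have v: "v \<in> V" "v \<noteq> K" and w: "w \<in> V" "w \<noteq> K" and m: "meets l r d u v w" by auto
    have dv: "u K \<le> d v" using side[OF v] step.IH by linarith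
    show ?case
    proof (rule ccontr)
      assume "\<not> u K < u w"
      then have "u w \<le> u K" by simp
      then have e: "u w = u K" "d v = u K" "max (l v) (l w) < min (r v) (r w)"
        using m dv proper[OF v(1)] proper[OF w(1)] unfolding meets_def by auto
      have "r v \<le> r K" using rK[OF v(1) step.IH, of "r v"] by simp
      then show False
        using disjoint[OF w(1) K(1) w(2)] e proper[OF w(1)] proper[OF K(1)] bounds[OF v(1)] K(2) by linarith
    qed
  qed
  have "u K < u b" using inv con[of a b] a(1) aK b(1) bK by blast
  then show False using ub by simp
qed

text \<open>Sides by number: left, right, bottom, top, and as number 4 the two walls at the concave
  corner together. A module without convex corner may touch both of these, so separating them would
  break \<open>touch_unique\<close>.\<close>

definition touch :: "nat \<Rightarrow> 'v \<Rightarrow> bool" where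
  "touch i v \<longleftrightarrow> (i = 0 \<and> l v = X0) \<or> (i = 1 \<and> r v = X1) \<or> (i = 2 \<and> d v = Y0) \<or> (i = 3 \<and> u v = Y1) \<or>
     (i = 4 \<and> px \<le> r v \<and> py \<le> u v)"

lemma open_wall_touch:
  assumes "v \<in> V" "w \<in> V" "open_wall V l r d u v w"
  obtains i where "touch i v" "touch i w"
proof -
  obtain x y where xy: "in_box l r d u v x y" "in_box l r d u w x y" "\<not> full V l r d u x y"
    using assms(3) unfolding open_wall_def by blast
  have "\<exists>i. touch i v \<and> touch i w"
  proof -
    consider "x \<le> X0" | "x \<ge> X1" | "y \<le> Y0" | "y \<ge> Y1" | "x \<ge> px" "y \<ge> py" using xy(3) unfolding full_iff by linarith
    then show ?thesis
    proof cases
      case 1 then show ?thesis using xy bounds[OF assms(1)] bounds[OF assms(2)]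
        by (intro exI[of _ 0]) (auto simp: touch_def in_box_def)
    next
      case 2 then show ?thesis using xy bounds[OF assms(1)] bounds[OF assms(2)]
        by (intro exI[of _ 1]) (auto simp: touch_def in_box_def)
    next
      case 3 then show ?thesis using xy bounds[OF assms(1)] bounds[OF assms(2)]
        by (intro exI[of _ 2]) (auto simp: touch_def in_box_def)
    next
      case 4 then show ?thesis using xy bounds[OF assms(1)] bounds[OF assms(2)]
        by (intro exI[of _ 3]) (auto simp: touch_def in_box_def)
    next
      case 5 then show ?thesis using xy by (intro exI[of _ 4]) (auto simp: touch_def in_box_def)
    qed
  qed
  then show ?thesis using that by blast
qed

lemma touch_vertical_wall:
  assumes V: "v \<in> V" "w \<in> V" and t: "touch i v" "touch i w"
    and m: "r v = l w" "max (d v) (d w) < min (u v) (u w)"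
  shows "open_wall V l r d u v w"
proof -
  note p = proper[OF V(1)] proper[OF V(2)] bounds[OF V(1)] bounds[OF V(2)]
  have m': "d v < u w" "d w < u v" using m(2) by simp_all
  \<comment> \<open>Two modules side by side cannot both touch the left or both touch the right
    side, so the side they share is the bottom, the top or the one at the concave corner.\<close>
  consider "d v = Y0" "d w = Y0" | "u v = Y1" "u w = Y1" | "px \<le> r v" "py \<le> u v" "px \<le> r w" "py \<le> u w"
    using t p m(1) unfolding touch_def by auto
  then show ?thesis
  proof cases
    case 1
    then show ?thesis unfolding open_wall_def in_box_def full_iff
      using p m(1) by (intro exI[of _ "r v"] exI[of _ Y0]) simp
  next
    case 2
    then show ?thesis unfolding open_wall_def in_box_def full_iff
      using p m(1) by (intro exI[of _ "r v"] exI[of _ Y1]) simp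
  next
    case 3
    then have "u w = py" using p m(1) by linarith
    then show ?thesis unfolding open_wall_def in_box_def full_iff
      using p m(1) m' 3 by (intro exI[of _ "r v"] exI[of _ py]) simp
  qed
qed

lemma touch_meets_open_wall:
  assumes V: "v \<in> V" "w \<in> V" and t: "touch i v" "touch i w" and m: "meets l r d u v w"
  shows "open_wall V l r d u v w"
proof -
  interpret T: L_plan V d u l r Y0 py Y1 X0 px X1 by (rule L_plan_transpose)
  obtain j where t': "T.touch j v" "T.touch j w"
  proof (rule that)
    \<comment> \<open>Transposition exchanges left with bottom and right with top and keeps the
      concave corner.\<close>
    let ?j = "if i = 0 then 2 else if i = 1 then 3 else if i = 2 then 0 else if i = 3 then 1 else i"
    show "T.touch ?j v" "T.touch ?j w" using t unfolding touch_def T.touch_def by auto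
  qed
  consider "r v = l w" "max (d v) (d w) < min (u v) (u w)" | "r w = l v" "max (d w) (d v) < min (u w) (u v)"
    | "u v = d w" "max (l v) (l w) < min (r v) (r w)" | "u w = d v" "max (l w) (l v) < min (r w) (r v)"
    using m unfolding meets_def max.commute[of "_ w"] min.commute[of "_ w"] by metis
  then show ?thesis
  proof cases
    case 1 show ?thesis by (rule touch_vertical_wall[OF V t 1])
  next
    case 2 show ?thesis by (rule open_wall_sym[THEN iffD1, OF touch_vertical_wall[OF V(2,1) t(2,1) 2]])
  next
    case 3 show ?thesis by (rule open_wall_transpose[THEN iffD2, OF T.touch_vertical_wall[OF V t' 3]])
  next
    case 4 show ?thesis
      by (rule open_wall_sym[THEN iffD1, OF open_wall_transpose[THEN iffD2, OF T.touch_vertical_wall[OF V(2,1) t'(2,1) 4]]])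
  qed
qed

text \<open>Touching two sides with a common convex corner makes \<open>K\<close> a corner module.
  The right and the top side are kept apart by the missing quadrant, and for any other two sides
  \<open>K\<close> would span the region and be a cut vertex.\<close>

lemma touch_unique:
  assumes K: "K \<in> V" "\<not> corner K" and t: "touch i K" "touch j K"
    and con: "\<And>x y. x \<in> V - {K} \<Longrightarrow> y \<in> V - {K} \<Longrightarrow>
      (x, y) \<in> {(x, y). x \<in> V - {K} \<and> y \<in> V - {K} \<and> meets l r d u x y}\<^sup>*"
  shows "i = j"
proof -
  interpret T: L_plan V d u l r Y0 py Y1 X0 px X1 by (rule L_plan_transpose)
  have mt: "meets d u l r = meets l r d u" by (intro ext) (rule meets_transpose)
  have ct: "T.corner K \<longleftrightarrow> corner K"
    unfolding T.corner_def corner_def by blast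
  have con': "(x, y) \<in> {(x, y). x \<in> V - {K} \<and> y \<in> V - {K} \<and> meets d u l r x y}\<^sup>*"
    if "x \<in> V - {K}" "y \<in> V - {K}" for x y
    unfolding mt using con[OF that] .
  have h: "\<not> (l K = X0 \<and> r K \<ge> px \<and> (r K = X1 \<or> u K \<ge> py))"
    using no_horizontal_span[OF K(1) _ _ _ K(2) con] by blast
  have v: "\<not> (d K = Y0 \<and> u K \<ge> py \<and> (u K = Y1 \<or> r K \<ge> px))"
    using T.no_horizontal_span[OF K(1) _ _ _ _ con'] ct K(2) by blast
  note b = bounds[OF K(1)]
  have f: "\<not> (l K = X0 \<and> d K = Y0)" "\<not> (r K = X1 \<and> d K = Y0)" "\<not> (l K = X0 \<and> u K = Y1)"
    "\<not> (r K = X1 \<and> u K = py)" "\<not> (u K = Y1 \<and> r K = px)"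
    using K(2) unfolding corner_def by blast+
  have g: "\<not> (l K = X0 \<and> r K = X1)" "\<not> (l K = X0 \<and> px \<le> r K \<and> py \<le> u K)"
    "\<not> (d K = Y0 \<and> u K = Y1)" "\<not> (d K = Y0 \<and> px \<le> r K \<and> py \<le> u K)"
    using h v order by auto
  have g': "\<not> (r K = X1 \<and> u K = Y1)" "\<not> (r K = X1 \<and> py \<le> u K)" "\<not> (u K = Y1 \<and> px \<le> r K)"
    using f(4,5) b(5) order by linarith+
  show ?thesis
    using t unfolding touch_def by (elim disjE conjE) (use f g g' in simp_all)
qed

lemma chain_has_corner:
  assumes us: "set us \<subseteq> V" "length us \<ge> 3"
    and walls: "successively (open_wall V l r d u) us"
    and ends: "meets l r d u (hd us) (last us)" "\<not> open_wall V l r d u (hd us) (last us)"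
    and con: "\<And>K x y. K \<in> V \<Longrightarrow> x \<in> V - {K} \<Longrightarrow> y \<in> V - {K} \<Longrightarrow>
      (x, y) \<in> {(x, y). x \<in> V - {K} \<and> y \<in> V - {K} \<and> meets l r d u x y}\<^sup>*"
    and d: "distinct us"
  shows "\<exists>v\<in>set us. v \<noteq> hd us \<and> v \<noteq> last us \<and> corner v"
proof (rule ccontr)
  assume nc: "\<not> ?thesis"
  have main: "\<exists>i. touch i (hd us) \<and> touch i (last us)"
    if "us \<noteq> []" "length us \<ge> 2" "set us \<subseteq> V" "successively (open_wall V l r d u) us" "distinct us"
      "\<forall>v\<in>set us. v \<noteq> hd us \<and> v \<noteq> last us \<longrightarrow> \<not> corner v" for us
    using that
  proof (induction us)
    case (Cons v us)
    then obtain w ws where us: "us = w # ws" by (cases us) auto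
    have vw: "v \<in> V" "w \<in> V" "open_wall V l r d u v w" using Cons.prems us by auto
    then obtain i where i: "touch i v" "touch i w" by (rule open_wall_touch)
    show ?case
    proof (cases "ws = []")
      case True then show ?thesis using i us by auto
    next
      case False
      have "\<exists>j. touch j (hd us) \<and> touch j (last us)"
        by (rule Cons.IH) (use Cons.prems us False in \<open>auto simp: Suc_le_eq\<close>)
      then obtain j where j: "touch j w" "touch j (last us)" using us by auto
      have "w \<noteq> last us" using Cons.prems(5) us False by auto
      then have "\<not> corner w" using Cons.prems us by auto
      then have "i = j" using touch_unique[OF vw(2) _ i(2) j(1)] con[OF vw(2)] by blast
      then show ?thesis using i j us by auto
    qed
  qed simp
  have "us \<noteq> []" using us(2) by auto
  then obtain i where "touch i (hd us)" "touch i (last us)"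
    using main[of us] us walls d nc by auto
  moreover have "hd us \<in> V" "last us \<in> V" using us(1) \<open>us \<noteq> []\<close> by auto
  ultimately show False using touch_meets_open_wall ends by blast
qed

section \<open>Triplets of modules at the concave corner\<close>

definition good_triple :: "'v \<Rightarrow> 'v \<Rightarrow> 'v \<Rightarrow> bool" where
  "good_triple a b c \<longleftrightarrow> a \<in> V \<and> b \<in> V \<and> c \<in> V \<and> a \<noteq> c \<and> meets l r d u a b \<and> meets l r d u b c \<and>
     open_wall V l r d u a b \<and> open_wall V l r d u b c \<and> \<not> meets l r d u a c \<and>
     (\<forall>w\<in>V. meets l r d u a w \<and> meets l r d u c w \<longrightarrow> w = b)"

lemma meets_point:
  assumes "meets l r d u v w" "v \<in> V" "w \<in> V"
  obtains x y where "in_box l r d u v x y" "in_box l r d u w x y"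
proof (rule that)
  show "in_box l r d u v (max (l v) (l w)) (max (d v) (d w))" "in_box l r d u w (max (l v) (l w)) (max (d v) (d w))"
    using assms(1) proper[OF assms(2)] proper[OF assms(3)] unfolding meets_def in_box_def by auto
qed

text \<open>To touch \<open>A\<close>, the module \<open>w\<close> must extend left to
  \<open>px\<close> and up to \<open>y1\<close>; to touch \<open>C\<close>, it must extend right to
  \<open>px\<close> and down to \<open>py\<close>. So it contains the vertical segment from the
  concave corner up to height \<open>y1\<close>.\<close>

lemma common_contains_segment:
  assumes A: "A \<in> V" "r A \<le> px" "y1 \<le> d A" and C: "C \<in> V" "px \<le> l C" "u C \<le> py" and y: "py \<le> y1"
    and w: "w \<in> V" "meets l r d u A w" "meets l r d u C w"
  shows "l w \<le> px \<and> px \<le> r w \<and> d w \<le> py \<and> y1 \<le> u w"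
proof -
  obtain x y where "in_box l r d u A x y" "in_box l r d u w x y" by (rule meets_point[OF w(2) A(1) w(1)])
  moreover obtain x' y' where "in_box l r d u C x' y'" "in_box l r d u w x' y'" by (rule meets_point[OF w(3) C(1) w(1)])
  ultimately show ?thesis using A C unfolding in_box_def by linarith
qed

text \<open>Here three modules occupy the three quadrants at the concave corner. A common neighbour
  of \<open>A\<close> and \<open>C\<close> contains that corner, and only the quadrant of
  \<open>B\<close> is left for it.\<close>

lemma triple_at_distinct:
  assumes A: "A \<in> V" "r A = px" "d A = py" and B: "B \<in> V" "r B = px" "u B = py"
    and C: "C \<in> V" "l C = px" "u C = py"
  shows "good_triple A B C"
proof -
  note p = proper[OF A(1)] proper[OF B(1)] proper[OF C(1)]
  have ne: "A \<noteq> B" "B \<noteq> C" "A \<noteq> C" using A B C p by auto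
  have m: "meets l r d u A B" "meets l r d u B C" "\<not> meets l r d u A C" using A B C p ne unfolding meets_def by auto
  have nf: "\<not> full V l r d u px py" unfolding full_iff by simp
  have o: "open_wall V l r d u A B" "open_wall V l r d u B C"
    unfolding open_wall_def by (rule exI[of _ px], rule exI[of _ py], use A B C p nf in \<open>simp add: in_box_def\<close>)+
  have "w = B" if w: "w \<in> V" "meets l r d u A w" "meets l r d u C w" for w
  proof (rule ccontr)
    assume n: "w \<noteq> B"
    have b: "l w \<le> px" "px \<le> r w" "d w \<le> py" "py \<le> u w"
      using common_contains_segment[OF A(1) _ _ C(1) _ _ _ w] A C by auto
    have nA: "w \<noteq> A" and nC: "w \<noteq> C" using w(2,3) unfolding meets_def by auto
    show False
      using b disjoint[OF w(1) A(1) nA] disjoint[OF w(1) B(1) n] disjoint[OF w(1) C(1) nC] A B C p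
        proper[OF w(1)] bounds(5)[OF w(1)] by linarith
  qed
  then show ?thesis unfolding good_triple_def using A B C ne m o by blast
qed

text \<open>\<open>A\<close> covers both western quadrants at the concave corner but ends below the
  top, and \<open>D\<close> is the next module upwards along the wall. A common neighbour of
  \<open>D\<close> and \<open>C\<close> would contain the stretch of the wall that \<open>A\<close>
  occupies.\<close>

lemma triple_at_spanning:
  assumes A: "A \<in> V" "r A = px" "d A < py" "py < u A" "u A < Y1"
    and C: "C \<in> V" "l C = px" "u C = py"
  obtains D where "good_triple D A C"
proof -
  obtain D where D: "D \<in> V" "l D < px" "px \<le> r D" "d D \<le> u A" "u A < u D"
    using north_west_iff[of px "u A"] order A unfolding north_west_def by auto
  note p = proper[OF A(1)] proper[OF C(1)] proper[OF D(1)]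
  have DA: "D \<noteq> A" using D by auto
  have rD: "r D = px" using D bounds(5)[OF D(1)] A by linarith
  have dD: "d D = u A" using disjoint[OF D(1) A(1) DA] D p A rD by linarith
  have ne: "A \<noteq> C" "D \<noteq> C" using A C D dD p by auto
  have m: "meets l r d u D A" "meets l r d u A C" "\<not> meets l r d u D C"
    using A C D p ne DA rD dD unfolding meets_def by auto
  have "open_wall V l r d u A C"
    unfolding open_wall_def by (rule exI[of _ px], rule exI[of _ py]) (use A C p in \<open>simp add: in_box_def full_iff\<close>)
  moreover have "open_wall V l r d u D A"
    unfolding open_wall_def by (rule exI[of _ px], rule exI[of _ "u A"]) (use A D rD dD p in \<open>simp add: in_box_def full_iff\<close>)
  moreover have "w = A" if w: "w \<in> V" "meets l r d u D w" "meets l r d u C w" for w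
  proof (rule ccontr)
    assume n: "w \<noteq> A"
    have b: "l w \<le> px" "px \<le> r w" "d w \<le> py" "u A \<le> u w"
      using common_contains_segment[OF D(1) _ _ C(1) _ _ _ w, of "u A"] A C rD dD by auto
    show False
      using b disjoint[OF w(1) A(1) n] A p proper[OF w(1)] bounds(5)[OF w(1)] by linarith
  qed
  ultimately have "good_triple D A C" unfolding good_triple_def using A C D ne m by blast
  then show ?thesis by (rule that)
qed

text \<open>Compare the modules \<open>A\<close>, \<open>B\<close> and \<open>C\<close> in the
  north-west, south-west and south-east quadrants at the concave corner. \<open>A\<close> and
  \<open>C\<close> always differ. If \<open>B\<close> coincides with one of them, either that module
  ends before the far end of its wall, which gives a triplet, or it covers the wall
  completely.\<close>

lemma concave_corner_cases:
  obtains a b c where "good_triple a b c"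
  | A where "A \<in> V" "r A = px" "d A < py" "u A = Y1"
  | C where "C \<in> V" "u C = py" "l C < px" "r C = X1"
proof -
  interpret T: L_plan V d u l r Y0 py Y1 X0 px X1 by (rule L_plan_transpose)
  have gt: "good_triple c b a" if "T.good_triple a b c" for a b c
    using that meets_transpose[of d u l r] open_wall_transpose[of V d u l r] meets_sym[of l r d u] open_wall_sym[of V l r d u]
    unfolding T.good_triple_def good_triple_def by metis
  obtain A where A: "A \<in> V" "l A < px" "px \<le> r A" "d A \<le> py" "py < u A"
    using north_west_iff[of px py] order unfolding north_west_def by auto
  obtain B where B: "B \<in> V" "l B < px" "px \<le> r B" "d B < py" "py \<le> u B"
    using south_west_iff[of px py] order unfolding south_west_def by auto
  obtain C where C: "C \<in> V" "l C \<le> px" "px < r C" "d C < py" "py \<le> u C"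
    using south_east_iff[of px py] order unfolding south_east_def by auto
  have rA: "r A = px" and uC: "u C = py" using bounds(5)[OF A(1)] bounds(5)[OF C(1)] A C by linarith+
  note p = proper[OF A(1)] proper[OF B(1)] proper[OF C(1)]
  show ?thesis
  proof (cases "A = B")
    case AB: True
    have AC: "A \<noteq> C" using rA C by auto
    have "d A < py" using B AB by simp
    then have lC: "l C = px" using disjoint[OF A(1) C(1) AC] A C rA uC p by linarith
    show ?thesis
    proof (cases "u A < Y1")
      case True
      then show ?thesis using triple_at_spanning[OF A(1) rA _ A(5) True C(1) lC uC] B AB that(1) by blast
    next
      case False
      then show ?thesis using that(2)[OF A(1) rA] B AB bounds(4)[OF A(1)] by fastforce
    qed
  next
    case AB: False
    show ?thesis
    proof (cases "B = C")
      case BC: True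
      have AC: "A \<noteq> C" "l C < px" using AB B BC by auto
      then have dA: "d A = py" using disjoint[OF A(1) C(1) AC(1)] A C rA uC p by linarith
      show ?thesis
      proof (cases "r C < X1")
        case True
        obtain D where "T.good_triple D C A"
          using T.triple_at_spanning[OF C(1) uC _ C(3) True A(1) dA rA] B BC by blast
        then show ?thesis using gt that(1) by blast
      next
        case False
        then show ?thesis using that(3)[OF C(1) uC] B BC bounds(2)[OF C(1)] by fastforce
      qed
    next
      case BC: False
      have "u B = py" "d A = py" using disjoint[OF A(1) B(1) AB] A B rA p by linarith+
      moreover have "r B = px" "l C = px" using disjoint[OF B(1) C(1) BC] B C uC p by linarith+
      ultimately have "good_triple A B C" using triple_at_distinct A(1) B(1) C(1) rA uC by blast
      then show ?thesis by (rule that(1))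
    qed
  qed
qed

text \<open>Fills the missing quadrant by pushing up the wall below it. The condition on
  \<open>l v\<close> leaves alone those modules to the left of the concave corner that merely end at
  its height.\<close>

definition stretched :: "'v \<Rightarrow> real" where
  "stretched v = (if px \<le> l v \<and> u v = py then Y1 else u v)"

lemma stretched_ge: "u v \<le> stretched v"
  unfolding stretched_def using order by auto

text \<open>Otherwise \<open>w\<close> would stand above height \<open>py\<close> against the wall
  at \<open>px\<close> and overlap \<open>A\<close>, which covers this wall up to the top. Hence a
  pushed module gains no neighbour on its left.\<close>

lemma right_of_spanning_low:
  assumes A: "A \<in> V" "r A = px" "d A < py" "u A = Y1" and w: "w \<in> V" "px \<le> r w"
  shows "d w < py"
proof (rule ccontr)
  assume dw: "\<not> d w < py"
  have "r w = px" using dw w(2) bounds(5)[OF w(1)] proper[OF w(1)] by linarith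
  moreover have "w \<noteq> A" using A dw by auto
  ultimately show False
    using disjoint[OF w(1) A(1)] A dw proper[OF w(1)] proper[OF A(1)] bounds(4)[OF w(1)] by linarith
qed

lemma stretched_boxes:
  assumes A: "A \<in> V" "r A = px" "d A < py" "u A = Y1"
  shows "boxes V l r d stretched"
  unfolding boxes_def
proof (intro conjI ballI impI)
  show "finite V" by (rule fin)
  show "l v < r v" "d v < stretched v" if "v \<in> V" for v
    using proper[OF that] stretched_ge[of v] by linarith+
  have one: "r v \<le> l w \<or> r w \<le> l v \<or> stretched v \<le> d w \<or> stretched w \<le> d v"
    if v: "v \<in> V" and w: "w \<in> V" and ne: "v \<noteq> w" and s: "px \<le> l v" "u v = py" for v w
  proof (cases "px \<le> l w \<and> u w = py")
    case True
    then show ?thesis using disjoint[OF v w ne] s proper[OF v] proper[OF w] by linarith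
  next
    case False
    then have sw: "stretched w = u w" unfolding stretched_def by auto
    show ?thesis
    proof (rule ccontr)
      assume n: "\<not> ?thesis"
      then have "u v \<le> d w" using disjoint[OF v w ne] sw by linarith
      then show False using n s proper[OF w] proper[OF v] bounds(5)[OF w] by linarith
    qed
  qed
  show "r v \<le> l w \<or> r w \<le> l v \<or> stretched v \<le> d w \<or> stretched w \<le> d v"
    if v: "v \<in> V" and w: "w \<in> V" and ne: "v \<noteq> w" for v w
  proof (cases "px \<le> l v \<and> u v = py")
    case True then show ?thesis using one[OF v w ne] by blast
  next
    case F1: False
    show ?thesis
    proof (cases "px \<le> l w \<and> u w = py")
      case True then show ?thesis using one[OF w v] ne by blast
    next
      case False
      then have "stretched w = u w" "stretched v = u v" using F1 unfolding stretched_def by auto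
      then show ?thesis using disjoint[OF v w ne] by simp
    qed
  qed
qed

lemma stretched_meets:
  assumes A: "A \<in> V" "r A = px" "d A < py" "u A = Y1" and V: "v \<in> V" "w \<in> V"
  shows "meets l r d stretched v w \<longleftrightarrow> meets l r d u v w"
proof -
  have one: "meets l r d stretched v w \<longleftrightarrow> meets l r d u v w"
    if v: "v \<in> V" and w: "w \<in> V" and s: "px \<le> l v" "u v = py" for v w
  proof (cases "v = w")
    case True then show ?thesis unfolding meets_def by simp
  next
    case ne: False
    note p = proper[OF v] proper[OF w] bounds[OF v] bounds[OF w]
    have sv: "stretched v = Y1" using s unfolding stretched_def by simp
    show ?thesis
    proof (cases "px \<le> l w \<and> u w = py")
      case True
      then have "stretched w = Y1" unfolding stretched_def by simp
      then show ?thesis using sv True s p order unfolding meets_def by auto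
    next
      case False
      then have sw: "stretched w = u w" unfolding stretched_def by auto
      \<comment> \<open>The new part of \<open>v\<close> lies above \<open>py\<close>. Modules to
        its right that are not pushed stop at \<open>py\<close>; those to its left begin below
        \<open>py\<close> and so were neighbours before; and there was nothing on top of
        \<open>v\<close>.\<close>
      have "r v = l w \<Longrightarrow> u w \<le> py" using p s by linarith
      moreover have "r w = l v \<Longrightarrow> d w < py"
        using right_of_spanning_low[OF A w] s(1) by simp
      moreover have "py = d w \<Longrightarrow> max (l v) (l w) < min (r v) (r w) \<Longrightarrow> False" using p s by auto
      moreover have "d w < Y1" using p by linarith
      ultimately show ?thesis using sv sw s p order unfolding meets_def by auto
    qed
  qed
  show ?thesis
  proof (cases "px \<le> l v \<and> u v = py")
    case True then show ?thesis using one[OF V] by blast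
  next
    case F1: False
    show ?thesis
    proof (cases "px \<le> l w \<and> u w = py")
      case True
      then show ?thesis using one[OF V(2,1)] meets_sym[of l r d stretched] meets_sym[of l r d u] by blast
    next
      case False
      then have "stretched w = u w" "stretched v = u v" using F1 unfolding stretched_def by auto
      then show ?thesis unfolding meets_def by simp
    qed
  qed
qed

lemma stretched_cover:
  assumes A: "A \<in> V" "r A = px" "d A < py" "u A = Y1"
  shows "(\<exists>v\<in>V. in_box l r d stretched v x y) \<longleftrightarrow> X0 \<le> x \<and> x \<le> X1 \<and> Y0 \<le> y \<and> y \<le> Y1"
proof
  assume "\<exists>v\<in>V. in_box l r d stretched v x y"
  then obtain v where v: "v \<in> V" "in_box l r d stretched v x y" by blast
  then show "X0 \<le> x \<and> x \<le> X1 \<and> Y0 \<le> y \<and> y \<le> Y1"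
    using bounds[OF v(1)] order unfolding in_box_def stretched_def by (auto split: if_splits)
next
  assume c: "X0 \<le> x \<and> x \<le> X1 \<and> Y0 \<le> y \<and> y \<le> Y1"
  show "\<exists>v\<in>V. in_box l r d stretched v x y"
  proof (cases "x \<le> px \<or> y \<le> py")
    case True
    then obtain v where "v \<in> V" "in_box l r d u v x y" using cover[of x y] c by blast
    then show ?thesis using stretched_ge[of v] unfolding in_box_def by (intro bexI[of _ v]) auto
  next
    case False
    then obtain K where K: "K \<in> V" "l K < x" "x \<le> r K" "d K < py" "py \<le> u K"
      using south_west_iff[of x py] c order unfolding south_west_def by auto
    have uK: "u K = py" using K False bounds(5)[OF K(1)] by linarith
    \<comment> \<open>\<open>K\<close> is the module under the wall below the point. Reaching left
      of \<open>px\<close> it would overlap \<open>A\<close>, so it is one of the pushed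
      modules.\<close>
    have "px \<le> l K"
    proof (rule ccontr)
      assume "\<not> px \<le> l K"
      moreover have "K \<noteq> A" using A K False by auto
      ultimately show False using disjoint[OF K(1) A(1)] A K False uK proper[OF A(1)] order by linarith
    qed
    then have "stretched K = Y1" using uK unfolding stretched_def by simp
    then show ?thesis using K c False unfolding in_box_def by (intro bexI[of _ K]) auto
  qed
qed

lemma stretched_moved:
  assumes "v \<in> V" "stretched v \<noteq> u v" "l v \<le> x"
  shows "\<not> full V l r d u x (u v)"
  using assms unfolding stretched_def full_iff by (auto split: if_splits)

end

section \<open>The region with a single concave corner\<close>

definition covered :: "'v set \<Rightarrow> 'v coord \<Rightarrow> 'v coord \<Rightarrow> 'v coord \<Rightarrow> 'v coord \<Rightarrow> real \<Rightarrow> real \<Rightarrow> bool" where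
  "covered V l r d u x y \<longleftrightarrow> (\<exists>v\<in>V. in_box l r d u v x y)"

text \<open>At least three quadrants are covered. A point with exactly three is a concave corner, so
  everywhere else \<open>three_quadrants\<close> implies \<open>full\<close>; the hypotheses
  \<open>no3\<close> below have this origin.\<close>

definition three_quadrants :: "'v set \<Rightarrow> 'v coord \<Rightarrow> 'v coord \<Rightarrow> 'v coord \<Rightarrow> 'v coord \<Rightarrow> real \<Rightarrow> real \<Rightarrow> bool" where
  "three_quadrants V l r d u x y \<longleftrightarrow>
     north_east V l r d u x y \<and> north_west V l r d u x y \<and> south_west V l r d u x y \<or>
     north_west V l r d u x y \<and> south_west V l r d u x y \<and> south_east V l r d u x y \<or>
     south_west V l r d u x y \<and> south_east V l r d u x y \<and> north_east V l r d u x y \<or>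
     south_east V l r d u x y \<and> north_east V l r d u x y \<and> north_west V l r d u x y"

lemma quadrants_flip_y:
  "north_east V l r (\<lambda>v. - u v) (\<lambda>v. - d v) x y \<longleftrightarrow> south_east V l r d u x (- y)"
  "north_west V l r (\<lambda>v. - u v) (\<lambda>v. - d v) x y \<longleftrightarrow> south_west V l r d u x (- y)"
  "south_east V l r (\<lambda>v. - u v) (\<lambda>v. - d v) x y \<longleftrightarrow> north_east V l r d u x (- y)"
  "south_west V l r (\<lambda>v. - u v) (\<lambda>v. - d v) x y \<longleftrightarrow> north_west V l r d u x (- y)"
  unfolding north_east_def north_west_def south_east_def south_west_def
  by (simp_all add: minus_le_iff le_minus_iff minus_less_iff less_minus_iff conj_comms)

lemma quadrants_transpose:
  "north_east V d u l r x y \<longleftrightarrow> north_east V l r d u y x"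
  "north_west V d u l r x y \<longleftrightarrow> south_east V l r d u y x"
  "south_east V d u l r x y \<longleftrightarrow> north_west V l r d u y x"
  "south_west V d u l r x y \<longleftrightarrow> south_west V l r d u y x"
  unfolding north_east_def north_west_def south_east_def south_west_def by blast+

lemma covered_transpose: "covered V d u l r x y \<longleftrightarrow> covered V l r d u y x"
  unfolding covered_def in_box_def by blast

lemma covered_flip_y: "covered V l r (\<lambda>v. - u v) (\<lambda>v. - d v) x y \<longleftrightarrow> covered V l r d u x (- y)"
proof -
  have "in_box l r (\<lambda>v. - u v) (\<lambda>v. - d v) v x y \<longleftrightarrow> in_box l r d u v x (- y)" for v
    unfolding in_box_def by auto
  then show ?thesis unfolding covered_def by simp
qed

lemma three_quadrants_flip_y:
  "three_quadrants V l r (\<lambda>v. - u v) (\<lambda>v. - d v) x y \<longleftrightarrow> three_quadrants V l r d u x (- y)"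
  unfolding three_quadrants_def quadrants_flip_y by argo

lemma three_quadrants_transpose: "three_quadrants V d u l r x y \<longleftrightarrow> three_quadrants V l r d u y x"
  unfolding three_quadrants_def quadrants_transpose[of V d u l r x y] by argo

lemma full_iff_neighbourhood:
  assumes "finite V"
  shows "full V l r d u x y \<longleftrightarrow>
    (\<exists>\<epsilon>>0. \<forall>x' y'. \<bar>x' - x\<bar> < \<epsilon> \<and> \<bar>y' - y\<bar> < \<epsilon> \<longrightarrow> covered V l r d u x' y')"
proof
  assume f: "full V l r d u x y"
  obtain v1 where v1: "v1 \<in> V" "l v1 \<le> x" "x < r v1" "d v1 \<le> y" "y < u v1"
    using f unfolding full_def north_east_def by blast
  obtain v2 where v2: "v2 \<in> V" "l v2 < x" "x \<le> r v2" "d v2 \<le> y" "y < u v2"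
    using f unfolding full_def north_west_def by blast
  obtain v3 where v3: "v3 \<in> V" "l v3 < x" "x \<le> r v3" "d v3 < y" "y \<le> u v3"
    using f unfolding full_def south_west_def by blast
  obtain v4 where v4: "v4 \<in> V" "l v4 \<le> x" "x < r v4" "d v4 < y" "y \<le> u v4"
    using f unfolding full_def south_east_def by blast
  define \<epsilon> where "\<epsilon> = Min {r v1 - x, u v1 - y, x - l v2, u v2 - y, x - l v3, y - d v3, r v4 - x, y - d v4}"
  have "\<epsilon> > 0" unfolding \<epsilon>_def by (subst Min_gr_iff) (use v1 v2 v3 v4 in auto)
  moreover have "covered V l r d u x' y'" if "\<bar>x' - x\<bar> < \<epsilon>" "\<bar>y' - y\<bar> < \<epsilon>" for x' y'
  proof -
    have e: "\<epsilon> \<le> r v1 - x" "\<epsilon> \<le> u v1 - y" "\<epsilon> \<le> x - l v2" "\<epsilon> \<le> u v2 - y" "\<epsilon> \<le> x - l v3" "\<epsilon> \<le> y - d v3"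
      "\<epsilon> \<le> r v4 - x" "\<epsilon> \<le> y - d v4"
      unfolding \<epsilon>_def by (rule Min_le; simp)+
    consider "x \<le> x'" "y \<le> y'" | "x' \<le> x" "y \<le> y'" | "x' \<le> x" "y' \<le> y" | "x \<le> x'" "y' \<le> y" by linarith
    then show ?thesis
    proof cases
      case 1
      then have "in_box l r d u v1 x' y'" unfolding in_box_def using that v1 e by linarith
      then show ?thesis unfolding covered_def using v1(1) by blast
    next
      case 2
      then have "in_box l r d u v2 x' y'" unfolding in_box_def using that v2 e by linarith
      then show ?thesis unfolding covered_def using v2(1) by blast
    next
      case 3
      then have "in_box l r d u v3 x' y'" unfolding in_box_def using that v3 e by linarith
      then show ?thesis unfolding covered_def using v3(1) by blast
    next
      case 4
      then have "in_box l r d u v4 x' y'" unfolding in_box_def using that v4 e by linarith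
      then show ?thesis unfolding covered_def using v4(1) by blast
    qed
  qed
  ultimately show "\<exists>\<epsilon>>0. \<forall>x' y'. \<bar>x' - x\<bar> < \<epsilon> \<and> \<bar>y' - y\<bar> < \<epsilon> \<longrightarrow> covered V l r d u x' y'" by metis
next
  assume "\<exists>\<epsilon>>0. \<forall>x' y'. \<bar>x' - x\<bar> < \<epsilon> \<and> \<bar>y' - y\<bar> < \<epsilon> \<longrightarrow> covered V l r d u x' y'"
  then obtain \<epsilon> where e: "\<epsilon> > 0" and c: "\<And>x' y'. \<bar>x' - x\<bar> < \<epsilon> \<Longrightarrow> \<bar>y' - y\<bar> < \<epsilon> \<Longrightarrow> \<exists>v\<in>V. in_box l r d u v x' y'"
    unfolding covered_def by metis
  have no: False if "\<delta> > 0" and g: "\<And>a b. 0 < a \<Longrightarrow> a < \<delta> \<Longrightarrow> 0 < b \<Longrightarrow> b < \<delta> \<Longrightarrow> \<not> (\<exists>v\<in>V. in_box l r d u v (x + s * a) (y + t * b))"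
    and st: "\<bar>s\<bar> = 1" "\<bar>t\<bar> = 1" for \<delta> s t :: real
  proof -
    define a where "a = min \<delta> \<epsilon> / 2"
    have a: "0 < a" "a < \<delta>" "a < \<epsilon>" using that(1) e unfolding a_def by auto
    have "\<bar>x + s * a - x\<bar> < \<epsilon>" "\<bar>y + t * a - y\<bar> < \<epsilon>" using st a by (auto simp: abs_mult)
    then show False using c g[OF a(1,2) a(1,2)] by blast
  qed
  show "full V l r d u x y"
    unfolding full_def
  proof (intro conjI)
    show "north_east V l r d u x y"
    proof (rule ccontr)
      assume "\<not> ?thesis"
      with assms show False by (rule not_north_east_gap) (rule no[where s = 1 and t = 1], auto)
    qed
    show "north_west V l r d u x y"
    proof (rule ccontr)
      assume "\<not> ?thesis"
      with assms show False by (rule not_north_west_gap) (rule no[where s = "-1" and t = 1], auto)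
    qed
    show "south_west V l r d u x y"
    proof (rule ccontr)
      assume "\<not> ?thesis"
      with assms show False by (rule not_south_west_gap) (rule no[where s = "-1" and t = "-1"], auto)
    qed
    show "south_east V l r d u x y"
    proof (rule ccontr)
      assume "\<not> ?thesis"
      with assms show False by (rule not_south_east_gap) (rule no[where s = 1 and t = "-1"], auto)
    qed
  qed
qed

text \<open>Finitely many closed boxes cover a closed set. The gaps are stated for open quadrants,
  so the end is approached diagonally, in the room between \<open>y\<close> and
  \<open>h\<close>.\<close>

lemma covered_closed_ends:
  assumes fin: "finite V" and ab: "a < b" and c: "h' \<le> y" "y < h"
    and cov: "\<And>x y. a < x \<Longrightarrow> x < b \<Longrightarrow> h' \<le> y \<Longrightarrow> y \<le> h \<Longrightarrow> covered V l r d u x y"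
  shows "covered V l r d u a y" "covered V l r d u b y"
proof -
  have s: "0 < min \<epsilon> (min (b - a) (h - y)) / 2" "min \<epsilon> (min (b - a) (h - y)) / 2 < \<epsilon>"
    "min \<epsilon> (min (b - a) (h - y)) / 2 < b - a" "min \<epsilon> (min (b - a) (h - y)) / 2 < h - y" if "\<epsilon> > 0" for \<epsilon>
    using that ab c by (auto simp: min_def)
  show "covered V l r d u a y"
  proof (rule ccontr)
    assume n: "\<not> ?thesis"
    then have "\<not> north_east V l r d u a y" unfolding covered_def in_box_def north_east_def by fastforce
    with fin obtain \<epsilon> where e: "\<epsilon> > 0" and g: "\<And>a' b. 0 < a' \<Longrightarrow> a' < \<epsilon> \<Longrightarrow> 0 < b \<Longrightarrow> b < \<epsilon> \<Longrightarrow> \<not> (\<exists>v\<in>V. in_box l r d u v (a + a') (y + b))"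
      by (rule not_north_east_gap) (rule that)
    define q where "q = min \<epsilon> (min (b - a) (h - y)) / 2"
    note q = s[OF e, folded q_def]
    have "covered V l r d u (a + q) (y + q)" by (rule cov) (use q c in auto)
    then show False using g[OF q(1,2) q(1,2)] unfolding covered_def by blast
  qed
  show "covered V l r d u b y"
  proof (rule ccontr)
    assume n: "\<not> ?thesis"
    then have "\<not> north_west V l r d u b y" unfolding covered_def in_box_def north_west_def by fastforce
    with fin obtain \<epsilon> where e: "\<epsilon> > 0" and g: "\<And>a' b'. 0 < a' \<Longrightarrow> a' < \<epsilon> \<Longrightarrow> 0 < b' \<Longrightarrow> b' < \<epsilon> \<Longrightarrow> \<not> (\<exists>v\<in>V. in_box l r d u v (b - a') (y + b'))"
      by (rule not_north_west_gap) (rule that)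
    define q where "q = min \<epsilon> (min (b - a) (h - y)) / 2"
    note q = s[OF e, folded q_def]
    have "covered V l r d u (b - q) (y + q)" by (rule cov) (use q c in auto)
    then show False using g[OF q(1,2) q(1,2)] unfolding covered_def by blast
  qed
qed

text \<open>
  Along a horizontal segment above which the region extends, the part below the segment cannot
  start or stop without a point with exactly three quadrants.
\<close>

lemma below_side_constant:
  assumes fin: "finite V"
    and north: "\<And>x. a < x \<Longrightarrow> x < b \<Longrightarrow> north_east V l r d u x h \<and> north_west V l r d u x h"
    and no3: "\<And>x. a < x \<Longrightarrow> x < b \<Longrightarrow> three_quadrants V l r d u x h \<Longrightarrow> full V l r d u x h"
    and x0: "a < x0" "x0 < b" "south_east V l r d u x0 h \<or> south_west V l r d u x0 h"
    and x: "a < x" "x < b"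
  shows "south_east V l r d u x h \<and> south_west V l r d u x h"
proof -
  \<comment> \<open>One southern quadrant without the other would leave exactly three, so they come
    and go together. This makes \<open>?S\<close> and \<open>?N\<close> both open.\<close>
  have eq: "south_east V l r d u x h \<longleftrightarrow> south_west V l r d u x h" if "a < x" "x < b" for x
    using north[OF that] no3[OF that] unfolding three_quadrants_def full_def by blast
  let ?S = "{x. a < x \<and> x < b \<and> south_east V l r d u x h}"
  let ?N = "{x. a < x \<and> x < b \<and> \<not> south_east V l r d u x h}"
  have "open ?S"
    unfolding open_contains_ball
  proof (intro ballI)
    fix x assume "x \<in> ?S"
    then have x: "a < x" "x < b" "south_east V l r d u x h" "south_west V l r d u x h" using eq by auto
    obtain v where v: "v \<in> V" "l v \<le> x" "x < r v" "d v < h" "h \<le> u v" using x(3) unfolding south_east_def by blast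
    obtain w where w: "w \<in> V" "l w < x" "x \<le> r w" "d w < h" "h \<le> u w" using x(4) unfolding south_west_def by blast
    define \<epsilon> where "\<epsilon> = Min {x - a, b - x, r v - x, x - l w}"
    have e: "\<epsilon> \<le> x - a" "\<epsilon> \<le> b - x" "\<epsilon> \<le> r v - x" "\<epsilon> \<le> x - l w" unfolding \<epsilon>_def by (rule Min_le; simp)+
    have "\<epsilon> > 0" unfolding \<epsilon>_def using x v w by simp
    moreover have "ball x \<epsilon> \<subseteq> ?S"
    proof
      fix z assume "z \<in> ball x \<epsilon>"
      then have z: "\<bar>x - z\<bar> < \<epsilon>" by (simp add: dist_real_def)
      then have zab: "a < z" "z < b" using e by linarith+
      show "z \<in> ?S"
      proof (cases "x \<le> z")
        case True
        then have "south_east V l r d u z h" unfolding south_east_def using v e z by (intro bexI[OF _ v(1)]) linarith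
        then show ?thesis using zab by simp
      next
        case False
        then have "south_east V l r d u z h" unfolding south_east_def using w e z by (intro bexI[OF _ w(1)]) linarith
        then show ?thesis using zab by simp
      qed
    qed
    ultimately show "\<exists>e>0. ball x e \<subseteq> ?S" by blast
  qed
  moreover have "open ?N"
    unfolding open_contains_ball
  proof (intro ballI)
    fix x assume "x \<in> ?N"
    then have x: "a < x" "x < b" "\<not> south_east V l r d u x h" "\<not> south_west V l r d u x h" using eq by auto
    obtain \<epsilon>1 where e1: "\<epsilon>1 > 0" and g1: "\<And>a b. 0 < a \<Longrightarrow> a < \<epsilon>1 \<Longrightarrow> 0 < b \<Longrightarrow> b < \<epsilon>1 \<Longrightarrow> \<not> (\<exists>v\<in>V. in_box l r d u v (x + a) (h - b))"
      by (rule not_south_east_gap[OF fin x(3)]) (rule that)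
    obtain \<epsilon>2 where e2: "\<epsilon>2 > 0" and g2: "\<And>a b. 0 < a \<Longrightarrow> a < \<epsilon>2 \<Longrightarrow> 0 < b \<Longrightarrow> b < \<epsilon>2 \<Longrightarrow> \<not> (\<exists>v\<in>V. in_box l r d u v (x - a) (h - b))"
      by (rule not_south_west_gap[OF fin x(4)]) (rule that)
    define \<epsilon> where "\<epsilon> = Min {x - a, b - x, \<epsilon>1, \<epsilon>2}"
    have e: "\<epsilon> \<le> x - a" "\<epsilon> \<le> b - x" "\<epsilon> \<le> \<epsilon>1" "\<epsilon> \<le> \<epsilon>2" unfolding \<epsilon>_def by (rule Min_le; simp)+
    have "\<epsilon> > 0" unfolding \<epsilon>_def using x e1 e2 by simp
    moreover have "ball x \<epsilon> \<subseteq> ?N"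
    proof
      fix z assume "z \<in> ball x \<epsilon>"
      then have z: "\<bar>x - z\<bar> < \<epsilon>" by (simp add: dist_real_def)
      then have zab: "a < z" "z < b" using e by linarith+
      have "\<not> south_east V l r d u z h"
      proof
        assume se: "south_east V l r d u z h"
        then obtain v where v: "v \<in> V" "l v \<le> z" "z < r v" "d v < h" "h \<le> u v" unfolding south_east_def by blast
        have zx: "z \<noteq> x" using se x by blast
        define q where "q = min \<epsilon> (h - d v) / 2"
        have q: "0 < q" "q < \<epsilon>" "q < h - d v" using \<open>\<epsilon> > 0\<close> v unfolding q_def by (auto simp: min_def)
        have i: "in_box l r d u v z (h - q)" unfolding in_box_def using v q by auto
        show False
        proof (cases "x < z")
          case True
          have "in_box l r d u v (x + (z - x)) (h - q)" using i by simp
          then show False using g1[of "z - x" q] True z q e v(1) by auto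
        next
          case False
          have "in_box l r d u v (x - (x - z)) (h - q)" using i by simp
          then show False using g2[of "x - z" q] False zx z q e v(1) by auto
        qed
      qed
      then show "z \<in> ?N" using zab by simp
    qed
    ultimately show "\<exists>e>0. ball x e \<subseteq> ?N" by blast
  qed
  moreover have "connected {a<..<b}" by simp
  moreover have "{a<..<b} \<subseteq> ?S \<union> ?N" by auto
  moreover have "?S \<inter> ?N \<inter> {a<..<b} = {}" by auto
  moreover have "x0 \<in> ?S \<inter> {a<..<b}" using x0 eq by auto
  ultimately have "?N \<inter> {a<..<b} = {}" by (metis (no_types, lifting) connectedD empty_iff)
  then have "south_east V l r d u x h" using x by auto
  then show ?thesis using eq[OF x] by blast
qed

text \<open>With \<open>h'\<close> the highest lower side below \<open>h\<close>, every box that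
  extends below height \<open>h\<close> and reaches it extends down to \<open>h'\<close>. Taking
  \<open>h'\<close> among the values of \<open>d\<close> keeps the later choice of a maximal
  rectangle finite.\<close>

lemma below_side_extend:
  assumes fin: "finite V" and ab: "a < b"
    and south: "\<And>x. a < x \<Longrightarrow> x < b \<Longrightarrow> south_west V l r d u x h"
  obtains h' where "h' \<in> d ` V" "h' < h" "\<And>x y. a \<le> x \<Longrightarrow> x \<le> b \<Longrightarrow> h' \<le> y \<Longrightarrow> y < h \<Longrightarrow> covered V l r d u x y"
proof -
  let ?D = "{d v |v. v \<in> V \<and> d v < h}"
  have finD: "finite ?D" using fin by simp
  obtain v where "v \<in> V" "d v < h"
    using south[of "(a + b) / 2"] ab unfolding south_west_def by auto
  then have ne: "?D \<noteq> {}" by blast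
  define h' where "h' = Max ?D"
  have h': "h' \<in> ?D" unfolding h'_def using finD ne by (rule Max_in)
  have inner: "covered V l r d u x y" if x: "a < x" "x < b" and y: "h' \<le> y" "y \<le> h" for x y
  proof -
    obtain v where v: "v \<in> V" "l v < x" "x \<le> r v" "d v < h" "h \<le> u v"
      using south[OF x] unfolding south_west_def by blast
    have "d v \<le> h'" unfolding h'_def using finD v by (intro Max_ge) auto
    then show ?thesis unfolding covered_def in_box_def using v y by (intro bexI[OF _ v(1)]) auto
  qed
  show ?thesis
  proof (rule that)
    show "h' \<in> d ` V" "h' < h" using h' by auto
    fix x y assume x: "a \<le> x" "x \<le> b" and y: "h' \<le> y" "y < h"
    consider "x = a" | "x = b" | "a < x" "x < b" using x by linarith
    then show "covered V l r d u x y"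
    proof cases
      case 1 then show ?thesis using covered_closed_ends(1)[OF fin ab y inner] by simp
    next
      case 2 then show ?thesis using covered_closed_ends(2)[OF fin ab y inner] by simp
    next
      case 3 then show ?thesis using inner y by simp
    qed
  qed
qed

section \<open>Extending a covered rectangle across one of its sides\<close>

lemma side_below:
  assumes fin: "finite V" and ab: "a < b"
    and north: "\<And>x. a < x \<Longrightarrow> x < b \<Longrightarrow> north_east V l r d u x h \<and> north_west V l r d u x h"
    and no3: "\<And>x. a < x \<Longrightarrow> x < b \<Longrightarrow> three_quadrants V l r d u x h \<Longrightarrow> full V l r d u x h"
    and x0: "a < x0" "x0 < b" "south_east V l r d u x0 h \<or> south_west V l r d u x0 h"
  obtains h' where "h' \<in> d ` V" "h' < h" "\<And>x y. a \<le> x \<Longrightarrow> x \<le> b \<Longrightarrow> h' \<le> y \<Longrightarrow> y < h \<Longrightarrow> covered V l r d u x y"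
proof (rule below_side_extend[OF fin ab])
  show "south_west V l r d u x h" if "a < x" "x < b" for x
    using below_side_constant[OF fin north no3 x0 that] by simp
qed (rule that)

lemma side_above:
  assumes fin: "finite V" and ab: "a < b"
    and south: "\<And>x. a < x \<Longrightarrow> x < b \<Longrightarrow> south_east V l r d u x h \<and> south_west V l r d u x h"
    and no3: "\<And>x. a < x \<Longrightarrow> x < b \<Longrightarrow> three_quadrants V l r d u x h \<Longrightarrow> full V l r d u x h"
    and x0: "a < x0" "x0 < b" "north_east V l r d u x0 h \<or> north_west V l r d u x0 h"
  obtains h' where "h' \<in> u ` V" "h < h'" "\<And>x y. a \<le> x \<Longrightarrow> x \<le> b \<Longrightarrow> h < y \<Longrightarrow> y \<le> h' \<Longrightarrow> covered V l r d u x y"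
proof -
  obtain k where k: "k \<in> (\<lambda>v. - u v) ` V" "k < - h"
    and c: "\<And>x y. a \<le> x \<Longrightarrow> x \<le> b \<Longrightarrow> k \<le> y \<Longrightarrow> y < - h \<Longrightarrow> covered V l r (\<lambda>v. - u v) (\<lambda>v. - d v) x y"
  proof (rule side_below[OF fin ab])
    show "north_east V l r (\<lambda>v. - u v) (\<lambda>v. - d v) x (- h) \<and> north_west V l r (\<lambda>v. - u v) (\<lambda>v. - d v) x (- h)"
      if "a < x" "x < b" for x
      using south[OF that] unfolding quadrants_flip_y by simp
    show "full V l r (\<lambda>v. - u v) (\<lambda>v. - d v) x (- h)"
      if "a < x" "x < b" "three_quadrants V l r (\<lambda>v. - u v) (\<lambda>v. - d v) x (- h)" for x
      using no3[OF that(1,2)] that(3) full_flip[of V l r d u x h] unfolding three_quadrants_flip_y by simp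
    show "south_east V l r (\<lambda>v. - u v) (\<lambda>v. - d v) x0 (- h) \<or> south_west V l r (\<lambda>v. - u v) (\<lambda>v. - d v) x0 (- h)"
      using x0(3) unfolding quadrants_flip_y by simp
  qed (rule x0(1), rule x0(2), rule that)
  show ?thesis
  proof (rule that)
    show "- k \<in> u ` V" "h < - k" using k by auto
    show "covered V l r d u x y" if "a \<le> x" "x \<le> b" "h < y" "y \<le> - k" for x y
      using c[of x "- y"] that unfolding covered_flip_y by simp
  qed
qed

lemma side_left:
  assumes fin: "finite V" and ab: "a < b"
    and east: "\<And>y. a < y \<Longrightarrow> y < b \<Longrightarrow> north_east V l r d u h y \<and> south_east V l r d u h y"
    and no3: "\<And>y. a < y \<Longrightarrow> y < b \<Longrightarrow> three_quadrants V l r d u h y \<Longrightarrow> full V l r d u h y"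
    and y0: "a < y0" "y0 < b" "north_west V l r d u h y0 \<or> south_west V l r d u h y0"
  obtains h' where "h' \<in> l ` V" "h' < h" "\<And>x y. h' \<le> x \<Longrightarrow> x < h \<Longrightarrow> a \<le> y \<Longrightarrow> y \<le> b \<Longrightarrow> covered V l r d u x y"
proof -
  note t = quadrants_transpose[of V d u l r _ h] three_quadrants_transpose[of V d u l r _ h]
  obtain k where k: "k \<in> l ` V" "k < h"
    and c: "\<And>x y. a \<le> x \<Longrightarrow> x \<le> b \<Longrightarrow> k \<le> y \<Longrightarrow> y < h \<Longrightarrow> covered V d u l r x y"
  proof (rule side_below[OF fin ab])
    show "north_east V d u l r x h \<and> north_west V d u l r x h" if "a < x" "x < b" for x
      using east[OF that] unfolding t by simp
    show "full V d u l r x h" if "a < x" "x < b" "three_quadrants V d u l r x h" for x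
      using no3[OF that(1,2)] that(3) full_transpose[of V l r d u h x] unfolding t by simp
    show "south_east V d u l r y0 h \<or> south_west V d u l r y0 h"
      using y0(3) unfolding t .
  qed (rule y0(1), rule y0(2), rule that)
  show ?thesis
  proof (rule that[OF k])
    show "covered V l r d u x y" if "k \<le> x" "x < h" "a \<le> y" "y \<le> b" for x y
      using c[OF that(3,4,1,2)] unfolding covered_transpose[of V d u l r] .
  qed
qed

lemma side_right:
  assumes fin: "finite V" and ab: "a < b"
    and west: "\<And>y. a < y \<Longrightarrow> y < b \<Longrightarrow> north_west V l r d u h y \<and> south_west V l r d u h y"
    and no3: "\<And>y. a < y \<Longrightarrow> y < b \<Longrightarrow> three_quadrants V l r d u h y \<Longrightarrow> full V l r d u h y"
    and y0: "a < y0" "y0 < b" "north_east V l r d u h y0 \<or> south_east V l r d u h y0"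
  obtains h' where "h' \<in> r ` V" "h < h'" "\<And>x y. h < x \<Longrightarrow> x \<le> h' \<Longrightarrow> a \<le> y \<Longrightarrow> y \<le> b \<Longrightarrow> covered V l r d u x y"
proof -
  note t = quadrants_transpose[of V d u l r _ h] three_quadrants_transpose[of V d u l r _ h]
  obtain k where k: "k \<in> r ` V" "h < k"
    and c: "\<And>x y. a \<le> x \<Longrightarrow> x \<le> b \<Longrightarrow> h < y \<Longrightarrow> y \<le> k \<Longrightarrow> covered V d u l r x y"
  proof (rule side_above[OF fin ab])
    show "south_east V d u l r x h \<and> south_west V d u l r x h" if "a < x" "x < b" for x
      using west[OF that] unfolding t by simp
    show "full V d u l r x h" if "a < x" "x < b" "three_quadrants V d u l r x h" for x
      using no3[OF that(1,2)] that(3) full_transpose[of V l r d u h x] unfolding t by simp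
    show "north_east V d u l r y0 h \<or> north_west V d u l r y0 h"
      using y0(3) unfolding t .
  qed (rule y0(1), rule y0(2), rule that)
  show ?thesis
  proof (rule that[OF k])
    show "covered V l r d u x y" if "h < x" "x \<le> k" "a \<le> y" "y \<le> b" for x y
      using c[OF that(3,4,1,2)] unfolding covered_transpose[of V d u l r] .
  qed
qed

lemma rect_quadrants:
  assumes fin: "finite V" and c: "\<And>x y. a \<le> x \<Longrightarrow> x \<le> b \<Longrightarrow> c \<le> y \<Longrightarrow> y \<le> e \<Longrightarrow> covered V l r d u x y"
  shows "\<lbrakk>a \<le> x; x < b; c \<le> y; y < e\<rbrakk> \<Longrightarrow> north_east V l r d u x y"
    and "\<lbrakk>a < x; x \<le> b; c \<le> y; y < e\<rbrakk> \<Longrightarrow> north_west V l r d u x y"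
    and "\<lbrakk>a < x; x \<le> b; c < y; y \<le> e\<rbrakk> \<Longrightarrow> south_west V l r d u x y"
    and "\<lbrakk>a \<le> x; x < b; c < y; y \<le> e\<rbrakk> \<Longrightarrow> south_east V l r d u x y"
proof -
  show "north_east V l r d u x y" if xy: "a \<le> x" "x < b" "c \<le> y" "y < e"
  proof (rule ccontr)
    assume n: "\<not> ?thesis"
    show False
    proof (rule not_north_east_gap[OF fin n])
      fix \<epsilon> :: real assume e: "\<epsilon> > 0"
        and g: "\<And>a b. 0 < a \<Longrightarrow> a < \<epsilon> \<Longrightarrow> 0 < b \<Longrightarrow> b < \<epsilon> \<Longrightarrow> \<not> (\<exists>v\<in>V. in_box l r d u v (x + a) (y + b))"
      have pos: "0 < b - x" "0 < e - y" using xy by simp_all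
      obtain s where s: "0 < s" "s < \<epsilon>" "s < b - x" using field_lbound_gt_zero[OF e pos(1)] by blast
      obtain t where t: "0 < t" "t < \<epsilon>" "t < e - y" using field_lbound_gt_zero[OF e pos(2)] by blast
      have "covered V l r d u (x + s) (y + t)" by (rule c) (use s t xy in linarith)+
      then show False using g[OF s(1,2) t(1,2)] unfolding covered_def by blast
    qed
  qed
  show "north_west V l r d u x y" if xy: "a < x" "x \<le> b" "c \<le> y" "y < e"
  proof (rule ccontr)
    assume n: "\<not> ?thesis"
    show False
    proof (rule not_north_west_gap[OF fin n])
      fix \<epsilon> :: real assume e: "\<epsilon> > 0"
        and g: "\<And>a b. 0 < a \<Longrightarrow> a < \<epsilon> \<Longrightarrow> 0 < b \<Longrightarrow> b < \<epsilon> \<Longrightarrow> \<not> (\<exists>v\<in>V. in_box l r d u v (x - a) (y + b))"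
      have pos: "0 < x - a" "0 < e - y" using xy by simp_all
      obtain s where s: "0 < s" "s < \<epsilon>" "s < x - a" using field_lbound_gt_zero[OF e pos(1)] by blast
      obtain t where t: "0 < t" "t < \<epsilon>" "t < e - y" using field_lbound_gt_zero[OF e pos(2)] by blast
      have "covered V l r d u (x - s) (y + t)" by (rule c) (use s t xy in linarith)+
      then show False using g[OF s(1,2) t(1,2)] unfolding covered_def by blast
    qed
  qed
  show "south_west V l r d u x y" if xy: "a < x" "x \<le> b" "c < y" "y \<le> e"
  proof (rule ccontr)
    assume n: "\<not> ?thesis"
    show False
    proof (rule not_south_west_gap[OF fin n])
      fix \<epsilon> :: real assume e: "\<epsilon> > 0"
        and g: "\<And>a b. 0 < a \<Longrightarrow> a < \<epsilon> \<Longrightarrow> 0 < b \<Longrightarrow> b < \<epsilon> \<Longrightarrow> \<not> (\<exists>v\<in>V. in_box l r d u v (x - a) (y - b))"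
      have pos: "0 < x - a" "0 < y - c" using xy by simp_all
      obtain s where s: "0 < s" "s < \<epsilon>" "s < x - a" using field_lbound_gt_zero[OF e pos(1)] by blast
      obtain t where t: "0 < t" "t < \<epsilon>" "t < y - c" using field_lbound_gt_zero[OF e pos(2)] by blast
      have "covered V l r d u (x - s) (y - t)" by (rule c) (use s t xy in linarith)+
      then show False using g[OF s(1,2) t(1,2)] unfolding covered_def by blast
    qed
  qed
  show "south_east V l r d u x y" if xy: "a \<le> x" "x < b" "c < y" "y \<le> e"
  proof (rule ccontr)
    assume n: "\<not> ?thesis"
    show False
    proof (rule not_south_east_gap[OF fin n])
      fix \<epsilon> :: real assume e: "\<epsilon> > 0"
        and g: "\<And>a b. 0 < a \<Longrightarrow> a < \<epsilon> \<Longrightarrow> 0 < b \<Longrightarrow> b < \<epsilon> \<Longrightarrow> \<not> (\<exists>v\<in>V. in_box l r d u v (x + a) (y - b))"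
      have pos: "0 < b - x" "0 < y - c" using xy by simp_all
      obtain s where s: "0 < s" "s < \<epsilon>" "s < b - x" using field_lbound_gt_zero[OF e pos(1)] by blast
      obtain t where t: "0 < t" "t < \<epsilon>" "t < y - c" using field_lbound_gt_zero[OF e pos(2)] by blast
      have "covered V l r d u (x + s) (y - t)" by (rule c) (use s t xy in linarith)+
      then show False using g[OF s(1,2) t(1,2)] unfolding covered_def by blast
    qed
  qed
qed

lemma full_nearby:
  assumes fin: "finite V" and f: "full V l r d u x y"
  obtains \<epsilon> where "\<epsilon> > 0" "\<And>x' y'. \<bar>x' - x\<bar> < \<epsilon> \<Longrightarrow> \<bar>y' - y\<bar> < \<epsilon> \<Longrightarrow> full V l r d u x' y'"
proof -
  obtain \<epsilon> where e: "\<epsilon> > 0" and c: "\<And>x' y'. \<bar>x' - x\<bar> < \<epsilon> \<Longrightarrow> \<bar>y' - y\<bar> < \<epsilon> \<Longrightarrow> covered V l r d u x' y'"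
    using f unfolding full_iff_neighbourhood[OF fin] by metis
  show ?thesis
  proof (rule that[of "\<epsilon> / 2"])
    fix x' y' assume *: "\<bar>x' - x\<bar> < \<epsilon> / 2" "\<bar>y' - y\<bar> < \<epsilon> / 2"
    have "covered V l r d u x'' y''" if "\<bar>x'' - x'\<bar> < \<epsilon> / 2" "\<bar>y'' - y'\<bar> < \<epsilon> / 2" for x'' y''
      by (rule c) (use that * in linarith)+
    then show "full V l r d u x' y'"
      unfolding full_iff_neighbourhood[OF fin] using e by (intro exI[of _ "\<epsilon> / 2"]) simp
  qed (use e in simp)
qed

lemma near_interior_point:
  fixes lo hi y \<epsilon> :: real
  assumes "lo < hi" "lo \<le> y" "y \<le> hi" "\<epsilon> > 0"
  obtains y' where "lo < y'" "y' < hi" "\<bar>y' - y\<bar> < \<epsilon>"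
proof -
  define \<delta> where "\<delta> = min \<epsilon> (hi - lo) / 4"
  have \<delta>: "0 < \<delta>" "\<delta> < \<epsilon>" "\<delta> < (hi - lo) / 2" using assms unfolding \<delta>_def by (auto simp: min_def)
  show ?thesis
  proof (cases "y \<le> (lo + hi) / 2")
    case True
    have "y + \<delta> < hi" using True \<delta>(3) by (simp add: field_simps)
    then show ?thesis using \<delta> assms by (intro that[of "y + \<delta>"]) auto
  next
    case False
    have "lo < y - \<delta>" using False \<delta>(3) by (simp add: field_simps)
    then show ?thesis using \<delta> assms by (intro that[of "y - \<delta>"]) auto
  qed
qed

lemma finite_has_max_real:
  fixes f :: "'a \<Rightarrow> real"
  assumes "finite S" "S \<noteq> {}"
  obtains m where "m \<in> S" "\<And>x. x \<in> S \<Longrightarrow> f x \<le> f m"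
proof -
  have "Max (f ` S) \<in> f ` S" using assms by (intro Max_in) auto
  then obtain m where "m \<in> S" "f m = Max (f ` S)" by auto
  then show ?thesis using assms(1) by (intro that[of m]) auto
qed

text \<open>A covered rectangle of maximal area with its top at height \<open>py\<close> and with
  \<open>px\<close> strictly between its vertical sides is prolonged upwards, left of
  \<open>px\<close>, to a maximal height \<open>H\<close>. By maximality the region does not
  continue across an outer side of the resulting L, nor does it enter the missing quadrant across
  the two inner walls. A connected interior then cannot leave the L.\<close>

theorem L_shape:
  assumes B: "boxes V l r d u"
    and p: "\<not> north_east V l r d u px py" "north_west V l r d u px py" "south_west V l r d u px py"
      "south_east V l r d u px py"
    and uniq: "\<And>x y. three_quadrants V l r d u x y \<Longrightarrow> full V l r d u x y \<or> (x = px \<and> y = py)"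
    and con: "connected {z. full V l r d u (fst z) (snd z)}"
  obtains X0 X1 Y0 Y1 where "L_plan V l r d u X0 px X1 Y0 py Y1"
proof -
  let ?c = "covered V l r d u"
  have fin: "finite V" using B unfolding boxes_def by blast
  define S where "S = {(a, b, c). a \<in> l ` V \<and> b \<in> r ` V \<and> c \<in> d ` V \<and> a < px \<and> px < b \<and> c < py \<and>
    (\<forall>x y. a \<le> x \<and> x \<le> b \<and> c \<le> y \<and> y \<le> py \<longrightarrow> ?c x y)}"
  have "S \<subseteq> l ` V \<times> r ` V \<times> d ` V" unfolding S_def by auto
  then have finS: "finite S" using fin by (meson finite_SigmaI finite_imageI finite_subset)
  obtain vB where vB: "vB \<in> V" "l vB < px" "px \<le> r vB" "d vB < py" "py \<le> u vB" using p(3) unfolding south_west_def by blast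
  obtain vC where vC: "vC \<in> V" "l vC \<le> px" "px < r vC" "d vC < py" "py \<le> u vC" using p(4) unfolding south_east_def by blast
  have "?c x y" if "l vB \<le> x" "x \<le> r vC" "max (d vB) (d vC) \<le> y" "y \<le> py" for x y
  proof (cases "x \<le> px")
    case True
    then have "in_box l r d u vB x y" using that vB unfolding in_box_def by auto
    then show ?thesis unfolding covered_def using vB(1) by blast
  next
    case False
    then have "in_box l r d u vC x y" using that vC unfolding in_box_def by auto
    then show ?thesis unfolding covered_def using vC(1) by blast
  qed
  moreover have "max (d vB) (d vC) \<in> d ` V" using vB(1) vC(1) by (auto simp: max_def)
  ultimately have "(l vB, r vC, max (d vB) (d vC)) \<in> S" unfolding S_def using vB vC by simp
  then have neS: "S \<noteq> {}" by blast
  obtain m where m: "m \<in> S" and mmax: "\<And>s. s \<in> S \<Longrightarrow> (\<lambda>(a, b, c). (b - a) * (py - c)) s \<le> (\<lambda>(a, b, c). (b - a) * (py - c)) m"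
    by (rule finite_has_max_real[OF finS neS, of "\<lambda>(a, b, c). (b - a) * (py - c)"]) (rule that)
  obtain a b c where abc: "m = (a, b, c)" by (cases m)
  have mem: "a \<in> l ` V" "b \<in> r ` V" "c \<in> d ` V" and ord: "a < px" "px < b" "c < py"
    and R1: "\<And>x y. a \<le> x \<Longrightarrow> x \<le> b \<Longrightarrow> c \<le> y \<Longrightarrow> y \<le> py \<Longrightarrow> ?c x y"
    using m unfolding abc S_def by auto
  have maxi: "(b' - a') * (py - c') \<le> (b - a) * (py - c)" if "(a', b', c') \<in> S" for a' b' c'
    using mmax[OF that] unfolding abc by simp
  note q1 = rect_quadrants[OF fin R1]
  have no3: "full V l r d u x y" if "three_quadrants V l r d u x y" "x \<noteq> px \<or> y \<noteq> py" for x y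
    using uniq[OF that(1)] that(2) by blast
  have bottom: "\<not> south_east V l r d u x c \<and> \<not> south_west V l r d u x c" if x: "a < x" "x < b" for x
  proof (rule ccontr)
    assume "\<not> ?thesis"
    then have s: "south_east V l r d u x c \<or> south_west V l r d u x c" by blast
    show False
    proof (rule side_below[OF fin _ _ _ x s])
      fix h' assume h': "h' \<in> d ` V" "h' < c" and cv: "\<And>x y. a \<le> x \<Longrightarrow> x \<le> b \<Longrightarrow> h' \<le> y \<Longrightarrow> y < c \<Longrightarrow> ?c x y"
      have "?c x y" if "a \<le> x" "x \<le> b" "h' \<le> y" "y \<le> py" for x y
        using cv[OF that(1-3)] R1[OF that(1,2) _ that(4)] by (cases "y < c") auto
      then have "(a, b, h') \<in> S" unfolding S_def using mem ord h' by simp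
      then have "(b - a) * (py - h') \<le> (b - a) * (py - c)" by (rule maxi)
      then show False using ord h'(2) by simp
    qed (use ord q1 no3 in auto)
  qed
  obtain vA where vA: "vA \<in> V" "l vA < px" "px \<le> r vA" "d vA \<le> py" "py < u vA" using p(2) unfolding north_west_def by blast
  \<comment> \<open>A position between \<open>a\<close> and \<open>px\<close> above which the
    north-west module at the corner lies, so that the region does continue upwards from
    there.\<close>
  define xA where "xA = (max (l vA) a + px) / 2"
  have xA: "a < xA" "xA < px" "l vA < xA" using vA ord unfolding xA_def by (auto simp: max_def)
  then have nwA: "north_east V l r d u xA py \<or> north_west V l r d u xA py"
    unfolding north_west_def using vA by (intro disjI2 bexI[OF _ vA(1)]) simp
  obtain H0 where H0: "H0 \<in> u ` V" "py < H0" and H0c: "\<And>x y. a \<le> x \<Longrightarrow> x \<le> px \<Longrightarrow> py < y \<Longrightarrow> y \<le> H0 \<Longrightarrow> ?c x y"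
    by (rule side_above[OF fin ord(1) _ _ xA(1,2) nwA]) (use ord q1 no3 in \<open>auto intro: that\<close>)
  define U where "U = {h \<in> u ` V. py < h \<and> (\<forall>x y. a \<le> x \<and> x \<le> px \<and> py \<le> y \<and> y \<le> h \<longrightarrow> ?c x y)}"
  have finU: "finite U" unfolding U_def using fin by simp
  have "H0 \<in> U"
  proof -
    have "?c x y" if "a \<le> x" "x \<le> px" "py \<le> y" "y \<le> H0" for x y
      using H0c[OF that(1,2) _ that(4)] R1[of x y] that ord by (cases "y = py") auto
    then show ?thesis unfolding U_def using H0 by simp
  qed
  then have neU: "U \<noteq> {}" by blast
  obtain H where H: "H \<in> U" and Hmax: "\<And>h. h \<in> U \<Longrightarrow> h \<le> H"
    by (rule finite_has_max_real[OF finU neU, of "\<lambda>x. x"]) (rule that)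
  have H1: "py < H" and R2: "\<And>x y. a \<le> x \<Longrightarrow> x \<le> px \<Longrightarrow> py \<le> y \<Longrightarrow> y \<le> H \<Longrightarrow> ?c x y"
    using H unfolding U_def by auto
  note q2 = rect_quadrants[OF fin R2]
  have R3: "?c x y" if "a \<le> x" "x \<le> px" "c \<le> y" "y \<le> H" for x y
    using R1[of x y] R2[of x y] that ord by (cases "y \<le> py") auto
  note q3 = rect_quadrants[OF fin R3]
  have top: "\<not> north_east V l r d u x H \<and> \<not> north_west V l r d u x H" if x: "a < x" "x < px" for x
  proof (rule ccontr)
    assume "\<not> ?thesis"
    then have s: "north_east V l r d u x H \<or> north_west V l r d u x H" by blast
    show False
    proof (rule side_above[OF fin _ _ _ x s])
      fix h' assume h': "h' \<in> u ` V" "H < h'" and cv: "\<And>x y. a \<le> x \<Longrightarrow> x \<le> px \<Longrightarrow> H < y \<Longrightarrow> y \<le> h' \<Longrightarrow> ?c x y"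
      have "?c x y" if "a \<le> x" "x \<le> px" "py \<le> y" "y \<le> h'" for x y
        using cv[OF that(1,2) _ that(4)] R2[OF that(1-3)] by (cases "H < y") auto
      then have "h' \<in> U" unfolding U_def using h' H1 by simp
      then show False using Hmax h'(2) by fastforce
    qed (use ord H1 q2 no3 in auto)
  qed
  \<comment> \<open>An extension to the left happens along the whole height of the L; its lower part
    would enlarge the maximal rectangle.\<close>
  have left: "\<not> north_west V l r d u a y \<and> \<not> south_west V l r d u a y" if y: "c < y" "y < H" for y
  proof (rule ccontr)
    assume "\<not> ?thesis"
    then have s: "north_west V l r d u a y \<or> south_west V l r d u a y" by blast
    show False
    proof (rule side_left[OF fin _ _ _ y s])
      fix h' assume h': "h' \<in> l ` V" "h' < a" and cv: "\<And>x y. h' \<le> x \<Longrightarrow> x < a \<Longrightarrow> c \<le> y \<Longrightarrow> y \<le> H \<Longrightarrow> ?c x y"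
      have "?c x y" if "h' \<le> x" "x \<le> b" "c \<le> y" "y \<le> py" for x y
        using cv[OF that(1) _ that(3)] R1[OF _ that(2-4)] that(4) H1 by (cases "x < a") auto
      then have "(h', b, c) \<in> S" unfolding S_def using mem ord h' by simp
      then have "(b - h') * (py - c) \<le> (b - a) * (py - c)" by (rule maxi)
      then show False using ord h'(2) by simp
    qed (use ord H1 q3 no3 in auto)
  qed
  have right: "\<not> north_east V l r d u b y \<and> \<not> south_east V l r d u b y" if y: "c < y" "y < py" for y
  proof (rule ccontr)
    assume "\<not> ?thesis"
    then have s: "north_east V l r d u b y \<or> south_east V l r d u b y" by blast
    show False
    proof (rule side_right[OF fin _ _ _ y s])
      fix h' assume h': "h' \<in> r ` V" "b < h'" and cv: "\<And>x y. b < x \<Longrightarrow> x \<le> h' \<Longrightarrow> c \<le> y \<Longrightarrow> y \<le> py \<Longrightarrow> ?c x y"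
      have "?c x y" if "a \<le> x" "x \<le> h'" "c \<le> y" "y \<le> py" for x y
        using cv[OF _ that(2-4)] R1[OF that(1) _ that(3,4)] by (cases "b < x") auto
      then have "(a, h', c) \<in> S" unfolding S_def using mem ord h' by simp
      then have "(h' - a) * (py - c) \<le> (b - a) * (py - c)" by (rule maxi)
      then show False using ord h'(2) by simp
    qed (use ord q1 no3 in auto)
  qed
  have gap: False if "e1 > 0" "e2 > 0" "\<And>x y. px < x \<Longrightarrow> x \<le> px + e1 \<Longrightarrow> py < y \<Longrightarrow> y \<le> py + e2 \<Longrightarrow> ?c x y" for e1 e2
  proof (rule not_north_east_gap[OF fin p(1)])
    fix \<epsilon> :: real assume e: "\<epsilon> > 0"
      and g: "\<And>a b. 0 < a \<Longrightarrow> a < \<epsilon> \<Longrightarrow> 0 < b \<Longrightarrow> b < \<epsilon> \<Longrightarrow> \<not> (\<exists>v\<in>V. in_box l r d u v (px + a) (py + b))"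
    define q where "q = min \<epsilon> (min e1 e2) / 2"
    have q: "0 < q" "q < \<epsilon>" "q \<le> e1" "q \<le> e2" using e that(1,2) unfolding q_def by (auto simp: min_def)
    show False using g[OF q(1,2) q(1,2)] that(3)[of "px + q" "py + q"] q unfolding covered_def by auto
  qed
  \<comment> \<open>If the region continued above the lower inner wall anywhere, it would do so
    along all of it and thus cover the missing quadrant next to the concave corner.\<close>
  have innerh: "\<not> north_east V l r d u x py \<and> \<not> north_west V l r d u x py" if x: "px < x" "x < b" for x
  proof (rule ccontr)
    assume "\<not> ?thesis"
    then have s: "north_east V l r d u x py \<or> north_west V l r d u x py" by blast
    show False
    proof (rule side_above[OF fin _ _ _ x s])
      fix h' assume h': "py < h'" and cv: "\<And>x y. px \<le> x \<Longrightarrow> x \<le> b \<Longrightarrow> py < y \<Longrightarrow> y \<le> h' \<Longrightarrow> ?c x y"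
      show False by (rule gap[of "b - px" "h' - py"]) (use h' cv ord in auto)
    qed (use ord q1 no3 in auto)
  qed
  have innerv: "\<not> north_east V l r d u px y \<and> \<not> south_east V l r d u px y" if y: "py < y" "y < H" for y
  proof (rule ccontr)
    assume "\<not> ?thesis"
    then have s: "north_east V l r d u px y \<or> south_east V l r d u px y" by blast
    show False
    proof (rule side_right[OF fin _ _ _ y s])
      fix h' assume h': "px < h'" and cv: "\<And>x y. px < x \<Longrightarrow> x \<le> h' \<Longrightarrow> py \<le> y \<Longrightarrow> y \<le> H \<Longrightarrow> ?c x y"
      show False by (rule gap[of "h' - px" "H - py"]) (use h' cv H1 in auto)
    qed (use ord H1 q2 no3 in auto)
  qed
  let ?F = "{z. full V l r d u (fst z) (snd z)}"
  \<comment> \<open>\<open>?A\<close> is the open L and \<open>?B\<close> the complement of the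
    closed one. It remains to see that no interior point of the region lies on the boundary of the
    L.\<close>
  let ?A = "{z :: real \<times> real. a < fst z \<and> fst z < b \<and> c < snd z \<and> snd z < H \<and> (fst z < px \<or> snd z < py)}"
  let ?B = "{z :: real \<times> real. fst z < a \<or> b < fst z \<or> snd z < c \<or> H < snd z \<or> (px < fst z \<and> py < snd z)}"
  have oA: "open ?A" "open ?B"
    by (intro open_Collect_conj open_Collect_disj open_Collect_less continuous_intros)+
  have FAB: "?F \<subseteq> ?A \<union> ?B"
  proof
    fix z assume "z \<in> ?F"
    then have f: "full V l r d u (fst z) (snd z)" by simp
    obtain x y where z: "z = (x, y)" by (cases z)
    have f: "full V l r d u x y" using f z by simp
    obtain \<epsilon> where e: "\<epsilon> > 0" and near: "\<And>x' y'. \<bar>x' - x\<bar> < \<epsilon> \<Longrightarrow> \<bar>y' - y\<bar> < \<epsilon> \<Longrightarrow> full V l r d u x' y'"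
      by (rule full_nearby[OF fin f]) (rule that)
    have nx: "full V l r d u x' y" if "\<bar>x' - x\<bar> < \<epsilon>" for x' using near[OF that] e by simp
    have ny: "full V l r d u x y'" if "\<bar>y' - y\<bar> < \<epsilon>" for y' using near[OF _ that] e by simp
    show "z \<in> ?A \<union> ?B"
    proof (rule ccontr)
      assume n: "z \<notin> ?A \<union> ?B"
      then have in_L: "a \<le> x" "x \<le> b" "c \<le> y" "y \<le> H" "x \<le> px \<or> y \<le> py" using z by auto
      have "x = a \<or> x = b \<or> y = c \<or> y = H \<or> (px \<le> x \<and> py \<le> y)" using n z in_L by auto
      \<comment> \<open>The point may be an end of a side, where nothing was proved. A nearby point
        strictly between the ends is still \<open>full\<close> and gives the contradiction.\<close>
      then consider "x = a" | "x = b" "y \<le> py" | "y = c" | "y = H" "x \<le> px" | "x = px" "py \<le> y" | "y = py" "px \<le> x"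
        using in_L ord H1 by linarith
      then show False
      proof cases
        case 1
        obtain y' where "c < y'" "y' < H" "\<bar>y' - y\<bar> < \<epsilon>"
          by (rule near_interior_point[of c H y \<epsilon>]) (use ord H1 in_L e that in auto)
        then show False using ny left 1 unfolding full_def by blast
      next
        case 2
        obtain y' where "c < y'" "y' < py" "\<bar>y' - y\<bar> < \<epsilon>"
          by (rule near_interior_point[of c py y \<epsilon>]) (use ord in_L e 2 that in auto)
        then show False using ny right 2 unfolding full_def by blast
      next
        case 3
        obtain x' where "a < x'" "x' < b" "\<bar>x' - x\<bar> < \<epsilon>"
          by (rule near_interior_point[of a b x \<epsilon>]) (use ord in_L e that in auto)
        then show False using nx bottom 3 unfolding full_def by blast
      next
        case 4
        obtain x' where "a < x'" "x' < px" "\<bar>x' - x\<bar> < \<epsilon>"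
          by (rule near_interior_point[of a px x \<epsilon>]) (use ord in_L e 4 that in auto)
        then show False using nx top 4 unfolding full_def by blast
      next
        case 5
        obtain y' where "py < y'" "y' < H" "\<bar>y' - y\<bar> < \<epsilon>"
          by (rule near_interior_point[of py H y \<epsilon>]) (use H1 in_L e 5 that in auto)
        then show False using ny innerv 5 unfolding full_def by blast
      next
        case 6
        obtain x' where "px < x'" "x' < b" "\<bar>x' - x\<bar> < \<epsilon>"
          by (rule near_interior_point[of px b x \<epsilon>]) (use ord in_L e 6 that in auto)
        then show False using nx innerh 6 unfolding full_def by blast
      qed
    qed
  qed
  define z0 where "z0 = ((a + px) / 2, (c + py) / 2)"
  have z0A: "z0 \<in> ?A" unfolding z0_def using ord H1 by auto
  have z0F: "z0 \<in> ?F" unfolding z0_def full_def using q1 ord by simp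
  have "?A \<inter> ?B \<inter> ?F = {}" using ord H1 by auto
  then have "?B \<inter> ?F = {}"
    using connectedD[OF con oA _ FAB] z0A z0F by blast
  then have FA: "?F \<subseteq> ?A" using FAB by blast
  have box_in: "a \<le> l v \<and> r v \<le> b \<and> c \<le> d v \<and> u v \<le> H \<and> (r v \<le> px \<or> u v \<le> py)" if v: "v \<in> V" for v
  proof -
    note pr = boxes_proper[OF B v]
    have inA: "a < x \<and> x < b \<and> c < y \<and> y < H \<and> (x < px \<or> y < py)" if "l v < x" "x < r v" "d v < y" "y < u v" for x y
    proof -
      have "full V l r d u x y"
        unfolding full_def north_east_def north_west_def south_west_def south_east_def
        by (intro conjI; rule bexI[OF _ v]; use that in simp)
      then have "(x, y) \<in> ?F" by simp
      then have "(x, y) \<in> ?A" using FA by blast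
      then show ?thesis by simp
    qed
    define xm ym where "xm = (l v + r v) / 2" and "ym = (d v + u v) / 2"
    have m: "l v < xm" "xm < r v" "d v < ym" "ym < u v" using pr unfolding xm_def ym_def by auto
    have xs: "a < x" "x < b" if "l v < x" "x < r v" for x using inA[OF that m(3,4)] by simp_all
    have ys: "c < y" "y < H" if "d v < y" "y < u v" for y using inA[OF m(1,2) that] by simp_all
    have "a \<le> l v" by (rule dense_ge_bounded[OF m(1)]) (use xs m in force)
    moreover have "r v \<le> b"
    proof (rule dense_le_bounded[OF m(2)])
      fix w assume "xm < w" "w < r v" then show "w \<le> b" using xs(2)[of w] m(1) by linarith
    qed
    moreover have "c \<le> d v" by (rule dense_ge_bounded[OF m(3)]) (use ys m in force)
    moreover have "u v \<le> H"
    proof (rule dense_le_bounded[OF m(4)])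
      fix w assume "ym < w" "w < u v" then show "w \<le> H" using ys(2)[of w] m(3) by linarith
    qed
    moreover have "r v \<le> px \<or> u v \<le> py"
    proof (rule ccontr)
      assume "\<not> ?thesis"
      then have "max px (l v) < r v" "max py (d v) < u v" using pr by simp_all
      then obtain x y where "max px (l v) < x" "x < r v" "max py (d v) < y" "y < u v"
        using dense by meson
      then show False using inA[of x y] by simp
    qed
    ultimately show ?thesis by blast
  qed
  show ?thesis
  proof (rule that, unfold_locales)
    show "boxes V l r d u" by (rule B)
    show "a < px" "px < b" "c < py" "py < H" using ord H1 by auto
    show "(\<exists>v\<in>V. in_box l r d u v x y) \<longleftrightarrow> a \<le> x \<and> x \<le> b \<and> c \<le> y \<and> y \<le> H \<and> (x \<le> px \<or> y \<le> py)" for x y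
    proof
      assume "\<exists>v\<in>V. in_box l r d u v x y"
      then obtain v where v: "v \<in> V" "in_box l r d u v x y" by blast
      show "a \<le> x \<and> x \<le> b \<and> c \<le> y \<and> y \<le> H \<and> (x \<le> px \<or> y \<le> py)"
        using box_in[OF v(1)] v(2) unfolding in_box_def by auto
    next
      assume *: "a \<le> x \<and> x \<le> b \<and> c \<le> y \<and> y \<le> H \<and> (x \<le> px \<or> y \<le> py)"
      then have "?c x y" using R1[of x y] R3[of x y] by (cases "y \<le> py") auto
      then show "\<exists>v\<in>V. in_box l r d u v x y" unfolding covered_def .
    qed
  qed
qed

section \<open>Boxes in the complex plane\<close>

definition rect :: "'v coord \<Rightarrow> 'v coord \<Rightarrow> 'v coord \<Rightarrow> 'v coord \<Rightarrow> 'v \<Rightarrow> complex set" where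
  "rect l r d u v = cbox (Complex (l v) (d v)) (Complex (r v) (u v))"

lemma mem_rect: "z \<in> rect l r d u v \<longleftrightarrow> in_box l r d u v (Re z) (Im z)"
  unfolding rect_def in_box_def by (auto simp: in_cbox_complex_iff)

lemma mem_interior_rect:
  "z \<in> interior (rect l r d u v) \<longleftrightarrow> l v < Re z \<and> Re z < r v \<and> d v < Im z \<and> Im z < u v"
  unfolding rect_def interior_cbox by (auto simp: in_box_complex_iff)

lemma mem_frontier_rect:
  "z \<in> frontier (rect l r d u v) \<longleftrightarrow>
     in_box l r d u v (Re z) (Im z) \<and> \<not> (l v < Re z \<and> Re z < r v \<and> d v < Im z \<and> Im z < u v)"
proof -
  have cl: "closure (rect l r d u v) = rect l r d u v" unfolding rect_def by simp
  show ?thesis unfolding frontier_def cl Diff_iff mem_rect mem_interior_rect ..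
qed

lemma rect_eqD:
  assumes "rect l r d u v = cbox a b" "l v < r v" "d v < u v"
  shows "a = Complex (l v) (d v)" "b = Complex (r v) (u v)"
proof -
  have ne: "cbox (Complex (l v) (d v)) (Complex (r v) (u v)) \<noteq> {}"
    using assms(2,3) by (auto simp: box_ne_empty Basis_complex_def)
  have "cbox (Complex (l v) (d v)) (Complex (r v) (u v)) = cbox a b" using assms(1) unfolding rect_def .
  then show "a = Complex (l v) (d v)" "b = Complex (r v) (u v)" using ne eq_cbox[of _ _ a b] by auto
qed

lemma rect_interiors_disjoint:
  assumes B: "boxes V l r d u" and V: "v \<in> V" "w \<in> V" "v \<noteq> w"
  shows "interior (rect l r d u v) \<inter> interior (rect l r d u w) = {}"
  using boxes_disjoint[OF B V] mem_interior_rect[of _ l r d u] by fastforce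

lemma rect_inj:
  assumes B: "boxes V l r d u" and V: "v \<in> V" "w \<in> V" and eq: "rect l r d u v = rect l r d u w"
  shows "v = w"
proof (rule ccontr)
  assume ne: "v \<noteq> w"
  have "Complex ((l v + r v) / 2) ((d v + u v) / 2) \<in> interior (rect l r d u v)"
    unfolding mem_interior_rect using boxes_proper[OF B V(1)] by simp
  then show False using rect_interiors_disjoint[OF B V ne] unfolding eq by blast
qed

text \<open>The segment is not assumed to be axis-parallel. But its ends lie in both boxes and
  differ in some coordinate, where the boxes therefore overlap properly; disjointness then forces a
  common side in the other coordinate.\<close>

lemma adjacent_rects:
  assumes B: "boxes V l r d u" and V: "v \<in> V" "w \<in> V"
  shows "adjacent_modules (rect l r d u v) (rect l r d u w) \<longleftrightarrow> meets l r d u v w"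
proof
  assume "adjacent_modules (rect l r d u v) (rect l r d u w)"
  then obtain p q where ne: "rect l r d u v \<noteq> rect l r d u w" and pq: "p \<noteq> q"
    and sub: "closed_segment p q \<subseteq> frontier (rect l r d u v) \<inter> frontier (rect l r d u w)"
    unfolding adjacent_modules_def by blast
  have vw: "v \<noteq> w" using ne by blast
  have "p \<in> frontier (rect l r d u v) \<inter> frontier (rect l r d u w)" by (rule subsetD[OF sub]) simp
  moreover have "q \<in> frontier (rect l r d u v) \<inter> frontier (rect l r d u w)" by (rule subsetD[OF sub]) simp
  ultimately have i: "in_box l r d u v (Re p) (Im p)" "in_box l r d u v (Re q) (Im q)"
    "in_box l r d u w (Re p) (Im p)" "in_box l r d u w (Re q) (Im q)"
    unfolding Int_iff mem_frontier_rect by metis+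
  have d: "Re p \<noteq> Re q \<or> Im p \<noteq> Im q" using pq complex_eqI by blast
  show "meets l r d u v w"
    using boxes_disjoint[OF B V vw] i d vw unfolding in_box_def meets_def max_less_iff_conj min_less_iff_conj
    by (smt (verit))
next
  assume m: "meets l r d u v w"
  have vw: "v \<noteq> w" using m unfolding meets_def by blast
  then have ne: "rect l r d u v \<noteq> rect l r d u w" using rect_inj[OF B V] by blast
  define x1 x2 y1 y2 where "x1 = max (l v) (l w)" and "x2 = min (r v) (r w)"
    and "y1 = max (d v) (d w)" and "y2 = min (u v) (u w)"
  note p = boxes_proper[OF B V(1)] boxes_proper[OF B V(2)]
  consider "r v = l w \<or> r w = l v" "y1 < y2" | "u v = d w \<or> u w = d v" "x1 < x2"
    using m unfolding meets_def x1_def x2_def y1_def y2_def by blast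
  then show "adjacent_modules (rect l r d u v) (rect l r d u w)"
  proof cases
    case 1
    have x: "x1 = x2" using 1(1) p unfolding x1_def x2_def by (auto simp: max_def min_def)
    have "closed_segment (Complex x1 y1) (Complex x1 y2) \<subseteq> frontier (rect l r d u v) \<inter> frontier (rect l r d u w)"
    proof
      fix z assume "z \<in> closed_segment (Complex x1 y1) (Complex x1 y2)"
      then have "Re z = x1" "y1 \<le> Im z" "Im z \<le> y2"
        using 1(2) by (auto simp: closed_segment_same_Re closed_segment_eq_real_ivl)
      then show "z \<in> frontier (rect l r d u v) \<inter> frontier (rect l r d u w)"
        using 1 p x unfolding Int_iff mem_frontier_rect in_box_def x1_def x2_def y1_def y2_def by auto
    qed
    moreover have "Complex x1 y1 \<noteq> Complex x1 y2" using 1(2) by simp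
    ultimately show ?thesis unfolding adjacent_modules_def using ne by blast
  next
    case 2
    have y: "y1 = y2" using 2(1) p unfolding y1_def y2_def by (auto simp: max_def min_def)
    have "closed_segment (Complex x1 y1) (Complex x2 y1) \<subseteq> frontier (rect l r d u v) \<inter> frontier (rect l r d u w)"
    proof
      fix z assume "z \<in> closed_segment (Complex x1 y1) (Complex x2 y1)"
      then have "Im z = y1" "x1 \<le> Re z" "Re z \<le> x2"
        using 2(2) by (auto simp: closed_segment_same_Im closed_segment_eq_real_ivl)
      then show "z \<in> frontier (rect l r d u v) \<inter> frontier (rect l r d u w)"
        using 2 p y unfolding Int_iff mem_frontier_rect in_box_def x1_def x2_def y1_def y2_def by auto
    qed
    moreover have "Complex x1 y1 \<noteq> Complex x2 y1" using 2(2) by simp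
    ultimately show ?thesis unfolding adjacent_modules_def using ne by blast
  qed
qed

lemma mem_Union_rect: "z \<in> \<Union> (rect l r d u ` V) \<longleftrightarrow> covered V l r d u (Re z) (Im z)"
  unfolding covered_def by (auto simp: mem_rect)

lemma mem_interior_Union_rect:
  assumes "finite V"
  shows "z \<in> interior (\<Union> (rect l r d u ` V)) \<longleftrightarrow> full V l r d u (Re z) (Im z)"
proof
  assume "z \<in> interior (\<Union> (rect l r d u ` V))"
  then obtain \<epsilon> where e: "\<epsilon> > 0" "ball z \<epsilon> \<subseteq> \<Union> (rect l r d u ` V)" unfolding mem_interior by blast
  have "covered V l r d u x y" if "\<bar>x - Re z\<bar> < \<epsilon> / 2" "\<bar>y - Im z\<bar> < \<epsilon> / 2" for x y
  proof -
    have "cmod (Complex x y - z) \<le> \<bar>Re (Complex x y - z)\<bar> + \<bar>Im (Complex x y - z)\<bar>" by (rule cmod_le)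
    then have "Complex x y \<in> ball z \<epsilon>" using that by (simp add: dist_norm norm_minus_commute)
    then have "Complex x y \<in> \<Union> (rect l r d u ` V)" using e(2) by blast
    then show ?thesis unfolding mem_Union_rect by simp
  qed
  then show "full V l r d u (Re z) (Im z)"
    unfolding full_iff_neighbourhood[OF assms] using e(1) by (intro exI[of _ "\<epsilon> / 2"]) simp
next
  assume "full V l r d u (Re z) (Im z)"
  then obtain \<epsilon> where e: "\<epsilon> > 0" and c: "\<And>x y. \<bar>x - Re z\<bar> < \<epsilon> \<Longrightarrow> \<bar>y - Im z\<bar> < \<epsilon> \<Longrightarrow> covered V l r d u x y"
    unfolding full_iff_neighbourhood[OF assms] by metis
  have "ball z \<epsilon> \<subseteq> \<Union> (rect l r d u ` V)"
  proof
    fix w assume "w \<in> ball z \<epsilon>"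
    then have n: "cmod (w - z) < \<epsilon>" by (simp add: dist_norm norm_minus_commute)
    have "\<bar>Re w - Re z\<bar> < \<epsilon>" "\<bar>Im w - Im z\<bar> < \<epsilon>"
      using abs_Re_le_cmod[of "w - z"] abs_Im_le_cmod[of "w - z"] n by auto
    then show "w \<in> \<Union> (rect l r d u ` V)" unfolding mem_Union_rect by (rule c)
  qed
  then show "z \<in> interior (\<Union> (rect l r d u ` V))" unfolding mem_interior using e by blast
qed

text \<open>By the Jordan curve theorem the interior of the polygon is the inside of its boundary
  curve.\<close>

lemma connected_interior_rectilinear:
  assumes "rectilinear_polygon P"
  shows "connected (interior P)"
proof -
  obtain g where g: "simple_path g" "pathfinish g = pathstart g" "P = path_image g \<union> inside (path_image g)"
    using assms unfolding rectilinear_polygon_def by metis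
  note J = Jordan_inside_outside[OF g(1,2)]
  have "- P = outside (path_image g)" unfolding g(3) union_with_inside by simp
  then have "closure (- P) = outside (path_image g) \<union> path_image g"
    using J unfolding closure_Un_frontier by metis
  then have "interior P = inside (path_image g)"
    unfolding interior_closure using J inside_Un_outside[of "path_image g"] by blast
  then show ?thesis using J by simp
qed

lemma rectangle_rectilinear:
  assumes "rectangle R"
  shows "rectilinear_polygon R"
proof -
  obtain a b where ab: "Re a < Re b" "Im a < Im b" "R = cbox a b"
    using assms unfolding rectangle_def by blast
  let ?c = "Complex (Re b) (Im a)" and ?d = "Complex (Re a) (Im b)"
  let ?S = "{closed_segment a ?c, closed_segment ?c b, closed_segment b ?d, closed_segment ?d a}"
  have pi: "path_image (rectpath a b) = cbox a b - box a b"
    using ab by (intro path_image_rectpath_cbox_minus_box) auto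
  have "path_image (rectpath a b) = \<Union>?S"
    unfolding rectpath_def Let_def by (auto simp: path_image_join)
  moreover have "R = path_image (rectpath a b) \<union> inside (path_image (rectpath a b))"
  proof -
    have "frontier (cbox a b) = path_image (rectpath a b)" unfolding pi by (simp add: frontier_cbox)
    then have "inside (path_image (rectpath a b)) = box a b"
      using inside_frontier_eq_interior[of "cbox a b"] by (simp add: bounded_cbox)
    then show ?thesis unfolding pi ab(3) using box_subset_cbox by blast
  qed
  moreover have "simple_path (rectpath a b)" using ab by (intro simple_path_rectpath) auto
  moreover have "\<forall>s\<in>?S. \<exists>p q. s = closed_segment p q \<and> (Re p = Re q \<or> Im p = Im q)"
  proof
    fix s assume "s \<in> ?S"
    then consider "s = closed_segment a ?c" | "s = closed_segment ?c b" | "s = closed_segment b ?d" | "s = closed_segment ?d a"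
      by blast
    then show "\<exists>p q. s = closed_segment p q \<and> (Re p = Re q \<or> Im p = Im q)"
      by cases (auto intro!: exI)
  qed
  moreover have "finite ?S" by simp
  moreover have "pathfinish (rectpath a b) = pathstart (rectpath a b)" by simp
  ultimately show ?thesis unfolding rectilinear_polygon_def by blast
qed

text \<open>Coordinate form of a deformation that refutes \<open>nontrivial\<close>: the new boxes
  fill a rectangle with the same adjacencies, and a side moves only if none of its points is
  interior to the region.\<close>

definition wall_shift :: "'v set \<Rightarrow> 'v coord \<Rightarrow> 'v coord \<Rightarrow> 'v coord \<Rightarrow> 'v coord \<Rightarrow>
    'v coord \<Rightarrow> 'v coord \<Rightarrow> 'v coord \<Rightarrow> 'v coord \<Rightarrow> real \<Rightarrow> real \<Rightarrow> real \<Rightarrow> real \<Rightarrow> bool" where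
  "wall_shift V l r d u l' r' d' u' A0 A1 B0 B1 \<longleftrightarrow>
     boxes V l r d u \<and> boxes V l' r' d' u' \<and> A0 < A1 \<and> B0 < B1 \<and>
     (\<forall>x y. covered V l' r' d' u' x y \<longleftrightarrow> A0 \<le> x \<and> x \<le> A1 \<and> B0 \<le> y \<and> y \<le> B1) \<and>
     (\<forall>v\<in>V. \<forall>w\<in>V. meets l' r' d' u' v w \<longleftrightarrow> meets l r d u v w) \<and>
     (\<forall>v\<in>V. l' v \<noteq> l v \<longrightarrow> (\<forall>y. d v \<le> y \<and> y \<le> u v \<longrightarrow> \<not> full V l r d u (l v) y)) \<and>
     (\<forall>v\<in>V. r' v \<noteq> r v \<longrightarrow> (\<forall>y. d v \<le> y \<and> y \<le> u v \<longrightarrow> \<not> full V l r d u (r v) y)) \<and>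
     (\<forall>v\<in>V. d' v \<noteq> d v \<longrightarrow> (\<forall>x. l v \<le> x \<and> x \<le> r v \<longrightarrow> \<not> full V l r d u x (d v))) \<and>
     (\<forall>v\<in>V. u' v \<noteq> u v \<longrightarrow> (\<forall>x. l v \<le> x \<and> x \<le> r v \<longrightarrow> \<not> full V l r d u x (u v)))"

lemma wall_shift_trivial:
  assumes shift: "wall_shift V l r d u l' r' d' u' A0 A1 B0 B1"
  shows "\<not> nontrivial (rect l r d u ` V)"
proof -
  note shift = shift[unfolded wall_shift_def]
  have B: "boxes V l r d u" and B': "boxes V l' r' d' u'" and A: "A0 < A1" "B0 < B1"
    and cover: "\<And>x y. covered V l' r' d' u' x y \<longleftrightarrow> A0 \<le> x \<and> x \<le> A1 \<and> B0 \<le> y \<and> y \<le> B1"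
    and m: "\<And>v w. v \<in> V \<Longrightarrow> w \<in> V \<Longrightarrow> meets l' r' d' u' v w \<longleftrightarrow> meets l r d u v w"
    using shift by simp_all
  have sl: "\<And>v y. v \<in> V \<Longrightarrow> l' v \<noteq> l v \<Longrightarrow> d v \<le> y \<Longrightarrow> y \<le> u v \<Longrightarrow> \<not> full V l r d u (l v) y"
    and sr: "\<And>v y. v \<in> V \<Longrightarrow> r' v \<noteq> r v \<Longrightarrow> d v \<le> y \<Longrightarrow> y \<le> u v \<Longrightarrow> \<not> full V l r d u (r v) y"
    and sd: "\<And>v x. v \<in> V \<Longrightarrow> d' v \<noteq> d v \<Longrightarrow> l v \<le> x \<Longrightarrow> x \<le> r v \<Longrightarrow> \<not> full V l r d u x (d v)"
    and su: "\<And>v x. v \<in> V \<Longrightarrow> u' v \<noteq> u v \<Longrightarrow> l v \<le> x \<Longrightarrow> x \<le> r v \<Longrightarrow> \<not> full V l r d u x (u v)"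
    using shift by simp_all
  let ?F = "rect l r d u ` V"
  have fin: "finite V" using B unfolding boxes_def by blast
  have inj: "inj_on (rect l r d u) V" using rect_inj[OF B] by (auto simp: inj_on_def)
  \<comment> \<open>Deformations act on point sets, so a module is traced back to its vertex before
    the new coordinates are applied.\<close>
  define \<sigma> where "\<sigma> M = rect l' r' d' u' (the_inv_into V (rect l r d u) M)" for M
  have \<sigma>: "\<sigma> (rect l r d u v) = rect l' r' d' u' v" if "v \<in> V" for v
    unfolding \<sigma>_def by (simp add: the_inv_into_f_f[OF inj that])
  have img: "\<sigma> ` ?F = rect l' r' d' u' ` V" using \<sigma> by (auto simp: image_iff)
  have fr: "z \<in> frontier (\<Union>?F)" if "z \<in> rect l r d u v" "v \<in> V" "\<not> full V l r d u (Re z) (Im z)" for z v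
  proof -
    have "z \<in> \<Union>?F" using that by blast
    then have "z \<in> closure (\<Union>?F)" by (rule subsetD[OF closure_subset])
    moreover have "z \<notin> interior (\<Union>?F)" unfolding mem_interior_Union_rect[OF fin] by (rule that(3))
    ultimately show ?thesis unfolding frontier_def by (rule DiffI)
  qed
  have "outer_wall_deformation ?F \<sigma>"
    unfolding outer_wall_deformation_def
  proof (intro allI impI)
    fix a b assume *: "Re a < Re b \<and> Im a < Im b \<and> cbox a b \<in> ?F"
    then obtain v where v: "v \<in> V" "rect l r d u v = cbox a b" by auto
    note p = boxes_proper[OF B v(1)] and p' = boxes_proper[OF B' v(1)]
    have ab: "a = Complex (l v) (d v)" "b = Complex (r v) (u v)" using rect_eqD[OF v(2)] p by auto
    have side: "z \<in> frontier (\<Union>?F)" if "z \<in> cbox a b" "\<not> full V l r d u (Re z) (Im z)" for z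
      using fr[of z v] that v by simp
    have mz: "l v \<le> Re z" "Re z \<le> r v" "d v \<le> Im z" "Im z \<le> u v" if "z \<in> cbox a b" for z
      using that unfolding v(2)[symmetric] mem_rect in_box_def by auto
    show "\<exists>a' b'. Re a' < Re b' \<and> Im a' < Im b' \<and> \<sigma> (cbox a b) = cbox a' b' \<and>
          (Re a' = Re a \<or> {z \<in> cbox a b. Re z = Re a} \<subseteq> frontier (\<Union>?F)) \<and>
          (Re b' = Re b \<or> {z \<in> cbox a b. Re z = Re b} \<subseteq> frontier (\<Union>?F)) \<and>
          (Im a' = Im a \<or> {z \<in> cbox a b. Im z = Im a} \<subseteq> frontier (\<Union>?F)) \<and>
          (Im b' = Im b \<or> {z \<in> cbox a b. Im z = Im b} \<subseteq> frontier (\<Union>?F))"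
    proof (rule exI[of _ "Complex (l' v) (d' v)"], rule exI[of _ "Complex (r' v) (u' v)"], intro conjI)
      show "\<sigma> (cbox a b) = cbox (Complex (l' v) (d' v)) (Complex (r' v) (u' v))"
        using \<sigma>[OF v(1)] v(2) unfolding rect_def by simp
      show "Re (Complex (l' v) (d' v)) = Re a \<or> {z \<in> cbox a b. Re z = Re a} \<subseteq> frontier (\<Union>?F)"
        using sl[OF v(1)] side mz unfolding ab by fastforce
      show "Re (Complex (r' v) (u' v)) = Re b \<or> {z \<in> cbox a b. Re z = Re b} \<subseteq> frontier (\<Union>?F)"
        using sr[OF v(1)] side mz unfolding ab by fastforce
      show "Im (Complex (l' v) (d' v)) = Im a \<or> {z \<in> cbox a b. Im z = Im a} \<subseteq> frontier (\<Union>?F)"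
        using sd[OF v(1)] side mz unfolding ab by fastforce
      show "Im (Complex (r' v) (u' v)) = Im b \<or> {z \<in> cbox a b. Im z = Im b} \<subseteq> frontier (\<Union>?F)"
        using su[OF v(1)] side mz unfolding ab by fastforce
    qed (use p' in auto)
  qed
  moreover have "inj_on \<sigma> ?F"
    using \<sigma> rect_inj[OF B'] by (auto simp: inj_on_def)
  moreover have "rectangular_floor_plan (\<sigma> ` ?F)"
  proof -
    have U: "\<Union> (rect l' r' d' u' ` V) = cbox (Complex A0 B0) (Complex A1 B1)"
      by (rule set_eqI, unfold mem_Union_rect cover in_cbox_complex_iff) auto
    have rU: "rectangle (\<Union> (rect l' r' d' u' ` V))"
      unfolding U rectangle_def by (rule exI[of _ "Complex A0 B0"], rule exI[of _ "Complex A1 B1"]) (simp add: A)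
    have rM: "rectangle (rect l' r' d' u' v)" if "v \<in> V" for v
      unfolding rect_def rectangle_def
      by (rule exI[of _ "Complex (l' v) (d' v)"], rule exI[of _ "Complex (r' v) (u' v)"]) (simp add: boxes_proper[OF B' that])
    have "pairwise (\<lambda>M N. interior M \<inter> interior N = {}) (rect l' r' d' u' ` V)"
      unfolding pairwise_def using rect_interiors_disjoint[OF B'] by blast
    then show ?thesis
      unfolding img rectangular_floor_plan_def floor_plan_def
      using fin rU rM rectangle_rectilinear by blast
  qed
  moreover have "adjacent_modules (\<sigma> M) (\<sigma> N) \<longleftrightarrow> adjacent_modules M N" if MN: "M \<in> ?F" "N \<in> ?F" for M N
  proof -
    obtain v w where vw: "v \<in> V" "w \<in> V" "M = rect l r d u v" "N = rect l r d u w" using MN by blast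
    show ?thesis
      unfolding vw(3,4) \<sigma>[OF vw(1)] \<sigma>[OF vw(2)] adjacent_rects[OF B vw(1,2)] adjacent_rects[OF B' vw(1,2)]
      by (rule m[OF vw(1,2)])
  qed
  ultimately show ?thesis unfolding nontrivial_def by blast
qed

lemma wall_shift_transpose:
  assumes "wall_shift V l r d u l' r' d' u' A0 A1 B0 B1"
  shows "wall_shift V d u l r d' u' l' r' B0 B1 A0 A1"
proof -
  note h = assms[unfolded wall_shift_def]
  have B: "boxes V d u l r" "boxes V d' u' l' r'"
    using h boxes_transpose[of V l r d u] boxes_transpose[of V l' r' d' u'] by simp_all
  have M: "meets d' u' l' r' v w \<longleftrightarrow> meets d u l r v w" if "v \<in> V" "w \<in> V" for v w
    using h that unfolding meets_transpose[of d' u' l' r'] meets_transpose[of d u l r] by simp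
  have C: "covered V d' u' l' r' x y \<longleftrightarrow> B0 \<le> x \<and> x \<le> B1 \<and> A0 \<le> y \<and> y \<le> A1" for x y
    using h unfolding covered_transpose[of V d' u' l' r'] by auto
  show ?thesis
    unfolding wall_shift_def full_transpose[of V d u l r] using h B M C by simp
qed

lemma wall_shift_flip_y:
  assumes "wall_shift V l r d u l' r' d' u' A0 A1 B0 B1"
  shows "wall_shift V l r (\<lambda>v. - u v) (\<lambda>v. - d v) l' r' (\<lambda>v. - u' v) (\<lambda>v. - d' v) A0 A1 (- B1) (- B0)"
proof -
  note h = assms[unfolded wall_shift_def]
  have f: "full V l r (\<lambda>v. - u v) (\<lambda>v. - d v) x y \<longleftrightarrow> full V l r d u x (- y)" for x y
    using full_flip[of V l r d u x "- y"] by simp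
  have B: "boxes V l r (\<lambda>v. - u v) (\<lambda>v. - d v)" "boxes V l' r' (\<lambda>v. - u' v) (\<lambda>v. - d' v)"
    using h boxes_flip[of V l r d u] boxes_flip[of V l' r' d' u'] by simp_all
  have M: "meets l' r' (\<lambda>v. - u' v) (\<lambda>v. - d' v) v w \<longleftrightarrow> meets l r (\<lambda>v. - u v) (\<lambda>v. - d v) v w"
    if "v \<in> V" "w \<in> V" for v w
    using h that unfolding meets_flip[of l r d u, symmetric] meets_flip[of l' r' d' u', symmetric] by simp
  have C: "covered V l' r' (\<lambda>v. - u' v) (\<lambda>v. - d' v) x y \<longleftrightarrow> A0 \<le> x \<and> x \<le> A1 \<and> - B1 \<le> y \<and> y \<le> - B0" for x y
    using h unfolding covered_flip_y by auto
  have S: "\<And>v y. v \<in> V \<Longrightarrow> l' v \<noteq> l v \<Longrightarrow> - u v \<le> y \<Longrightarrow> y \<le> - d v \<Longrightarrow> \<not> full V l r d u (l v) (- y)"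
    "\<And>v y. v \<in> V \<Longrightarrow> r' v \<noteq> r v \<Longrightarrow> - u v \<le> y \<Longrightarrow> y \<le> - d v \<Longrightarrow> \<not> full V l r d u (r v) (- y)"
    using h by (simp_all add: minus_le_iff le_minus_iff)
  show ?thesis
    unfolding wall_shift_def f using h B M C S by simp
qed

section \<open>Concave corners and reflection of the axes\<close>

lemma concave_north_east:
  assumes fin: "finite V" and q: "\<not> north_east V l r d u x y" "north_west V l r d u x y" "south_west V l r d u x y"
    "south_east V l r d u x y"
  shows "\<exists>\<epsilon>>0. \<forall>x' y'. \<bar>x' - x\<bar> < \<epsilon> \<and> \<bar>y' - y\<bar> < \<epsilon> \<longrightarrow> (covered V l r d u x' y' \<longleftrightarrow> \<not> (x < x' \<and> y < y'))"
proof -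
  obtain \<epsilon>0 where e0: "\<epsilon>0 > 0" and g: "\<And>a b. 0 < a \<Longrightarrow> a < \<epsilon>0 \<Longrightarrow> 0 < b \<Longrightarrow> b < \<epsilon>0 \<Longrightarrow> \<not> (\<exists>v\<in>V. in_box l r d u v (x + a) (y + b))"
    by (rule not_north_east_gap[OF fin q(1)]) (rule that)
  obtain v2 where v2: "v2 \<in> V" "l v2 < x" "x \<le> r v2" "d v2 \<le> y" "y < u v2"
    using q(2) unfolding north_west_def by blast
  obtain v3 where v3: "v3 \<in> V" "l v3 < x" "x \<le> r v3" "d v3 < y" "y \<le> u v3"
    using q(3) unfolding south_west_def by blast
  obtain v4 where v4: "v4 \<in> V" "l v4 \<le> x" "x < r v4" "d v4 < y" "y \<le> u v4"
    using q(4) unfolding south_east_def by blast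
  define \<epsilon> where "\<epsilon> = Min {\<epsilon>0, x - l v2, u v2 - y, x - l v3, y - d v3, r v4 - x, y - d v4}"
  have "\<epsilon> > 0" unfolding \<epsilon>_def by (subst Min_gr_iff) (use e0 v2 v3 v4 in auto)
  moreover have "covered V l r d u x' y' \<longleftrightarrow> \<not> (x < x' \<and> y < y')" if "\<bar>x' - x\<bar> < \<epsilon>" "\<bar>y' - y\<bar> < \<epsilon>" for x' y'
  proof -
    have e: "\<epsilon> \<le> \<epsilon>0" "\<epsilon> \<le> x - l v2" "\<epsilon> \<le> u v2 - y" "\<epsilon> \<le> x - l v3" "\<epsilon> \<le> y - d v3" "\<epsilon> \<le> r v4 - x" "\<epsilon> \<le> y - d v4"
      unfolding \<epsilon>_def by (rule Min_le; simp)+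
    consider "x < x'" "y < y'" | "x' \<le> x" "y \<le> y'" | "x' \<le> x" "y' \<le> y" | "x \<le> x'" "y' \<le> y" by linarith
    then show ?thesis
    proof cases
      case 1
      have "\<not> (\<exists>v\<in>V. in_box l r d u v (x + (x' - x)) (y + (y' - y)))" by (rule g) (use 1 that e in linarith)+
      then show ?thesis using 1 unfolding covered_def by simp
    next
      case 2
      then have "in_box l r d u v2 x' y'" unfolding in_box_def using that v2 e by linarith
      then show ?thesis unfolding covered_def using v2(1) 2 by auto
    next
      case 3
      then have "in_box l r d u v3 x' y'" unfolding in_box_def using that v3 e by linarith
      then show ?thesis unfolding covered_def using v3(1) 3 by auto
    next
      case 4
      then have "in_box l r d u v4 x' y'" unfolding in_box_def using that v4 e by linarith
      then show ?thesis unfolding covered_def using v4(1) 4 by auto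
    qed
  qed
  ultimately show ?thesis by metis
qed

lemma north_east_concave:
  assumes fin: "finite V" and e: "\<epsilon> > 0"
    and c: "\<And>x' y'. \<bar>x' - x\<bar> < \<epsilon> \<Longrightarrow> \<bar>y' - y\<bar> < \<epsilon> \<Longrightarrow> (covered V l r d u x' y' \<longleftrightarrow> \<not> (x < x' \<and> y < y'))"
  shows "\<not> north_east V l r d u x y" "north_west V l r d u x y" "south_west V l r d u x y" "south_east V l r d u x y"
proof -
  show "\<not> north_east V l r d u x y"
  proof
    assume "north_east V l r d u x y"
    then obtain v where v: "v \<in> V" "l v \<le> x" "x < r v" "d v \<le> y" "y < u v" unfolding north_east_def by blast
    have pos: "0 < r v - x" "0 < u v - y" using v by simp_all
    obtain s where s: "0 < s" "s < \<epsilon>" "s < r v - x" using field_lbound_gt_zero[OF e pos(1)] by blast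
    obtain t where t: "0 < t" "t < \<epsilon>" "t < u v - y" using field_lbound_gt_zero[OF e pos(2)] by blast
    have "in_box l r d u v (x + s) (y + t)" unfolding in_box_def using v s t by linarith
    then have "covered V l r d u (x + s) (y + t)" unfolding covered_def using v(1) by blast
    then show False using c[of "x + s" "y + t"] s t by simp
  qed
  have cov: "\<exists>v\<in>V. in_box l r d u v x' y'" if "\<bar>x' - x\<bar> < \<epsilon>" "\<bar>y' - y\<bar> < \<epsilon>" "x' \<le> x \<or> y' \<le> y" for x' y'
    using c[OF that(1,2)] that(3) unfolding covered_def by auto
  show "north_west V l r d u x y"
  proof (rule ccontr)
    assume n: "\<not> ?thesis"
    show False
    proof (rule not_north_west_gap[OF fin n])
      fix \<delta> :: real assume "\<delta> > 0" and g: "\<And>a b. 0 < a \<Longrightarrow> a < \<delta> \<Longrightarrow> 0 < b \<Longrightarrow> b < \<delta> \<Longrightarrow> \<not> (\<exists>v\<in>V. in_box l r d u v (x - a) (y + b))"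
      then obtain s where s: "0 < s" "s < \<epsilon>" "s < \<delta>" using field_lbound_gt_zero[OF e, of \<delta>] by blast
      show False using g[OF s(1,3) s(1,3)] cov[of "x - s" "y + s"] s by auto
    qed
  qed
  show "south_west V l r d u x y"
  proof (rule ccontr)
    assume n: "\<not> ?thesis"
    show False
    proof (rule not_south_west_gap[OF fin n])
      fix \<delta> :: real assume "\<delta> > 0" and g: "\<And>a b. 0 < a \<Longrightarrow> a < \<delta> \<Longrightarrow> 0 < b \<Longrightarrow> b < \<delta> \<Longrightarrow> \<not> (\<exists>v\<in>V. in_box l r d u v (x - a) (y - b))"
      then obtain s where s: "0 < s" "s < \<epsilon>" "s < \<delta>" using field_lbound_gt_zero[OF e, of \<delta>] by blast
      show False using g[OF s(1,3) s(1,3)] cov[of "x - s" "y - s"] s by auto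
    qed
  qed
  show "south_east V l r d u x y"
  proof (rule ccontr)
    assume n: "\<not> ?thesis"
    show False
    proof (rule not_south_east_gap[OF fin n])
      fix \<delta> :: real assume "\<delta> > 0" and g: "\<And>a b. 0 < a \<Longrightarrow> a < \<delta> \<Longrightarrow> 0 < b \<Longrightarrow> b < \<delta> \<Longrightarrow> \<not> (\<exists>v\<in>V. in_box l r d u v (x + a) (y - b))"
      then obtain s where s: "0 < s" "s < \<epsilon>" "s < \<delta>" using field_lbound_gt_zero[OF e, of \<delta>] by blast
      show False using g[OF s(1,3) s(1,3)] cov[of "x + s" "y - s"] s by auto
    qed
  qed
qed

text \<open>Reflecting the axes by signs \<open>s, t\<close> brings the missing quadrant to the north-east.\<close>

definition lo :: "real \<Rightarrow> 'v coord \<Rightarrow> 'v coord \<Rightarrow> 'v \<Rightarrow> real" where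
  "lo s l r = (if s = 1 then l else (\<lambda>v. - r v))"

definition hi :: "real \<Rightarrow> 'v coord \<Rightarrow> 'v coord \<Rightarrow> 'v \<Rightarrow> real" where
  "hi s l r = (if s = 1 then r else (\<lambda>v. - l v))"

lemma lo_hi_involution: "lo s (lo s l r) (hi s l r) = l" "hi s (lo s l r) (hi s l r) = r"
  unfolding lo_def hi_def by auto

lemma in_box_reflect:
  assumes "s \<in> {- 1, 1}" "t \<in> {- 1, 1}"
  shows "in_box (lo s l r) (hi s l r) (lo t d u) (hi t d u) v x y \<longleftrightarrow> in_box l r d u v (s * x) (t * y)"
  using assms unfolding lo_def hi_def in_box_def by auto

lemma covered_reflect:
  assumes "s \<in> {- 1, 1}" "t \<in> {- 1, 1}"
  shows "covered V (lo s l r) (hi s l r) (lo t d u) (hi t d u) x y \<longleftrightarrow> covered V l r d u (s * x) (t * y)"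
  unfolding covered_def in_box_reflect[OF assms] ..

lemma boxes_reflect: "boxes V l r d u \<Longrightarrow> boxes V (lo s l r) (hi s l r) (lo t d u) (hi t d u)"
  unfolding boxes_def lo_def hi_def by auto

lemma meets_reflect: "meets (lo s l r) (hi s l r) (lo t d u) (hi t d u) v w \<longleftrightarrow> meets l r d u v w"
proof -
  have y: "meets l r (lo t d u) (hi t d u) v w \<longleftrightarrow> meets l r d u v w" for l r d u
    unfolding lo_def hi_def using meets_flip[of l r d u v w] by simp
  have "meets (lo s l r) (hi s l r) (lo t d u) (hi t d u) v w \<longleftrightarrow> meets (lo t d u) (hi t d u) (lo s l r) (hi s l r) v w"
    by (rule meets_transpose)
  also have "\<dots> \<longleftrightarrow> meets (lo t d u) (hi t d u) l r v w"
    unfolding lo_def[of s] hi_def[of s] using meets_flip[of "lo t d u" "hi t d u" l r v w] by simp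
  also have "\<dots> \<longleftrightarrow> meets l r (lo t d u) (hi t d u) v w" by (rule meets_transpose)
  finally show ?thesis using y by simp
qed

lemma quadrants_flip_x:
  "north_east V (\<lambda>v. - r v) (\<lambda>v. - l v) d u x y \<longleftrightarrow> north_west V l r d u (- x) y"
  "north_west V (\<lambda>v. - r v) (\<lambda>v. - l v) d u x y \<longleftrightarrow> north_east V l r d u (- x) y"
  "south_east V (\<lambda>v. - r v) (\<lambda>v. - l v) d u x y \<longleftrightarrow> south_west V l r d u (- x) y"
  "south_west V (\<lambda>v. - r v) (\<lambda>v. - l v) d u x y \<longleftrightarrow> south_east V l r d u (- x) y"
  unfolding quadrants_transpose[of V "\<lambda>v. - r v" "\<lambda>v. - l v" d u] quadrants_flip_y
  unfolding quadrants_transpose[of V d u l r] by (rule refl)+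

lemma three_quadrants_reflect:
  assumes "s \<in> {- 1, 1}" "t \<in> {- 1, 1}"
  shows "three_quadrants V (lo s l r) (hi s l r) (lo t d u) (hi t d u) x y \<longleftrightarrow> three_quadrants V l r d u (s * x) (t * y)"
proof -
  consider "s = 1" "t = 1" | "s = 1" "t = - 1" | "s = - 1" "t = 1" | "s = - 1" "t = - 1" using assms by blast
  then show ?thesis
    by cases (auto simp: lo_def hi_def three_quadrants_def quadrants_flip_x quadrants_flip_y)
qed

lemma full_reflect:
  assumes "s \<in> {- 1, 1}" "t \<in> {- 1, 1}"
  shows "full V (lo s l r) (hi s l r) (lo t d u) (hi t d u) x y \<longleftrightarrow> full V l r d u (s * x) (t * y)"
proof -
  consider "s = 1" "t = 1" | "s = 1" "t = - 1" | "s = - 1" "t = 1" | "s = - 1" "t = - 1" using assms by blast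
  then show ?thesis
    by cases (auto simp: lo_def hi_def full_def quadrants_flip_x quadrants_flip_y)
qed

lemma wall_shift_reflect:
  assumes w: "wall_shift V l r d u l' r' d' u' A0 A1 B0 B1"
  obtains A0' A1' B0' B1' where "wall_shift V (lo s l r) (hi s l r) (lo t d u) (hi t d u)
    (lo s l' r') (hi s l' r') (lo t d' u') (hi t d' u') A0' A1' B0' B1'"
proof -
  have y: "\<exists>B0' B1'. wall_shift V l r (lo t d u) (hi t d u) l' r' (lo t d' u') (hi t d' u') A0 A1 B0' B1'"
    if w: "wall_shift V l r d u l' r' d' u' A0 A1 B0 B1" for l r d u l' r' d' u' :: "'a \<Rightarrow> real" and A0 A1 B0 B1 t
  proof (cases "t = 1")
    case True
    show ?thesis
      by (rule exI[of _ B0], rule exI[of _ B1]) (simp add: True lo_def hi_def w)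
  next
    case False
    show ?thesis
      by (rule exI[of _ "- B1"], rule exI[of _ "- B0"]) (simp add: False lo_def hi_def wall_shift_flip_y[OF w])
  qed
  obtain B0' B1' where "wall_shift V l r (lo t d u) (hi t d u) l' r' (lo t d' u') (hi t d' u') A0 A1 B0' B1'"
    using y[OF w] by metis
  from y[OF wall_shift_transpose[OF this]]
  obtain A0' A1' where "wall_shift V (lo t d u) (hi t d u) (lo s l r) (hi s l r) (lo t d' u') (hi t d' u')
      (lo s l' r') (hi s l' r') B0' B1' A0' A1'"
    by metis
  then show ?thesis by (rule that[OF wall_shift_transpose])
qed

text \<open>The reflections that bring the missing quadrant to the north-east have just the signs
  that \<open>concave_corner\<close> asks for.\<close>

lemma three_quadrants_concave_corner:
  assumes fin: "finite V" and q: "three_quadrants V l r d u x y" "\<not> full V l r d u x y"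
  shows "concave_corner (\<Union> (rect l r d u ` V)) (Complex x y)"
proof -
  have main: "concave_corner (\<Union> (rect l r d u ` V)) (Complex x y)"
    if st: "s \<in> {- 1, 1}" "t \<in> {- 1, 1}"
      and q: "\<not> north_east V (lo s l r) (hi s l r) (lo t d u) (hi t d u) (s * x) (t * y)"
        "north_west V (lo s l r) (hi s l r) (lo t d u) (hi t d u) (s * x) (t * y)"
        "south_west V (lo s l r) (hi s l r) (lo t d u) (hi t d u) (s * x) (t * y)"
        "south_east V (lo s l r) (hi s l r) (lo t d u) (hi t d u) (s * x) (t * y)" for s t :: real
  proof -
    have ss: "s * s = 1" "t * t = 1" "\<bar>s\<bar> = 1" "\<bar>t\<bar> = 1" using st by auto
    obtain \<epsilon> where e: "\<epsilon> > 0" and c: "\<And>x' y'. \<bar>x' - s * x\<bar> < \<epsilon> \<Longrightarrow> \<bar>y' - t * y\<bar> < \<epsilon> \<Longrightarrow>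
        covered V l r d u (s * x') (t * y') \<longleftrightarrow> \<not> (s * x < x' \<and> t * y < y')"
      using concave_north_east[OF fin q] unfolding covered_reflect[OF st] by blast
    have "z \<in> \<Union> (rect l r d u ` V) \<longleftrightarrow> \<not> (s * (Re z - x) > 0 \<and> t * (Im z - y) > 0)" if z: "z \<in> ball (Complex x y) \<epsilon>" for z
    proof -
      have n: "cmod (z - Complex x y) < \<epsilon>" using z by (simp add: dist_norm norm_minus_commute)
      have "\<bar>s * Re z - s * x\<bar> = \<bar>Re z - x\<bar>" "\<bar>t * Im z - t * y\<bar> = \<bar>Im z - y\<bar>"
        using ss by (metis abs_mult mult_1 right_diff_distrib)+
      then have "\<bar>s * Re z - s * x\<bar> < \<epsilon>" "\<bar>t * Im z - t * y\<bar> < \<epsilon>"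
        using abs_Re_le_cmod[of "z - Complex x y"] abs_Im_le_cmod[of "z - Complex x y"] n by auto
      then have "covered V l r d u (s * (s * Re z)) (t * (t * Im z)) \<longleftrightarrow> \<not> (s * x < s * Re z \<and> t * y < t * Im z)"
        by (rule c)
      moreover have "s * (s * Re z) = Re z" "t * (t * Im z) = Im z" using ss by (simp_all flip: mult.assoc)
      ultimately show ?thesis unfolding mem_Union_rect by (simp add: right_diff_distrib)
    qed
    then show ?thesis
      unfolding concave_corner_def complex.sel using e st by blast
  qed
  consider "\<not> north_east V l r d u x y" "north_west V l r d u x y" "south_west V l r d u x y" "south_east V l r d u x y"
    | "\<not> north_west V l r d u x y" "north_east V l r d u x y" "south_west V l r d u x y" "south_east V l r d u x y"
    | "\<not> south_west V l r d u x y" "north_east V l r d u x y" "north_west V l r d u x y" "south_east V l r d u x y"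
    | "\<not> south_east V l r d u x y" "north_east V l r d u x y" "north_west V l r d u x y" "south_west V l r d u x y"
    using q unfolding three_quadrants_def full_def by argo
  then show ?thesis
  proof cases
    case 1 then show ?thesis by (intro main[of 1 1]) (simp_all add: lo_def hi_def)
  next
    case 2 then show ?thesis by (intro main[of "- 1" 1]) (simp_all add: lo_def hi_def quadrants_flip_x quadrants_flip_y)
  next
    case 3 then show ?thesis by (intro main[of "- 1" "- 1"]) (simp_all add: lo_def hi_def quadrants_flip_x quadrants_flip_y)
  next
    case 4 then show ?thesis by (intro main[of 1 "- 1"]) (simp_all add: lo_def hi_def quadrants_flip_x quadrants_flip_y)
  qed
qed

text \<open>The signs of the concave corner serve as reflections. Any other point with exactly three
  quadrants would be a second concave corner, so cardinality one yields the uniqueness that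
  \<open>L_shape\<close> requires.\<close>

lemma L_shaped_normal_form:
  assumes B: "boxes V l r d u" and F: "L_shaped_floor_plan (rect l r d u ` V)"
  obtains s t X0 px X1 Y0 py Y1 where "s \<in> {- 1, 1}" "t \<in> {- 1, 1}"
    "L_plan V (lo s l r) (hi s l r) (lo t d u) (hi t d u) X0 px X1 Y0 py Y1"
proof -
  let ?P = "\<Union> (rect l r d u ` V)"
  have fin: "finite V" using B unfolding boxes_def by blast
  have card: "card {p. concave_corner ?P p} = 1" and poly: "rectilinear_polygon ?P"
    using F unfolding L_shaped_floor_plan_def floor_plan_def by blast+
  obtain p where p: "{p. concave_corner ?P p} = {p}" using card card_1_singletonE by blast
  then have "concave_corner ?P p" by blast
  then obtain \<epsilon> s t where e: "\<epsilon> > 0" and st: "s \<in> {- 1, 1}" "t \<in> {- 1, 1}"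
    and c0: "\<forall>z\<in>ball p \<epsilon>. z \<in> ?P \<longleftrightarrow> \<not> (s * (Re z - Re p) > 0 \<and> t * (Im z - Im p) > 0)"
    unfolding concave_corner_def by (elim exE conjE bexE) (rule that)
  note c = bspec[OF c0]
  have ss: "s * s = 1" "t * t = 1" "\<bar>s\<bar> = 1" "\<bar>t\<bar> = 1" using st by auto
  have ss': "s * (s * a) = a" "t * (t * a) = a" for a using ss by (simp_all flip: mult.assoc)
  let ?l = "lo s l r" and ?r = "hi s l r" and ?d = "lo t d u" and ?u = "hi t d u"
  \<comment> \<open>Half of the radius makes the square fit into the disc, since the modulus is at
    most the sum of the absolute coordinates.\<close>
  have near: "covered V ?l ?r ?d ?u x' y' \<longleftrightarrow> \<not> (s * Re p < x' \<and> t * Im p < y')"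
    if "\<bar>x' - s * Re p\<bar> < \<epsilon> / 2" "\<bar>y' - t * Im p\<bar> < \<epsilon> / 2" for x' y'
  proof -
    let ?z = "Complex (s * x') (t * y')"
    have "\<bar>s * x' - Re p\<bar> = \<bar>x' - s * Re p\<bar>" "\<bar>t * y' - Im p\<bar> = \<bar>y' - t * Im p\<bar>"
      using ss ss' by (metis abs_mult mult_1 right_diff_distrib)+
    then have "cmod (?z - p) < \<epsilon>" using cmod_le[of "?z - p"] that by simp
    then have "?z \<in> ball p \<epsilon>" by (simp add: dist_norm norm_minus_commute)
    then have "?z \<in> ?P \<longleftrightarrow> \<not> (s * (Re ?z - Re p) > 0 \<and> t * (Im ?z - Im p) > 0)" by (rule c)
    then show ?thesis unfolding covered_reflect[OF st] mem_Union_rect by (simp add: right_diff_distrib ss')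
  qed
  have e2: "\<epsilon> / 2 > 0" using e by simp
  have q: "\<not> north_east V ?l ?r ?d ?u (s * Re p) (t * Im p)" "north_west V ?l ?r ?d ?u (s * Re p) (t * Im p)"
    "south_west V ?l ?r ?d ?u (s * Re p) (t * Im p)" "south_east V ?l ?r ?d ?u (s * Re p) (t * Im p)"
    by (rule north_east_concave[OF fin e2]; rule near; assumption)+
  have uq: "full V ?l ?r ?d ?u x y \<or> (x = s * Re p \<and> y = t * Im p)" if tq: "three_quadrants V ?l ?r ?d ?u x y" for x y
  proof (rule disjCI)
    assume n: "\<not> (x = s * Re p \<and> y = t * Im p)"
    show "full V ?l ?r ?d ?u x y"
    proof (rule ccontr)
      assume "\<not> full V ?l ?r ?d ?u x y"
      then have "concave_corner ?P (Complex (s * x) (t * y))"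
        using three_quadrants_concave_corner[OF fin] tq unfolding full_reflect[OF st] three_quadrants_reflect[OF st] by blast
      then have "Complex (s * x) (t * y) = p" using p by blast
      then show False using n ss' by auto
    qed
  qed
  have cn: "connected {z. full V ?l ?r ?d ?u (fst z) (snd z)}"
  proof -
    have eq: "{z. full V ?l ?r ?d ?u (fst z) (snd z)} = (\<lambda>z. (s * Re z, t * Im z)) ` interior ?P"
    proof (rule set_eqI)
      fix z :: "real \<times> real"
      have "z \<in> {z. full V ?l ?r ?d ?u (fst z) (snd z)} \<longleftrightarrow> Complex (s * fst z) (t * snd z) \<in> interior ?P"
        unfolding mem_interior_Union_rect[OF fin] by (simp add: full_reflect[OF st])
      also have "\<dots> \<longleftrightarrow> z \<in> (\<lambda>z. (s * Re z, t * Im z)) ` interior ?P"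
      proof
        assume "Complex (s * fst z) (t * snd z) \<in> interior ?P"
        then show "z \<in> (\<lambda>z. (s * Re z, t * Im z)) ` interior ?P"
          by (rule rev_image_eqI) (simp add: ss')
      next
        assume "z \<in> (\<lambda>z. (s * Re z, t * Im z)) ` interior ?P"
        then show "Complex (s * fst z) (t * snd z) \<in> interior ?P" by (auto simp: ss')
      qed
      finally show "z \<in> {z. full V ?l ?r ?d ?u (fst z) (snd z)} \<longleftrightarrow> z \<in> (\<lambda>z. (s * Re z, t * Im z)) ` interior ?P" .
    qed
    have "continuous_on (interior ?P) (\<lambda>z. (s * Re z, t * Im z))" by (intro continuous_intros)
    then show ?thesis
      unfolding eq using connected_interior_rectilinear[OF poly] by (rule connected_continuous_image)
  qed
  obtain X0 X1 Y0 Y1 where "L_plan V ?l ?r ?d ?u X0 (s * Re p) X1 Y0 (t * Im p) Y1"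
    by (rule L_shape[OF boxes_reflect[OF B] q]) (rule uq, assumption, rule cn, rule that)
  then show ?thesis by (rule that[OF st])
qed

section \<open>Floor-plans of properly triangulated plane graphs\<close>

text \<open>Lets \<open>cross_wall\<close> be applied to each of the four walls in turn while
  adjacency, common neighbours and open walls stay the same relations.\<close>

lemma cross_cycle_rotate:
  assumes "boxes V l r d u" "cross V l r d u x y m1 m2 m3 m4"
  obtains l' r' d' u' x' y' where "boxes V l' r' d' u'" "cross V l' r' d' u' x' y' m2 m3 m4 m1"
    "meets l' r' d' u' = meets l r d u" "common V l' r' d' u' = common V l r d u"
    "open_wall V l' r' d' u' = open_wall V l r d u"
proof (rule that)
  show "boxes V (\<lambda>v. - u v) (\<lambda>v. - d v) l r" using assms(1) boxes_rotate by blast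
  show "cross V (\<lambda>v. - u v) (\<lambda>v. - d v) l r (- y) x m2 m3 m4 m1" using assms(2) by (rule cross_rotate[THEN iffD1])
  show "meets (\<lambda>v. - u v) (\<lambda>v. - d v) l r = meets l r d u" by (intro ext) (rule meets_rotate[symmetric])
  show "common V (\<lambda>v. - u v) (\<lambda>v. - d v) l r = common V l r d u" by (intro ext) (rule common_rotate[symmetric])
  show "open_wall V (\<lambda>v. - u v) (\<lambda>v. - d v) l r = open_wall V l r d u"
    by (intro ext) (rule open_wall_rotate[symmetric])
qed

lemma interiors_disjoint_coordinates:
  assumes i: "interior (rect l r d u v) \<inter> interior (rect l r d u w) = {}"
    and p: "l v < r v" "d v < u v" "l w < r w" "d w < u w"
  shows "r v \<le> l w \<or> r w \<le> l v \<or> u v \<le> d w \<or> u w \<le> d v"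
proof (rule ccontr)
  assume "\<not> ?thesis"
  then have "max (l v) (l w) < min (r v) (r w)" "max (d v) (d w) < min (u v) (u w)" using p by auto
  then obtain x y where "max (l v) (l w) < x" "x < min (r v) (r w)" "max (d v) (d w) < y" "y < min (u v) (u w)"
    using dense by meson
  then have "Complex x y \<in> interior (rect l r d u v) \<inter> interior (rect l r d u w)"
    unfolding Int_iff mem_interior_rect by simp
  then show False using i by blast
qed

text \<open>Either the north-west module at the concave corner reaches below it and shares a
  vertical wall with the south-east one, or it stands on the south-west one. Both walls contain the
  concave corner.\<close>

lemma (in L_plan) exists_open_wall:
  obtains a b where "a \<in> V" "b \<in> V" "meets l r d u a b" "open_wall V l r d u a b"
proof -
  obtain A where A: "A \<in> V" "l A < px" "px \<le> r A" "d A \<le> py" "py < u A"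
    using north_west_iff[of px py] order unfolding north_west_def by auto
  obtain B where B: "B \<in> V" "l B < px" "px \<le> r B" "d B < py" "py \<le> u B"
    using south_west_iff[of px py] order unfolding south_west_def by auto
  obtain C where C: "C \<in> V" "l C \<le> px" "px < r C" "d C < py" "py \<le> u C"
    using south_east_iff[of px py] order unfolding south_east_def by auto
  have rA: "r A = px" and uC: "u C = py" using bounds(5)[OF A(1)] bounds(5)[OF C(1)] A C by linarith+
  have nf: "\<not> full V l r d u px py" unfolding full_iff by simp
  note p = proper[OF A(1)] proper[OF B(1)] proper[OF C(1)]
  show ?thesis
  proof (cases "d A < py")
    case True
    have AC: "A \<noteq> C" using rA C by auto
    have lC: "l C = px" using disjoint[OF A(1) C(1) AC] A C rA uC p True by linarith
    have "meets l r d u A C" unfolding meets_def using AC rA lC A C True uC by simp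
    moreover have "open_wall V l r d u A C" unfolding open_wall_def
      by (rule exI[of _ px], rule exI[of _ py]) (use A C rA uC nf in \<open>simp add: in_box_def\<close>)
    ultimately show ?thesis using that A(1) C(1) by blast
  next
    case False
    then have dA: "d A = py" using A by simp
    have AB: "A \<noteq> B" using dA B by auto
    have uB: "u B = py" using disjoint[OF A(1) B(1) AB] A B rA dA p by linarith
    have "meets l r d u A B" unfolding meets_def using AB rA dA A B uB by simp
    moreover have "open_wall V l r d u A B" unfolding open_wall_def
      by (rule exI[of _ px], rule exI[of _ py]) (use A B rA dA uB nf in \<open>simp add: in_box_def\<close>)
    ultimately show ?thesis using that A(1) B(1) by blast
  qed
qed

lemma (in L_plan) stretched_wall_shift:
  assumes A: "A \<in> V" "r A = px" "d A < py" "u A = Y1"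
  shows "wall_shift V l r d u l r d stretched X0 X1 Y0 Y1"
  unfolding wall_shift_def covered_def
  using boxes stretched_boxes[OF A] stretched_cover[OF A] stretched_meets[OF A] stretched_moved order by simp

text \<open>The assumption \<open>some_open\<close> serves to exclude points where four modules
  meet: their walls would make up the whole outer boundary without any of them being open.\<close>

locale ptpg_boxes = ptpg V E for V E +
  fixes l r d u :: "complex \<Rightarrow> real"
  assumes boxes: "boxes V l r d u"
    and adj_meets: "\<And>v w. v \<in> V \<Longrightarrow> w \<in> V \<Longrightarrow> adj V E v w \<longleftrightarrow> meets l r d u v w"
    and some_open: "\<exists>a\<in>V. \<exists>b\<in>V. meets l r d u a b \<and> open_wall V l r d u a b"
begin

lemma commonI: "v \<in> V \<Longrightarrow> w \<in> V \<Longrightarrow> adj V E v k \<Longrightarrow> adj V E w k \<Longrightarrow> common V l r d u v w k"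
  unfolding common_def using adj_meets adj_vertices by blast

lemma unique_common_boundary:
  assumes V: "v \<in> V" "w \<in> V" and m: "meets l r d u v w"
    and un: "\<And>k k'. common V l r d u v w k \<Longrightarrow> common V l r d u v w k' \<Longrightarrow> k = k'"
  shows "boundary_adj V E v w"
proof (rule ccontr)
  assume n: "\<not> ?thesis"
  have a: "adj V E v w" using adj_meets[OF V] m by simp
  show False
    by (rule inner_edge_two_common[OF a n]) (use un commonI[OF V] in blast)
qed

lemma open_wall_boundary:
  assumes "v \<in> V" "w \<in> V" "meets l r d u v w" "open_wall V l r d u v w"
  shows "boundary_adj V E v w"
  using unique_common_boundary[OF assms(1-3)] open_wall_common_unique[OF boxes assms] by metis

lemma no_cross: "\<not> cross V l r d u x y m1 m2 m3 m4"
proof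
  assume c: "cross V l r d u x y m1 m2 m3 m4"
  \<comment> \<open>The properties of one wall at the crossing, stated without coordinates so that
    they can be carried around by rotation.\<close>
  define G where "G a b \<longleftrightarrow> a \<in> V \<and> b \<in> V \<and> a \<noteq> b \<and> meets l r d u a b \<and>
    (\<forall>k k'. common V l r d u a b k \<longrightarrow> common V l r d u a b k' \<longrightarrow> k = k') \<and>
    (\<forall>k. common V l r d u a b k \<longrightarrow> \<not> open_wall V l r d u a b)" for a b
  have main: "G a b \<and> \<not> meets l r d u a c \<and> a \<noteq> c"
    if "boxes V l' r' d' u'" "cross V l' r' d' u' x' y' a b c e" "meets l' r' d' u' = meets l r d u"
      "common V l' r' d' u' = common V l r d u" "open_wall V l' r' d' u' = open_wall V l r d u"
    for l' r' d' u' x' y' a b c e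
  proof -
    have "a \<in> V" "b \<in> V" using that(2) unfolding cross_def by blast+
    moreover note w = cross_wall[OF that(1,2), unfolded that(3-5)]
    ultimately show ?thesis unfolding G_def using w by blast
  qed
  obtain l1 r1 d1 u1 x1 y1 where 1: "boxes V l1 r1 d1 u1" "cross V l1 r1 d1 u1 x1 y1 m2 m3 m4 m1"
    "meets l1 r1 d1 u1 = meets l r d u" "common V l1 r1 d1 u1 = common V l r d u" "open_wall V l1 r1 d1 u1 = open_wall V l r d u"
    by (rule cross_cycle_rotate[OF boxes c]) (rule that)
  obtain l2 r2 d2 u2 x2 y2 where 2: "boxes V l2 r2 d2 u2" "cross V l2 r2 d2 u2 x2 y2 m3 m4 m1 m2"
    "meets l2 r2 d2 u2 = meets l r d u" "common V l2 r2 d2 u2 = common V l r d u" "open_wall V l2 r2 d2 u2 = open_wall V l r d u"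
    by (rule cross_cycle_rotate[OF 1(1,2), unfolded 1(3-5)]) (rule that)
  obtain l3 r3 d3 u3 x3 y3 where 3: "boxes V l3 r3 d3 u3" "cross V l3 r3 d3 u3 x3 y3 m4 m1 m2 m3"
    "meets l3 r3 d3 u3 = meets l r d u" "common V l3 r3 d3 u3 = common V l r d u" "open_wall V l3 r3 d3 u3 = open_wall V l r d u"
    by (rule cross_cycle_rotate[OF 2(1,2), unfolded 2(3-5)]) (rule that)
  have G: "G m1 m2" "G m2 m3" "G m3 m4" "G m4 m1"
    and opp: "\<not> meets l r d u m1 m3" "\<not> meets l r d u m2 m4" "\<not> meets l r d u m3 m1" "\<not> meets l r d u m4 m2" "m1 \<noteq> m3" "m2 \<noteq> m4"
    using main[OF boxes c refl refl refl] main[OF 1] main[OF 2] main[OF 3] by simp_all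
  have bG: "boundary_adj V E a b" if "G a b" for a b
    using unique_common_boundary[of a b] that unfolding G_def by simp
  note b = G[THEN bG]
  have d: "distinct [m1, m2, m3, m4]" using G opp(5,6) unfolding G_def by auto
  have d': "distinct [m2, m3, m4, m1]" "distinct [m3, m4, m1, m2]" "distinct [m4, m1, m2, m3]" using d by auto
  \<comment> \<open>Each of the four edges lies on a cycle and thus borders a triangle. This turns
    the last clause of \<open>G\<close> into the statement that no wall at the crossing is
    open.\<close>
  have cm: "\<exists>k. common V l r d u m1 m2 k" "\<exists>k. common V l r d u m2 m3 k" "\<exists>k. common V l r d u m3 m4 k" "\<exists>k. common V l r d u m4 m1 k"
  proof -
    have *: "\<exists>k. common V l r d u a b k" if "G a b" "adj V E a w" "adj V E b w" for a b w
      using commonI[of a b w] that unfolding G_def by blast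
    show "\<exists>k. common V l r d u m1 m2 k" by (rule four_cycle_common[OF b d]) (rule *[OF G(1)])
    show "\<exists>k. common V l r d u m2 m3 k" by (rule four_cycle_common[OF b(2,3,4,1) d'(1)]) (rule *[OF G(2)])
    show "\<exists>k. common V l r d u m3 m4 k" by (rule four_cycle_common[OF b(3,4,1,2) d'(2)]) (rule *[OF G(3)])
    show "\<exists>k. common V l r d u m4 m1 k" by (rule four_cycle_common[OF b(4,1,2,3) d'(3)]) (rule *[OF G(4)])
  qed
  have no: "\<not> open_wall V l r d u m1 m2" "\<not> open_wall V l r d u m2 m3" "\<not> open_wall V l r d u m3 m4" "\<not> open_wall V l r d u m4 m1"
    using G cm unfolding G_def by blast+
  obtain p q where pq: "p \<in> V" "q \<in> V" "meets l r d u p q" "open_wall V l r d u p q" using some_open by blast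
  have bpq: "boundary_adj V E p q" "boundary_adj V E q p"
    using open_wall_boundary[OF pq] boundary_adj_sym by blast+
  \<comment> \<open>The open wall is a boundary edge, so both its modules belong to the crossing.
    But opposite modules there do not meet, and neighbouring ones have no open wall.\<close>
  have "p \<in> {m1, m2, m3, m4}" "q \<in> {m1, m2, m3, m4}"
    using boundary_four_cycle[OF b d bpq(1)] boundary_four_cycle[OF b d bpq(2)] .
  moreover have "p \<noteq> q" using pq(3) unfolding meets_def by blast
  ultimately show False
    using pq(3,4) no opp open_wall_sym[of V l r d u] by auto
qed

lemma boundary_open_wall:
  assumes b: "boundary_adj V E v w"
  shows "open_wall V l r d u v w"
proof (rule ccontr)
  assume n: "\<not> ?thesis"
  have a: "adj V E v w" using boundary_adj_adj[OF b] .
  have V: "v \<in> V" "w \<in> V" using adj_vertices[OF a] by blast+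
  obtain k k' where k: "k \<noteq> k'" "common V l r d u v w k" "common V l r d u v w k'"
    by (rule closed_wall[OF boxes V _ n]) (use a adj_meets[OF V] no_cross that in auto)
  then have "adj V E v k" "adj V E w k" "adj V E v k'" "adj V E w k'"
    using adj_meets V unfolding common_def by blast+
  then show False using boundary_edge_common_unique[OF b] k(1) by blast
qed

end

lemma (in ptpg) boundary_adj_exterior:
  "boundary_adj V E v w \<Longrightarrow> v \<in> exterior_vertices V E \<and> w \<in> exterior_vertices V E"
  unfolding exterior_vertices_def using edge_props(2)[of v w] boundary_adj_edge[of v w] by blast

theorem theorem3:
  fixes V :: "complex set" and E :: "complex set set"
  assumes "PTPG V E"
    and "\<exists>F. L_shaped_floor_plan F \<and> nontrivial F \<and> corresponds F V E"
  shows "(finite (CIPs V E) \<and> card (CIPs V E) \<le> 5) \<and>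
    (\<exists>a\<in>exterior_vertices V E. \<exists>b\<in>exterior_vertices V E. \<exists>c\<in>exterior_vertices V E.
       a \<noteq> c \<and> adj V E a b \<and> adj V E b c \<and> \<not> adj V E a c \<and>
       (\<forall>w\<in>V. adj V E a w \<and> adj V E c w \<longrightarrow> w = b))"
proof -
  interpret ptpg V E by unfold_locales (rule assms(1))
  obtain F where F: "L_shaped_floor_plan F" "nontrivial F" "corresponds F V E" using assms(2) by blast
  obtain \<phi> where \<phi>: "bij_betw \<phi> V F" and adjF: "\<And>v w. v \<in> V \<Longrightarrow> w \<in> V \<Longrightarrow> adjacent_modules (\<phi> v) (\<phi> w) \<longleftrightarrow> adj V E v w"
    using F(3) unfolding corresponds_def by blast
  have \<phi>F: "\<phi> v \<in> F" if "v \<in> V" for v using \<phi> that by (rule bij_betw_apply)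
  have "\<forall>v\<in>V. \<exists>ab. Re (fst ab) < Re (snd ab) \<and> Im (fst ab) < Im (snd ab) \<and> \<phi> v = cbox (fst ab) (snd ab)"
  proof
    fix v assume "v \<in> V"
    then have "rectangle (\<phi> v)" using \<phi>F F(1) unfolding L_shaped_floor_plan_def by blast
    then obtain a b where "Re a < Re b" "Im a < Im b" "\<phi> v = cbox a b" unfolding rectangle_def by blast
    then show "\<exists>ab. Re (fst ab) < Re (snd ab) \<and> Im (fst ab) < Im (snd ab) \<and> \<phi> v = cbox (fst ab) (snd ab)"
      by (intro exI[of _ "(a, b)"]) simp
  qed
  then obtain ab where ab: "\<And>v. v \<in> V \<Longrightarrow> Re (fst (ab v)) < Re (snd (ab v)) \<and> Im (fst (ab v)) < Im (snd (ab v)) \<and>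
      \<phi> v = cbox (fst (ab v)) (snd (ab v))" by metis
  define l0 r0 d0 u0 where "l0 v = Re (fst (ab v))" and "r0 v = Re (snd (ab v))"
    and "d0 v = Im (fst (ab v))" and "u0 v = Im (snd (ab v))" for v
  have pr: "l0 v < r0 v" "d0 v < u0 v" "\<phi> v = rect l0 r0 d0 u0 v" if "v \<in> V" for v
    using ab[OF that] unfolding l0_def r0_def d0_def u0_def rect_def by simp_all
  have FV: "F = rect l0 r0 d0 u0 ` V"
    using \<phi> pr(3) unfolding bij_betw_def by (metis image_cong)
  have B0: "boxes V l0 r0 d0 u0"
    unfolding boxes_def
  proof (intro conjI ballI impI)
    show "finite V" by (rule finite_vertices)
    show "l0 v < r0 v" "d0 v < u0 v" if "v \<in> V" for v using pr[OF that] by auto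
    fix v w assume vw: "v \<in> V" "w \<in> V" "v \<noteq> w"
    have "\<phi> v \<noteq> \<phi> w" using \<phi> vw unfolding bij_betw_def inj_on_def by blast
    then have "interior (\<phi> v) \<inter> interior (\<phi> w) = {}"
      using F(1) \<phi>F vw unfolding L_shaped_floor_plan_def floor_plan_def pairwise_def by blast
    then show "r0 v \<le> l0 w \<or> r0 w \<le> l0 v \<or> u0 v \<le> d0 w \<or> u0 w \<le> d0 v"
      using interiors_disjoint_coordinates[of l0 r0 d0 u0 v w] pr vw by simp
  qed
  obtain s t X0 px X1 Y0 py Y1 where st: "s \<in> {- 1, 1}" "t \<in> {- 1, 1}"
    and L: "L_plan V (lo s l0 r0) (hi s l0 r0) (lo t d0 u0) (hi t d0 u0) X0 px X1 Y0 py Y1"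
    by (rule L_shaped_normal_form[OF B0 F(1)[unfolded FV]]) (rule that)
  define l r d u where "l = lo s l0 r0" and "r = hi s l0 r0" and "d = lo t d0 u0" and "u = hi t d0 u0"
  interpret L: L_plan V l r d u X0 px X1 Y0 py Y1 using L unfolding l_def r_def d_def u_def .
  have am: "adj V E v w \<longleftrightarrow> meets l r d u v w" if "v \<in> V" "w \<in> V" for v w
    using adjF[OF that] adjacent_rects[OF B0 that] pr(3)[OF that(1)] pr(3)[OF that(2)]
    unfolding l_def r_def d_def u_def meets_reflect by simp
  interpret P: ptpg_boxes V E l r d u
  proof
    show "boxes V l r d u" by (rule L.boxes)
    show "adj V E v w \<longleftrightarrow> meets l r d u v w" if "v \<in> V" "w \<in> V" for v w by (rule am[OF that])
    show "\<exists>a\<in>V. \<exists>b\<in>V. meets l r d u a b \<and> open_wall V l r d u a b" by (rule L.exists_open_wall) blast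
  qed
  \<comment> \<open>The reflections are involutions, so a shift in the normalised coordinates gives
    one of the original floor-plan, which is non-trivial.\<close>
  have not_shift: "\<not> wall_shift V l r d u l' r' d' u' A0 A1 B0 B1" for l' r' d' u' A0 A1 B0 B1
  proof
    assume w: "wall_shift V l r d u l' r' d' u' A0 A1 B0 B1"
    have e: "lo s l r = l0" "hi s l r = r0" "lo t d u = d0" "hi t d u = u0"
      unfolding l_def r_def d_def u_def by (rule lo_hi_involution)+
    have "\<not> nontrivial (rect l0 r0 d0 u0 ` V)"
      by (rule wall_shift_reflect[OF w, of s t, unfolded e]) (rule wall_shift_trivial)
    then show False using F(2) FV by simp
  qed
  have con: "(x, y) \<in> {(x, y). x \<in> V - {K} \<and> y \<in> V - {K} \<and> meets l r d u x y}\<^sup>*"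
    if "K \<in> V" "x \<in> V - {K}" "y \<in> V - {K}" for K x y
  proof -
    have "{(x, y). x \<in> V - {K} \<and> y \<in> V - {K} \<and> meets l r d u x y} = {(x, y). x \<in> V - {K} \<and> y \<in> V - {K} \<and> adj V E x y}"
      using am by auto
    then show ?thesis using connected_minus_vertex[OF that] by simp
  qed
  have corner: "\<exists>v\<in>set us. v \<noteq> hd us \<and> v \<noteq> last us \<and> L.corner v" if cip: "corner_implying_path V E us" for us
  proof -
    note ch = corner_implying_path_chordal[OF cip, unfolded chordal_def]
    have us: "set us \<subseteq> V" "length us \<ge> 3" using cip unfolding corner_implying_path_def by blast+
    have "hd us \<in> V" "last us \<in> V" using us by (cases us; force)+
    moreover have "adj V E (hd us) (last us)" "\<not> boundary_adj V E (hd us) (last us)" using ch by blast+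
    ultimately have e: "meets l r d u (hd us) (last us)" "\<not> open_wall V l r d u (hd us) (last us)"
      using am P.open_wall_boundary by blast+
    have "successively (boundary_adj V E) us" using ch by blast
    then have "successively (open_wall V l r d u) us" by (rule successively_mono) (rule P.boundary_open_wall)
    then show ?thesis using L.chain_has_corner[OF us _ e con] ch by blast
  qed
  \<comment> \<open>A path is given only up to reversal, which changes neither its inner vertices
    nor which of them are corner modules.\<close>
  define pick where "pick \<kappa> = (SOME v. \<exists>us. \<kappa> = {us, rev us} \<and> corner_implying_path V E us \<and> v \<in> set us \<and>
      v \<noteq> hd us \<and> v \<noteq> last us \<and> L.corner v)" for \<kappa>
  have pick: "\<exists>us. \<kappa> = {us, rev us} \<and> corner_implying_path V E us \<and> pick \<kappa> \<in> set us \<and>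
      pick \<kappa> \<noteq> hd us \<and> pick \<kappa> \<noteq> last us \<and> L.corner (pick \<kappa>)" if k: "\<kappa> \<in> CIPs V E" for \<kappa>
  proof -
    obtain us where us: "\<kappa> = {us, rev us}" "corner_implying_path V E us" using k unfolding CIPs_def by blast
    obtain v where "v \<in> set us" "v \<noteq> hd us" "v \<noteq> last us" "L.corner v" using corner[OF us(2)] by blast
    then have ex: "\<exists>v us. \<kappa> = {us, rev us} \<and> corner_implying_path V E us \<and> v \<in> set us \<and>
        v \<noteq> hd us \<and> v \<noteq> last us \<and> L.corner v"
      using us by (intro exI conjI)
    show ?thesis unfolding pick_def by (rule someI_ex[OF ex])
  qed
  \<comment> \<open>Paths with a common inner vertex agree up to reversal, so no corner module is
    picked for two of them.\<close>
  have inj: "inj_on pick (CIPs V E)"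
  proof (rule inj_onI)
    fix \<kappa> \<kappa>' assume k: "\<kappa> \<in> CIPs V E" "\<kappa>' \<in> CIPs V E" and eq: "pick \<kappa> = pick \<kappa>'"
    obtain us where us: "\<kappa> = {us, rev us}" "corner_implying_path V E us" "pick \<kappa> \<in> set us" "pick \<kappa> \<noteq> hd us" "pick \<kappa> \<noteq> last us"
      using pick[OF k(1)] by blast
    obtain vs where vs: "\<kappa>' = {vs, rev vs}" "corner_implying_path V E vs" "pick \<kappa> \<in> set vs" "pick \<kappa> \<noteq> hd vs" "pick \<kappa> \<noteq> last vs"
      using pick[OF k(2)] unfolding eq by blast
    have "vs = us \<or> vs = rev us"
      by (rule chordal_interior_unique[OF corner_implying_path_chordal[OF us(2)] corner_implying_path_chordal[OF vs(2)] us(3-5) vs(3-5)])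
    then show "\<kappa> = \<kappa>'" using us(1) vs(1) by auto
  qed
  have sub: "pick ` CIPs V E \<subseteq> {v \<in> V. L.corner v}"
  proof
    fix v assume "v \<in> pick ` CIPs V E"
    then obtain \<kappa> where k: "\<kappa> \<in> CIPs V E" "v = pick \<kappa>" by blast
    obtain us where us: "corner_implying_path V E us" "pick \<kappa> \<in> set us" "L.corner (pick \<kappa>)"
      using pick[OF k(1)] by metis
    have "set us \<subseteq> V" using us(1) unfolding corner_implying_path_def by metis
    then show "v \<in> {v \<in> V. L.corner v}" using us(2,3) k(2) by auto
  qed
  have i: "finite (CIPs V E) \<and> card (CIPs V E) \<le> 5"
    using L.card_corners inj_on_finite[OF inj sub] card_inj_on_le[OF inj sub] by linarith
  have "\<exists>a\<in>exterior_vertices V E. \<exists>b\<in>exterior_vertices V E. \<exists>c\<in>exterior_vertices V E.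
       a \<noteq> c \<and> adj V E a b \<and> adj V E b c \<and> \<not> adj V E a c \<and> (\<forall>w\<in>V. adj V E a w \<and> adj V E c w \<longrightarrow> w = b)"
  proof (cases rule: L.concave_corner_cases)
    case (1 a b c)
    note g = 1[unfolded L.good_triple_def]
    have V: "a \<in> V" "b \<in> V" "c \<in> V" using g by blast+
    \<comment> \<open>The open walls of the triplet are what places its three vertices on the outer
      boundary.\<close>
    have "boundary_adj V E a b" "boundary_adj V E b c" using g P.open_wall_boundary by blast+
    then have ext: "a \<in> exterior_vertices V E" "b \<in> exterior_vertices V E" "c \<in> exterior_vertices V E"
      using boundary_adj_exterior by blast+
    have "a \<noteq> c \<and> adj V E a b \<and> adj V E b c \<and> \<not> adj V E a c \<and> (\<forall>w\<in>V. adj V E a w \<and> adj V E c w \<longrightarrow> w = b)"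
    proof (intro conjI ballI impI)
      show "a \<noteq> c" "adj V E a b" "adj V E b c" "\<not> adj V E a c"
        unfolding am[OF V(1,2)] am[OF V(2,3)] am[OF V(1,3)] using g by blast+
      fix w assume w: "w \<in> V" "adj V E a w \<and> adj V E c w"
      then have "meets l r d u a w \<and> meets l r d u c w" using am[OF V(1) w(1)] am[OF V(3) w(1)] by simp
      then show "w = b" using g w(1) by blast
    qed
    then show ?thesis using ext by (intro bexI)
  next
    case (2 A)
    then show ?thesis using L.stretched_wall_shift not_shift by blast
  next
    case (3 C)
    \<comment> \<open>A module covering the whole horizontal wall is the previous case in the
      transposed plan, where the missing quadrant is again north-east.\<close>
    interpret T: L_plan V d u l r Y0 py Y1 X0 px X1 by (rule L.L_plan_transpose)
    show ?thesis using wall_shift_transpose[OF T.stretched_wall_shift[OF 3]] not_shift by blast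
  qed
  then show ?thesis using i by (rule conjI[rotated])
qed

end
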